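(* Let $(X,\mathcal B,\mu,T)$ be a system satisfying conditions (c1)--(c6) listed in the context, assume that $\mu$ is liftable to the Hofbauer tower with lift $\hat\mu$, and let $(Y,\mathcal C,\nu,F)$ with $Y=\bigsqcup_{u\in\alpha}R_u$ be the system of rugs defined in the context. To a.e. $z\in Y$ assign the two-sided sequence $\psi(z)=(b_k)_{k\in\mathbb Z}\in\alpha^{\mathbb Z}$ with $b_k=u$ if $F^kz\in R_u$. Let $\Omega=\psi(Y)$, $\mathcal P$ the product $\sigma$-algebra on $\Omega$, $\sigma$ the left shift, and $m_{\underline v}=m_{\underline v,P}$ the Markov measure given by the probability vector $\underline v=(v_u)_{u\in\alpha}$, $v_u=\hat\mu(D_u)$, and the (possibly infinite) probability matrix $P=(p_{t,u})_{t,u\in\alpha}$, $$p_{t,u}=\frac{\bar\mu(D_t\cap\hat T^{-1}D_u)}{\bar\mu(D_t)}.$$ Then the systems $(Y,\mathcal C,\nu,F)$ and $(\Omega,\mathcal P,m_{\underline v},\sigma)$ are isomorphic with isomorphism $\psi$; i.e., on sets of full measure, $\psi$ is bi-measurable, surjective and injective, $m_{\underline v}=\nu\circ\psi^{-1}$, and $\psi\circ F=\sigma\circ\psi$.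
   Context: **Setting.** $X\subset\mathbb R^n$ is compact, $\mathcal B$ is the Lebesgue $\sigma$-algebra on $X$, $\mu$ is a probability measure on $(X,\mathcal B)$ (not assumed $T$-invariant). $\mathcal Z=\{Z_1,\dots,Z_N\}$ is a collection of closed sets with $\mu(Z_j)>0$, $\mu(Z_i\cap Z_j)=0$ for $i\ne j$, $\mu(\bigcup_j Z_j)=1$, and $T:X\to X$. Conditions: (c1) for each $Z\in\mathcal Z$, $T$ can be extended uniquely to a continuous injective map $T_Z:Z\to\overline{T(\operatorname{int}Z)}$; (c2) for each $A\in\mathcal B$ also $TA,T^{-1}A\in\mathcal B$, and $\mu(A)=0$ implies $\mu(T^{-1}A)=0$; (c3) $\bigvee_{k\ge0}T^{-k}\mathcal Z=\mathcal B$, i.e. $\mathcal B$ is the smallest $\sigma$-algebra containing all cylinder sets (elements of $\mathcal Z_n:=\bigvee_{k=0}^nT^{-k}\mathcal Z$); (c4) for each $j$ there is a constant $s_j\ge1$ with $\mu(TA)=s_j\mu(A)$ for all measurable $A\subseteq Z_j$; (c5) $\mu$ is ergodic: $T^{-1}A=A$, $A\in\mathcal B$, implies $\mu(A)\in\{0,1\}$ (no invariance implied); (c6) $\mu\big(\bigcup_nT^n(\bigcup_{j=1}^N\partial Z_j)\big)=0$, with $\partial$ the topological boundary. **Hofbauer tower.** $\mathcal Z_n$ consists of the $(n+1)$-cylinders $Z_{j_0\cdots j_n}=Z_{j_0}\cap T^{-1}Z_{j_1}\cap\dots\cap T^{-n}Z_{j_n}$ of positive $\mu$-measure. $\mathcal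 D$ is the set of equivalence classes of the closures of the sets $T^nZ_{j_0\cdots j_n}$ ($n\ge0$), where two sets are equivalent if their symmetric difference has $\mu$-measure $0$; elements of $\mathcal D$ are also treated as subsets of $X$. Write $\mathcal D=\{D_u:u\in\alpha\}$ with $\alpha\subseteq\mathbb N$ an ordered index set and $D_u=Z_u$ for $1\le u\le N$. The tower is the disjoint union $\hat X=\bigsqcup_{u\in\alpha}D_u$, with points $\hat x=(x,D)$; its base is $\hat X_0=\bigsqcup_{u=1}^ND_u$; $\pi(x,D)=x$; $\hat{\mathcal B}=\mathcal D\vee\pi^{-1}(\mathcal B)$ is the Lebesgue $\sigma$-algebra on $\hat X$. If $\mu(Z_j\cap TD)>0$ then $D'=Z_j\cap TD\in\mathcal D$ and one writes $D\to D'$. The map $\hat T:\hat X\to\hat X$ is $\hat T(x,D)=(Tx,Z_j\cap TD)$ if $Tx\in Z_j$. So $\pi\circ\hat T=T\circ\pi$. **Lifting.** $\bar\mu(A)=\sum_{D\in\mathcal D}\mu(\pi(A\cap D))$ for $A\in\hat{\mathcal B}$, and $\hat\mu_n(A)=\frac1n\sum_{k=0}^{n-1}\bar\mu(\hat T^{-k}A\cap\hat X_0)$. $\mu$ is liftable, and lifts to $\hat\mu$, if $(\hat\mu_n)$ converges in the vague topology (weak topology on compacta) to a non-zero measure $\hat\mu$ (then a probability measure). On each $D\in\mathcal D$ the density $\frac{d\hat\mu}{d\bar\mu}$ is the constant $\rho(D)=\hat\mu(D)/\bar\mu(D)$. **The system $(Y,\mathcal C,\nu,F)$.** Only the $D_u$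 with $\hat\mu(D_u)>0$ are kept, and $\alpha$ denotes the set of their indices. The rug of $D_u$ is $R_u=D_u\times[0,\rho(D_u)]$; $Y=\bigsqcup_{u\in\alpha}R_u$; $\mathcal C$ is the Borel $\sigma$-algebra on $Y$; $\nu$ is $\bar\mu\times m$ on each rug, $m$ being one-dimensional Lebesgue measure. For $z=(\hat x,y,u)\in R_u$ with $\pi(\hat x)\in Z_j$ and $\hat T\hat x\in D_v$, $$F(\hat x,y,u)=\Big(\hat T\hat x,\ \frac y{s_j}+\sum_{1\le k\le N}\ \sum_{t<u:\ \pi^{-1}(Z_k)\supset D_t\to D_v}\frac{\rho(D_t)}{s_k},\ v\Big),$$ which is well-defined on a set of full $\nu$-measure and invertible $\nu$-a.e.
   Formalization: The measure μ is additionally assumed to have no atoms (the claim fails for every liftable μ with an atom, since ψ then forgets the height y); (c3) is required only modulo μ-null sets, and interiors and boundaries are taken relative to X. *)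

theory Defs
  imports "HOL-Probability.Probability"
begin

definition null_equal :: "'a measure \<Rightarrow> 'a set \<Rightarrow> 'a set \<Rightarrow> bool" where
  "null_equal M A B \<longleftrightarrow> (A - B) \<union> (B - A) \<in> null_sets M"

text \<open>
  The word \<open>[j\<^sub>0, \<dots>, j\<^sub>n]\<close> encodes \<open>Z\<^sub>j\<^sub>0 \<inter> T\<^sup>-\<^sup>1 Z\<^sub>j\<^sub>1 \<inter> \<dots> \<inter> T\<^sup>-\<^sup>n Z\<^sub>j\<^sub>n\<close>; the phase space \<open>X\<close> is always
  \<open>space M\<close>.
\<close>

definition cylinder :: "'a measure \<Rightarrow> (nat \<Rightarrow> 'a set) \<Rightarrow> ('a \<Rightarrow> 'a) \<Rightarrow> nat list \<Rightarrow> 'a set" where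
  "cylinder M Z T w = {x \<in> space M. \<forall>i<length w. (T ^^ i) x \<in> Z (w ! i)}"

definition words :: "'a measure \<Rightarrow> nat \<Rightarrow> (nat \<Rightarrow> 'a set) \<Rightarrow> ('a \<Rightarrow> 'a) \<Rightarrow> nat list set" where
  "words M N Z T = {w. w \<noteq> [] \<and> set w \<subseteq> {1..N} \<and> emeasure M (cylinder M Z T w) > 0}"

text \<open>
  Interiors and boundaries are taken in the phase space \<open>X\<close>, i.e. in its subspace topology
  (closures in \<open>X\<close> and in the ambient space agree, since \<open>X\<close> is compact). In \<open>c1\<close> it is the
  restriction of \<open>T\<close> to the interior of \<open>Z\<^sub>j\<close> that is extended: \<open>T\<close> itself may be discontinuous on the
  boundary. In \<open>c3\<close> the two \<open>\<sigma>\<close>-algebras agree modulo null sets; literal equality is impossible, as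
  a countably generated \<open>\<sigma>\<close>-algebra has at most continuum many elements, while the Lebesgue
  \<open>\<sigma>\<close>-algebra is usually larger.
\<close>

locale piecewise_system = prob_space M
  for M :: "'a::euclidean_space measure" +
  fixes X :: "'a set" and N :: nat and Z :: "nat \<Rightarrow> 'a set" and T :: "'a \<Rightarrow> 'a" and s :: "nat \<Rightarrow> real"
  assumes compact_X: "compact X"
    and sets_M: "sets M = sets (lebesgue_on X)"
    and Z_closed: "\<And>j. j \<in> {1..N} \<Longrightarrow> closed (Z j) \<and> Z j \<subseteq> X"
    and Z_pos: "\<And>j. j \<in> {1..N} \<Longrightarrow> emeasure M (Z j) > 0"
    and Z_overlap: "\<And>i j. i \<in> {1..N} \<Longrightarrow> j \<in> {1..N} \<Longrightarrow> i \<noteq> j \<Longrightarrow> emeasure M (Z i \<inter> Z j) = 0"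
    and Z_cover: "emeasure M (\<Union>j\<in>{1..N}. Z j) = 1"
    and T_into: "T \<in> X \<rightarrow> X"
    and c1: "\<And>j. j \<in> {1..N} \<Longrightarrow>
      \<exists>!g. g \<in> Z j \<rightarrow>\<^sub>E closure (T ` (top_of_set X interior_of Z j)) \<and>
           continuous_on (Z j) g \<and> inj_on g (Z j) \<and>
           (\<forall>x \<in> top_of_set X interior_of Z j. g x = T x)"
    and c2: "\<And>A. A \<in> sets M \<Longrightarrow>
      T ` A \<in> sets M \<and> T -` A \<inter> X \<in> sets M \<and>
      (emeasure M A = 0 \<longrightarrow> emeasure M (T -` A \<inter> X) = 0)"
    and c3: "\<And>A. A \<in> sets M \<Longrightarrow>
      \<exists>B \<in> sigma_sets X (cylinder M Z T ` words M N Z T). null_equal M A B"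
    and c4: "\<And>j. j \<in> {1..N} \<Longrightarrow> s j \<ge> 1 \<and>
      (\<forall>A \<in> sets M. A \<subseteq> Z j \<longrightarrow> emeasure M (T ` A) = ennreal (s j) * emeasure M A)"
    and c5: "\<And>A. A \<in> sets M \<Longrightarrow> T -` A \<inter> X = A \<Longrightarrow> emeasure M A = 0 \<or> emeasure M A = 1"
    and c6: "emeasure M (\<Union>n. (T ^^ n) ` (\<Union>j\<in>{1..N}. top_of_set X frontier_of Z j)) = 0"

definition tower_set :: "'a::topological_space measure \<Rightarrow> (nat \<Rightarrow> 'a set) \<Rightarrow> ('a \<Rightarrow> 'a) \<Rightarrow> nat list \<Rightarrow> 'a set" where
  "tower_set M Z T w = closure ((T ^^ (length w - 1)) ` cylinder M Z T w)"

text \<open>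
  An enumeration of \<open>\<D>\<close> by \<open>\<alpha>\<close>: \<open>D u\<close> is a representative of the \<open>u\<close>-th equivalence class. The last
  assumption is the property \<open>Z\<^sub>j \<inter> T D \<in> \<D>\<close> (up to equivalence), without which the tower map does
  not exist. It is not automatic: \<open>c6\<close> controls the images of the boundaries under \<open>T\<close>, not under
  the continuous extensions of the branches, and taking closures could thus add a set of positive
  measure.
\<close>

locale hofbauer_tower = piecewise_system M X N Z T s
  for M :: "'a::euclidean_space measure" and X N Z T s +
  fixes \<alpha> :: "nat set" and D :: "nat \<Rightarrow> 'a set"
  assumes base_index: "{1..N} \<subseteq> \<alpha>"
    and base_set: "\<And>u. u \<in> {1..N} \<Longrightarrow> D u = Z u"
    and D_tower_set: "\<And>u. u \<in> \<alpha> \<Longrightarrow> \<exists>w \<in> words M N Z T. D u = tower_set M Z T w"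
    and D_enum: "\<And>w. w \<in> words M N Z T \<Longrightarrow> \<exists>!u. u \<in> \<alpha> \<and> null_equal M (D u) (tower_set M Z T w)"
    and D_successor: "\<And>u j. u \<in> \<alpha> \<Longrightarrow> j \<in> {1..N} \<Longrightarrow> emeasure M (Z j \<inter> T ` D u) > 0 \<Longrightarrow>
      \<exists>v \<in> \<alpha>. null_equal M (D v) (Z j \<inter> T ` D u)"

text \<open>
  The point \<open>(x, D\<^sub>u)\<close> of the tower is encoded as \<open>(x, u)\<close>. As \<open>nat\<close> is discrete, the topology of the
  disjoint union is the subspace topology of the product type.
\<close>

definition level :: "(nat \<Rightarrow> 'a set) \<Rightarrow> nat \<Rightarrow> ('a \<times> nat) set" where
  "level D u = D u \<times> {u}"

definition tower :: "nat set \<Rightarrow> (nat \<Rightarrow> 'a set) \<Rightarrow> ('a \<times> nat) set" where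
  "tower \<alpha> D = (\<Union>u\<in>\<alpha>. level D u)"

definition tower_base :: "nat \<Rightarrow> (nat \<Rightarrow> 'a set) \<Rightarrow> ('a \<times> nat) set" where
  "tower_base N D = (\<Union>u\<in>{1..N}. level D u)"

definition arrow_via ::
  "'a measure \<Rightarrow> (nat \<Rightarrow> 'a set) \<Rightarrow> ('a \<Rightarrow> 'a) \<Rightarrow> (nat \<Rightarrow> 'a set) \<Rightarrow> nat \<Rightarrow> nat \<Rightarrow> nat \<Rightarrow> bool" where
  "arrow_via M Z T D j u v \<longleftrightarrow>
     emeasure M (Z j \<inter> T ` D u) > 0 \<and> null_equal M (D v) (Z j \<inter> T ` D u)"

definition arrow ::
  "'a measure \<Rightarrow> nat \<Rightarrow> (nat \<Rightarrow> 'a set) \<Rightarrow> ('a \<Rightarrow> 'a) \<Rightarrow> (nat \<Rightarrow> 'a set) \<Rightarrow> nat \<Rightarrow> nat \<Rightarrow> bool" where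
  "arrow M N Z T D u v \<longleftrightarrow> (\<exists>j\<in>{1..N}. arrow_via M Z T D j u v)"

text \<open>
  For almost every \<open>(x, u)\<close> in the tower exactly one index \<open>v\<close> qualifies, and \<open>T x \<in> D v\<close>; the
  \<open>LEAST\<close> only fixes values on the exceptional null set.
\<close>

definition tower_map ::
  "'a measure \<Rightarrow> nat \<Rightarrow> (nat \<Rightarrow> 'a set) \<Rightarrow> ('a \<Rightarrow> 'a) \<Rightarrow> nat set \<Rightarrow> (nat \<Rightarrow> 'a set) \<Rightarrow> 'a \<times> nat \<Rightarrow> 'a \<times> nat" where
  "tower_map M N Z T \<alpha> D = (\<lambda>(x, u).
     (T x, LEAST v. v \<in> \<alpha> \<and> (\<exists>j\<in>{1..N}. T x \<in> Z j \<and> arrow_via M Z T D j u v)))"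

definition bar_measure ::
  "'a measure \<Rightarrow> nat set \<Rightarrow> (nat \<Rightarrow> 'a set) \<Rightarrow> ('a \<times> nat) measure" where
  "bar_measure M \<alpha> D = measure_of (tower \<alpha> D)
     {A. A \<subseteq> tower \<alpha> D \<and> (\<forall>u\<in>\<alpha>. fst ` (A \<inter> level D u) \<in> sets M)}
     (\<lambda>A. \<integral>\<^sup>+u. emeasure M (fst ` (A \<inter> level D u)) \<partial>count_space \<alpha>)"

definition lift_average ::
  "'a measure \<Rightarrow> nat \<Rightarrow> (nat \<Rightarrow> 'a set) \<Rightarrow> ('a \<Rightarrow> 'a) \<Rightarrow> nat set \<Rightarrow> (nat \<Rightarrow> 'a set) \<Rightarrow> nat \<Rightarrow> ('a \<times> nat) measure" where
  "lift_average M N Z T \<alpha> D n = measure_of (tower \<alpha> D) (sets (bar_measure M \<alpha> D))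
     (\<lambda>A. ennreal (1 / real n) *
        (\<Sum>k<n. emeasure (bar_measure M \<alpha> D) ((tower_map M N Z T \<alpha> D ^^ k) -` A \<inter> tower_base N D)))"

definition lifts_to ::
  "'a::topological_space measure \<Rightarrow> nat \<Rightarrow> (nat \<Rightarrow> 'a set) \<Rightarrow> ('a \<Rightarrow> 'a) \<Rightarrow> nat set \<Rightarrow> (nat \<Rightarrow> 'a set) \<Rightarrow>
   ('a \<times> nat) measure \<Rightarrow> bool" where
  "lifts_to M N Z T \<alpha> D H \<longleftrightarrow>
     sets H = sets (bar_measure M \<alpha> D) \<and>
     (\<forall>K. compact K \<and> K \<subseteq> tower \<alpha> D \<longrightarrow> emeasure H K < \<infinity>) \<and>
     emeasure H (tower \<alpha> D) \<noteq> 0 \<and>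
     (\<forall>f :: 'a \<times> nat \<Rightarrow> real.
        continuous_on (tower \<alpha> D) f \<and>
        (\<exists>K. compact K \<and> K \<subseteq> tower \<alpha> D \<and> (\<forall>p \<in> tower \<alpha> D - K. f p = 0)) \<longrightarrow>
        (\<lambda>n. integral\<^sup>L (lift_average M N Z T \<alpha> D n) f) \<longlonglongrightarrow> integral\<^sup>L H f)"

text \<open>From here on \<open>H\<close> is the lift of \<open>M\<close>, and \<open>kept \<alpha> D H\<close> the reduced index set.\<close>

definition kept :: "nat set \<Rightarrow> (nat \<Rightarrow> 'a set) \<Rightarrow> ('a \<times> nat) measure \<Rightarrow> nat set" where
  "kept \<alpha> D H = {u \<in> \<alpha>. emeasure H (level D u) > 0}"

definition rho ::
  "'a measure \<Rightarrow> nat set \<Rightarrow> (nat \<Rightarrow> 'a set) \<Rightarrow> ('a \<times> nat) measure \<Rightarrow> nat \<Rightarrow> real" where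
  "rho M \<alpha> D H u = measure H (level D u) / measure (bar_measure M \<alpha> D) (level D u)"

text \<open>A point \<open>(x\<^sub>h, y, u)\<close> with \<open>x\<^sub>h = (x, D\<^sub>u)\<close> is encoded as \<open>((x, u), y)\<close>.\<close>

definition rug ::
  "'a measure \<Rightarrow> nat set \<Rightarrow> (nat \<Rightarrow> 'a set) \<Rightarrow> ('a \<times> nat) measure \<Rightarrow> nat \<Rightarrow> (('a \<times> nat) \<times> real) set" where
  "rug M \<alpha> D H u = level D u \<times> {0..rho M \<alpha> D H u}"

definition rug_space ::
  "'a measure \<Rightarrow> nat set \<Rightarrow> (nat \<Rightarrow> 'a set) \<Rightarrow> ('a \<times> nat) measure \<Rightarrow> (('a \<times> nat) \<times> real) set" where
  "rug_space M \<alpha> D H = (\<Union>u\<in>kept \<alpha> D H. rug M \<alpha> D H u)"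

definition rug_measure ::
  "'a::topological_space measure \<Rightarrow> nat set \<Rightarrow> (nat \<Rightarrow> 'a set) \<Rightarrow> ('a \<times> nat) measure \<Rightarrow>
   (('a \<times> nat) \<times> real) measure" where
  "rug_measure M \<alpha> D H = measure_of (rug_space M \<alpha> D H)
     (sets (restrict_space borel (rug_space M \<alpha> D H)))
     (emeasure (bar_measure M \<alpha> D \<Otimes>\<^sub>M lborel))"

definition rug_map ::
  "'a measure \<Rightarrow> nat \<Rightarrow> (nat \<Rightarrow> 'a set) \<Rightarrow> ('a \<Rightarrow> 'a) \<Rightarrow> (nat \<Rightarrow> real) \<Rightarrow> nat set \<Rightarrow> (nat \<Rightarrow> 'a set) \<Rightarrow>
   ('a \<times> nat) measure \<Rightarrow> ('a \<times> nat) \<times> real \<Rightarrow> ('a \<times> nat) \<times> real" where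
  "rug_map M N Z T s \<alpha> D H = (\<lambda>((x, u), y).
     let v = snd (tower_map M N Z T \<alpha> D (x, u)); j = (LEAST j. j \<in> {1..N} \<and> x \<in> Z j)
     in (tower_map M N Z T \<alpha> D (x, u),
         y / s j +
         (\<Sum>k\<in>{1..N}. \<Sum>t | t \<in> kept \<alpha> D H \<and> t < u \<and> D t \<subseteq> Z k \<and> arrow M N Z T D t v.
            rho M \<alpha> D H t / s k)))"

text \<open>
  Integer iterates of a map that restricts to a bijection of \<open>S\<close>. The set \<open>S\<close> will be a set of full
  measure; the itinerary depends on its choice only up to null sets.
\<close>

definition int_iterate :: "('z \<Rightarrow> 'z) \<Rightarrow> 'z set \<Rightarrow> int \<Rightarrow> 'z \<Rightarrow> 'z" where
  "int_iterate f S k = (if k \<ge> 0 then f ^^ nat k else inv_into S f ^^ nat (- k))"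

definition itinerary ::
  "'a measure \<Rightarrow> nat \<Rightarrow> (nat \<Rightarrow> 'a set) \<Rightarrow> ('a \<Rightarrow> 'a) \<Rightarrow> (nat \<Rightarrow> real) \<Rightarrow> nat set \<Rightarrow> (nat \<Rightarrow> 'a set) \<Rightarrow>
   ('a \<times> nat) measure \<Rightarrow> (('a \<times> nat) \<times> real) set \<Rightarrow> ('a \<times> nat) \<times> real \<Rightarrow> int \<Rightarrow> nat" where
  "itinerary M N Z T s \<alpha> D H S z = (\<lambda>k. THE u. u \<in> kept \<alpha> D H \<and>
     int_iterate (rug_map M N Z T s \<alpha> D H) S k z \<in> rug M \<alpha> D H u)"

definition lift_vector :: "(nat \<Rightarrow> 'a set) \<Rightarrow> ('a \<times> nat) measure \<Rightarrow> nat \<Rightarrow> real" where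
  "lift_vector D H u = measure H (level D u)"

definition transition_matrix ::
  "'a measure \<Rightarrow> nat \<Rightarrow> (nat \<Rightarrow> 'a set) \<Rightarrow> ('a \<Rightarrow> 'a) \<Rightarrow> nat set \<Rightarrow> (nat \<Rightarrow> 'a set) \<Rightarrow> nat \<Rightarrow> nat \<Rightarrow> real" where
  "transition_matrix M N Z T \<alpha> D t u =
     measure (bar_measure M \<alpha> D) (level D t \<inter> tower_map M N Z T \<alpha> D -` level D u) /
     measure (bar_measure M \<alpha> D) (level D t)"

text \<open>
  The cylinder values, at all positions \<open>k\<close>, determine the two-sided Markov measure on \<open>I\<^sup>\<int>\<close> uniquely.
  Its total mass is the sum of the entries of \<open>v\<close>.
\<close>

definition markov_measure ::
  "nat set \<Rightarrow> (nat \<Rightarrow> real) \<Rightarrow> (nat \<Rightarrow> nat \<Rightarrow> real) \<Rightarrow> (int \<Rightarrow> nat) measure \<Rightarrow> bool" where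
  "markov_measure I v P m \<longleftrightarrow>
     sets m = sets (PiM UNIV (\<lambda>_. count_space I)) \<and>
     (\<forall>k w. w \<noteq> [] \<and> set w \<subseteq> I \<longrightarrow>
        emeasure m {b \<in> space m. \<forall>i<length w. b (k + int i) = w ! i} =
        ennreal (v (hd w) * (\<Prod>i<length w - 1. P (w ! i) (w ! Suc i))))"

definition left_shift :: "(int \<Rightarrow> nat) \<Rightarrow> int \<Rightarrow> nat" where
  "left_shift b = (\<lambda>k. b (k + 1))"

definition isomorphism_on ::
  "'y set \<Rightarrow> 'z set \<Rightarrow> 'y measure \<Rightarrow> ('y \<Rightarrow> 'y) \<Rightarrow> 'z measure \<Rightarrow> ('z \<Rightarrow> 'z) \<Rightarrow> ('y \<Rightarrow> 'z) \<Rightarrow> bool" where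
  "isomorphism_on A B M f M' g \<phi> \<longleftrightarrow>
     A \<in> sets M \<and> emeasure M (space M - A) = 0 \<and> f \<in> A \<rightarrow> A \<and>
     B \<in> sets M' \<and> emeasure M' (space M' - B) = 0 \<and> g \<in> B \<rightarrow> B \<and>
     bij_betw \<phi> A B \<and>
     \<phi> \<in> restrict_space M A \<rightarrow>\<^sub>M restrict_space M' B \<and>
     inv_into A \<phi> \<in> restrict_space M' B \<rightarrow>\<^sub>M restrict_space M A \<and>
     (\<forall>E \<in> sets M'. emeasure M' E = emeasure M (\<phi> -` E \<inter> A)) \<and>
     (\<forall>z \<in> A. \<phi> (f z) = g (\<phi> z))"

end

theory Submission
  imports Defs
begin

text \<open>
  Write \<open>d\<^sub>u\<close> for the measure of \<open>D u\<close>, \<open>s\<^sub>u\<close> for the slope on the set \<open>Z k\<close> that contains \<open>D u\<close>, and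
  \<open>\<rho>\<^sub>u\<close> for the density of the lift. Four observations carry the proof.

  \<^item> The levels form a Markov partition of the tower: by \<open>c4\<close>, along an arrow \<open>t \<rightarrow> v\<close> a uniform mass
    on level \<open>t\<close> puts the fraction \<open>p\<^sub>t\<^sub>v = d\<^sub>v / (s\<^sub>t d\<^sub>t)\<close> uniformly on level \<open>v\<close>
    (\<open>emeasure_tower_preimage\<close>). Hence the averages that define the lift have constant densities on
    the levels, and only the masses of the levels matter. In a vague limit mass can escape, so the
    limit is a priori only superinvariant. But \<open>p\<close> is stochastic and the total mass is finite, which
    leaves no room for a strict inequality (\<open>substochastic_stationary\<close>). In terms of densities this
    reads \<open>\<rho>\<^sub>v = \<Sum>\<^sub>t \<rho>\<^sub>t / s\<^sub>t\<close>, summed over the arrows \<open>t \<rightarrow> v\<close> (\<open>width_sums\<close>).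

  \<^item> The rug map sends the part of rug \<open>t\<close> that goes to \<open>v\<close> to a horizontal strip of rug \<open>v\<close> of height
    \<open>\<rho>\<^sub>t / s\<^sub>t\<close>, stretching by \<open>s\<^sub>t\<close> in the base and shrinking by \<open>s\<^sub>t\<close> in the height. So it preserves
    the measure, and the strips are stacked without overlap, so it is injective (\<open>F_image\<close>,
    \<open>F_inj\<close>). As the measure is finite, the image of a set of full measure has full measure, and an
    invariant Borel set of full measure on which the map is a bijection is obtained by intersecting
    images (\<open>invertible_core\<close>).

  \<^item> The points whose future starts with a word \<open>w\<close> form a product of a subset of the first level with
    a full interval of heights. Its measure is the Markov weight of \<open>w\<close> (\<open>cyl_measure\<close>), and by
    invariance the same holds at all positions (\<open>markov\<close>).

  \<^item> The itinerary determines the point. The future determines the point in \<open>X\<close>, because \<open>c3\<close> says that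
    the cylinders generate (\<open>future_determines_point\<close>). The past confines the height to an interval
    of length (measure of the cylinder of the past word) / \<open>d\<^sub>u\<close>, where \<open>u\<close> is the present level
    (\<open>height_bounds_word\<close>). To see that these lengths tend to \<open>0\<close>, look forward: as there are no
    atoms, the measure of the cylinder of the first \<open>n + 1\<close> symbols tends to \<open>0\<close> at all good
    points (\<open>prob_word_tendsto_0\<close>). So the set where it is at least \<open>\<epsilon>\<close> has small measure if \<open>n\<close> is
    large, and so has its image under the \<open>n\<close>-th iterate, the set of points whose past word of length
    \<open>n + 1\<close> has a cylinder of measure at least \<open>\<epsilon>\<close> (\<open>contracting_core\<close>).

  The inverse of the itinerary is written down explicitly as a measurable map (\<open>decode\<close>), which gives
  at once bimeasurability and the measurability of the set of itineraries. As \<open>T\<close> is only Lebesgue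
  measurable and Borel sets are needed throughout, all of this happens over an invariant Borel set of
  points at which \<open>T\<close> is given by a continuous branch (\<open>good_set\<close>).
\<close>

section \<open>Invertible cores of measure preserving maps\<close>

text \<open>
  Removing the iterated preimages of \<open>N\<close> makes \<open>A\<close> forward invariant. The images \<open>f\<^sup>n A\<close> then
  decrease, and each has full measure because it has the same finite measure as \<open>A\<close>; injectivity
  turns their intersection into a set that \<open>f\<close> maps onto itself.
\<close>
lemma invertible_core:
  fixes M :: "'a measure" and f :: "'a \<Rightarrow> 'a"
  assumes A: "A \<in> sets M" and full: "emeasure M (space M - A) = 0"
    and fin: "emeasure M (space M) < \<infinity>"
    and f: "f \<in> A \<rightarrow> A" and inj: "inj_on f A"
    and img: "\<And>E. E \<in> sets M \<Longrightarrow> E \<subseteq> A \<Longrightarrow> f ` E \<in> sets M \<and> emeasure M (f ` E) = emeasure M E"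
    and pre: "\<And>E. E \<in> sets M \<Longrightarrow> f -` E \<inter> A \<in> sets M"
    and N: "N \<in> sets M" "emeasure M N = 0"
  obtains Y where "Y \<in> sets M" "Y \<subseteq> A - N" "emeasure M (space M - Y) = 0" "bij_betw f Y Y"
proof -
  have preim: "emeasure M (f -` E \<inter> A) = 0" if E: "E \<in> sets M" "emeasure M E = 0" for E
  proof -
    have "emeasure M (f -` E \<inter> A) = emeasure M (f ` (f -` E \<inter> A))"
      using img[of "f -` E \<inter> A"] pre[OF E(1)] by simp
    also have "\<dots> \<le> emeasure M E"
      by (rule emeasure_mono) (use E in auto)
    finally show ?thesis using E by simp
  qed
  have fn: "(f ^^ n) x \<in> A" if "x \<in> A" for n x
    using that f by (induction n) auto
  have pren: "(f ^^ n) -` N \<inter> A \<in> sets M \<and> emeasure M ((f ^^ n) -` N \<inter> A) = 0" for n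
  proof (induction n)
    case 0
    have "emeasure M (N \<inter> A) \<le> emeasure M N" by (rule emeasure_mono) (use N in auto)
    then show ?case using N A by auto
  next
    case (Suc n)
    have *: "(f ^^ Suc n) -` N \<inter> A = f -` ((f ^^ n) -` N \<inter> A) \<inter> A"
      using f by (auto simp: funpow_swap1)
    show ?case unfolding * using pre[of "(f ^^ n) -` N \<inter> A"] preim[of "(f ^^ n) -` N \<inter> A"] Suc by simp
  qed
  define A' where "A' = A - (\<Union>n. (f ^^ n) -` N \<inter> A)"
  have A': "A' \<in> sets M" unfolding A'_def using pren by (intro sets.Diff[OF A]) blast
  have A'sub: "A' \<subseteq> A - N"
  proof
    fix x assume x: "x \<in> A'"
    then have "(f ^^ 0) x \<notin> N" unfolding A'_def by blast
    then show "x \<in> A - N" using x by (auto simp: A'_def)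
  qed
  have fA': "f \<in> A' \<rightarrow> A'"
  proof
    fix x assume x: "x \<in> A'"
    have "(f ^^ n) (f x) \<notin> N" for n
    proof -
      have "x \<notin> (f ^^ Suc n) -` N \<inter> A" using x unfolding A'_def by blast
      then show ?thesis using x by (auto simp: A'_def funpow_swap1)
    qed
    then show "f x \<in> A'" using x f by (auto simp: A'_def)
  qed
  have nullN: "(\<Union>n. (f ^^ n) -` N \<inter> A) \<in> null_sets M"
    by (rule null_sets_UN) (use pren in auto)
  have A'full: "emeasure M (space M - A') = 0"
  proof -
    have "space M - A' = (space M - A) \<union> (\<Union>n. (f ^^ n) -` N \<inter> A)"
      using sets.sets_into_space[OF A] by (auto simp: A'_def)
    moreover have "(space M - A) \<in> null_sets M" using full A by auto
    ultimately show ?thesis using nullN by (metis null_sets.Un null_setsD1)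
  qed
  define B where "B n = (f ^^ n) ` A'" for n
  have B0: "B 0 = A'" by (simp add: B_def)
  have BS: "B (Suc n) = f ` B n" for n by (simp add: B_def image_comp)
  have Bm: "B n \<in> sets M \<and> B n \<subseteq> A' \<and> emeasure M (B n) = emeasure M A'" for n
  proof (induction n)
    case 0 show ?case using A' by (simp add: B0)
  next
    case (Suc n)
    then have "B n \<subseteq> A" using A'sub by blast
    moreover have "f ` B n \<subseteq> A'" using Suc fA' by blast
    ultimately show ?case using img[of "B n"] Suc by (simp add: BS)
  qed
  have finA: "emeasure M A' \<noteq> \<infinity>"
    using emeasure_mono[OF sets.sets_into_space[OF A'] sets.top] fin by (auto simp: top_unique)
  have Bfull: "emeasure M (space M - B n) = 0" for n
  proof -
    have "emeasure M (A' - B n) = emeasure M A' - emeasure M (B n)"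
      by (rule emeasure_Diff) (use Bm finA A' in auto)
    then have "A' - B n \<in> null_sets M" using Bm A' finA by auto
    moreover have "space M - A' \<in> null_sets M" using A' A'full by auto
    moreover have "space M - B n = (space M - A') \<union> (A' - B n)"
      using Bm sets.sets_into_space[OF A'] by blast
    ultimately show ?thesis by (metis null_sets.Un null_setsD1)
  qed
  define Y where "Y = (\<Inter>n. B n)"
  show ?thesis
  proof
    show "Y \<in> sets M" using Bm by (auto simp: Y_def)
    show "Y \<subseteq> A - N" using B0 A'sub unfolding Y_def by blast
    have "(\<Union>n. space M - B n) \<in> null_sets M"
      by (rule null_sets_UN) (use Bm Bfull in auto)
    moreover have "space M - Y = (\<Union>n. space M - B n)" by (auto simp: Y_def)
    ultimately show "emeasure M (space M - Y) = 0" by auto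
    have injA': "inj_on f A'" using inj A'sub by (auto intro: inj_on_subset)
    have "f ` Y = (\<Inter>n. f ` B n)"
      unfolding Y_def by (rule image_INT[OF injA']) (use Bm in auto)
    also have "\<dots> = (\<Inter>n. B (Suc n))" by (simp add: BS)
    also have "\<dots> = Y"
    proof -
      have "x \<in> B n" if "\<forall>n. x \<in> B (Suc n)" for x n
        using that Bm[of "Suc 0"] B0 by (cases n) auto
      then show ?thesis unfolding Y_def by blast
    qed
    finally show "bij_betw f Y Y"
      using inj_on_subset[OF injA', of Y] B0 unfolding bij_betw_def Y_def by blast
  qed
qed

section \<open>Measurability and injectivity of the branches\<close>
context piecewise_system
begin

abbreviation intZ :: "nat \<Rightarrow> 'a set" where
  "intZ j \<equiv> top_of_set X interior_of Z j"

lemma space_M: "space M = X"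
  using sets_eq_imp_space_eq[OF sets_M] by (simp add: space_restrict_space)

lemma X_borel: "X \<in> sets borel"
  using compact_X by (simp add: borel_compact)

lemma borel_in_sets_M: "A \<in> sets borel \<Longrightarrow> A \<subseteq> X \<Longrightarrow> A \<in> sets M"
  unfolding sets_M using X_borel
  by (auto simp: sets_restrict_space_iff)

lemma intZ_subset: "intZ j \<subseteq> Z j" "intZ j \<subseteq> X"
  using interior_of_subset[of "top_of_set X" "Z j"] interior_of_subset_topspace[of "top_of_set X" "Z j"]
  by auto

lemma intZ_borel: "intZ j \<in> sets borel"
proof -
  have "openin (top_of_set X) (intZ j)" by simp
  then obtain U where "open U" "intZ j = X \<inter> U" unfolding openin_open by blast
  then show ?thesis using X_borel by auto
qed

lemma Z_borel: "j \<in> {1..N} \<Longrightarrow> Z j \<in> sets borel"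
  using Z_closed by auto

lemma Z_sets_M: "j \<in> {1..N} \<Longrightarrow> Z j \<in> sets M"
  using Z_closed Z_borel borel_in_sets_M by auto

lemma preimage_in_sets_M: "A \<in> sets M \<Longrightarrow> T -` A \<inter> X \<in> sets M"
  using c2 by auto

lemma preimage_null: "A \<in> sets M \<Longrightarrow> emeasure M A = 0 \<Longrightarrow> emeasure M (T -` A \<inter> X) = 0"
  using c2 by auto

text \<open>
  The set in \<open>c6\<close> has to be shown measurable first, since \<open>emeasure\<close> is \<open>0\<close> on any set that is not
  measurable. The boundaries themselves are the images under \<open>T ^^ 0\<close>.
\<close>
lemma boundary_null:
  assumes "j \<in> {1..N}" shows "Z j - intZ j \<in> null_sets M"
proof -
  let ?B = "\<Union>j\<in>{1..N}. top_of_set X frontier_of Z j"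
  have fr: "top_of_set X frontier_of Z i = Z i - intZ i" if "i \<in> {1..N}" for i
  proof -
    have "closedin (top_of_set X) (Z i)" using Z_closed[OF that] by (auto intro: closed_subset)
    then show ?thesis by (simp add: frontier_of_def closure_of_closedin)
  qed
  have B: "?B \<in> sets M"
    using Z_sets_M intZ_borel intZ_subset borel_in_sets_M by (auto simp: fr)
  have "(T ^^ n) ` ?B \<in> sets M" for n
  proof (induction n)
    case 0 show ?case using B by simp
  next
    case (Suc n)
    have "(T ^^ Suc n) ` ?B = T ` ((T ^^ n) ` ?B)" by (simp only: funpow.simps image_comp)
    then show ?case using c2[OF Suc] by simp
  qed
  then have m: "(\<Union>n. (T ^^ n) ` ?B) \<in> sets M" by auto
  have "Z j - intZ j \<subseteq> (T ^^ 0) ` ?B" using fr[OF assms] assms by auto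
  also have "\<dots> \<subseteq> (\<Union>n. (T ^^ n) ` ?B)" by blast
  finally have "emeasure M (Z j - intZ j) \<le> emeasure M (\<Union>n. (T ^^ n) ` ?B)"
    by (rule emeasure_mono) (rule m)
  then have "emeasure M (Z j - intZ j) = 0" using c6 by simp
  then show ?thesis using Z_sets_M[OF assms] intZ_borel intZ_subset borel_in_sets_M by auto
qed

text \<open>
  The extension of a branch to the compact set \<open>Z j\<close> is a homeomorphism onto its image. Hence branch
  and inverse branch are restrictions of Borel maps \<open>g\<close> and \<open>h\<close> of the whole space, and images of
  Borel sets under a branch are Borel.
\<close>
lemma branch_extension:
  assumes j: "j \<in> {1..N}"
  obtains g h where "g \<in> borel_measurable borel" "\<And>x. x \<in> intZ j \<Longrightarrow> g x = T x"
    "h \<in> borel_measurable borel" "\<And>x. x \<in> intZ j \<Longrightarrow> h (T x) = x"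
    "T ` intZ j \<in> sets borel"
proof -
  obtain g where g: "continuous_on (Z j) g" "inj_on g (Z j)" "\<forall>x\<in>intZ j. g x = T x"
    using c1[OF j] by blast
  have cZ: "compact (Z j)" using Z_closed[OF j] compact_X
    by (metis closed_Int_compact inf.absorb1 inf_commute)
  define h where "h = inv_into (Z j) g"
  have hc: "continuous_on (g ` Z j) h"
    unfolding h_def using g(1) cZ g(2) by (intro continuous_on_inv) auto
  have gZ: "g ` Z j \<in> sets borel" using g(1) cZ by (simp add: borel_compact compact_continuous_image)
  define g' where "g' x = (if x \<in> Z j then g x else 0)" for x
  define h' where "h' y = (if y \<in> g ` Z j then h y else 0)" for y
  have g': "g' \<in> borel_measurable borel"
    unfolding g'_def using borel_measurable_continuous_on_if[OF Z_borel[OF j] g(1), of "\<lambda>_. 0"] by simp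
  have h': "h' \<in> borel_measurable borel"
    unfolding h'_def using borel_measurable_continuous_on_if[OF gZ hc, of "\<lambda>_. 0"] by simp
  have gx: "g' x = T x" "h' (T x) = x" if "x \<in> intZ j" for x
  proof -
    have "x \<in> Z j" using that intZ_subset by auto
    moreover have "T x = g x" using g(3) that by simp
    moreover have "h (g x) = x" using g(2) \<open>x \<in> Z j\<close> by (simp add: h_def)
    ultimately show "g' x = T x" "h' (T x) = x"
      by (auto simp: g'_def h'_def)
  qed
  have "T ` intZ j = h' -` intZ j \<inter> g ` Z j"
  proof (intro subset_antisym subsetI)
    fix y assume "y \<in> T ` intZ j"
    then obtain x where x: "x \<in> intZ j" "y = T x" by auto
    then have "y = g x" "x \<in> Z j" using g(3) intZ_subset by auto
    moreover have "h' y = x" using gx x by simp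
    ultimately show "y \<in> h' -` intZ j \<inter> g ` Z j" using x by auto
  next
    fix y assume y: "y \<in> h' -` intZ j \<inter> g ` Z j"
    then obtain x where "x \<in> Z j" "y = g x" by auto
    moreover from this have "h' y = x" using g(2) by (auto simp: h'_def h_def)
    ultimately show "y \<in> T ` intZ j" using y g(3) by auto
  qed
  moreover have "h' -` intZ j \<inter> g ` Z j \<in> sets borel"
    using measurable_sets[OF h' intZ_borel[of j]] gZ by auto
  ultimately show ?thesis using that[of g' h'] g' h' gx by simp
qed

lemma inj_on_intZ: "j \<in> {1..N} \<Longrightarrow> inj_on T (intZ j)"
  by (rule branch_extension[of j]) (auto intro: inj_on_inverseI)

lemma preimage_branch_borel:
  assumes j: "j \<in> {1..N}" and E: "E \<in> sets borel"
  shows "{x \<in> intZ j. T x \<in> E} \<in> sets borel"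
proof -
  obtain g where g: "g \<in> borel_measurable borel" "\<And>x. x \<in> intZ j \<Longrightarrow> g x = T x"
    using branch_extension[OF j] by metis
  have "{x \<in> intZ j. T x \<in> E} = intZ j \<inter> (g -` E)" using g(2) by auto
  then show ?thesis using measurable_sets[OF g(1) E] intZ_borel by auto
qed

lemma image_in_sets_M: "A \<in> sets M \<Longrightarrow> T ` A \<in> sets M"
  using c2 by auto

lemma emeasure_image:
  "j \<in> {1..N} \<Longrightarrow> A \<in> sets M \<Longrightarrow> A \<subseteq> Z j \<Longrightarrow> emeasure M (T ` A) = ennreal (s j) * emeasure M A"
  using c4 by auto

lemma slope_ge_1: "j \<in> {1..N} \<Longrightarrow> s j \<ge> 1"
  using c4 by auto

section \<open>A forward invariant set of regular points\<close>

definition regular :: "'a set" where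
  "regular = (\<Union>j\<in>{1..N}. intZ j - (\<Union>i\<in>{1..N} - {j}. Z i))"

lemma regular_borel: "regular \<in> sets borel"
  unfolding regular_def using intZ_borel Z_borel by auto

lemma regular_subset: "regular \<subseteq> X"
  unfolding regular_def using intZ_subset by auto

lemma regular_D:
  assumes "x \<in> regular" "j \<in> {1..N}" "x \<in> Z j"
  shows "x \<in> intZ j" "i \<in> {1..N} \<Longrightarrow> x \<in> Z i \<Longrightarrow> i = j"
  using assms unfolding regular_def by blast+

lemma regular_cover: "x \<in> regular \<Longrightarrow> \<exists>j\<in>{1..N}. x \<in> Z j"
  unfolding regular_def using intZ_subset by blast

lemma regular_full: "X - regular \<in> null_sets M"
proof -
  have U: "(\<Union>j\<in>{1..N}. Z j) \<in> sets M" using Z_sets_M by auto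
  have "prob (\<Union>j\<in>{1..N}. Z j) = 1" using Z_cover by (simp add: emeasure_eq_measure)
  then have "prob (space M - (\<Union>j\<in>{1..N}. Z j)) = 0" using prob_compl[OF U] by simp
  then have 1: "X - (\<Union>j\<in>{1..N}. Z j) \<in> null_sets M"
    using U by (intro null_setsI) (auto simp: space_M[symmetric] emeasure_eq_measure)
  have 2: "(\<Union>j\<in>{1..N}. Z j - intZ j) \<in> null_sets M"
    by (rule null_sets_UN') (use boundary_null in auto)
  have 3: "(\<Union>i\<in>{1..N}. \<Union>j\<in>{1..N}-{i}. Z i \<inter> Z j) \<in> null_sets M"
    by (intro null_sets_UN') (use Z_overlap Z_sets_M in \<open>auto intro!: null_setsI\<close>)
  have "X - regular \<in> sets M"
    using regular_borel X_borel by (intro borel_in_sets_M) auto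
  moreover have "X - regular \<subseteq> (X - (\<Union>j\<in>{1..N}. Z j)) \<union> (\<Union>j\<in>{1..N}. Z j - intZ j) \<union>
      (\<Union>i\<in>{1..N}. \<Union>j\<in>{1..N}-{i}. Z i \<inter> Z j)"
    unfolding regular_def by blast
  ultimately show ?thesis using 1 2 3
    by (meson null_sets.Un null_sets_subset)
qed

lemma preimage_regular_borel:
  assumes E: "E \<in> sets borel"
  shows "{x \<in> regular. T x \<in> E} \<in> sets borel"
proof -
  have "{x \<in> regular. T x \<in> E} = regular \<inter> (\<Union>j\<in>{1..N}. {x \<in> intZ j. T x \<in> E})"
    unfolding regular_def by blast
  then show ?thesis using regular_borel preimage_branch_borel[OF _ E] by auto
qed

text \<open>
  Preimages of null sets are null, and \<open>T\<close> is Borel on \<open>regular\<close>; so the points whose whole forward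
  orbit stays in \<open>P\<close> still form a Borel set of full measure.
\<close>
lemma forward_invariant_core:
  assumes P: "P \<in> sets borel" "P \<subseteq> regular" "X - P \<in> null_sets M"
  obtains G where "G \<in> sets borel" "G \<subseteq> P" "X - G \<in> null_sets M" "T \<in> G \<rightarrow> G"
proof -
  define B where "B n = {x \<in> P. \<forall>i\<le>n. (T ^^ i) x \<in> P}" for n
  have BS: "B (Suc n) = P \<inter> {x \<in> regular. T x \<in> B n}" for n
  proof -
    have "(\<forall>i\<le>Suc n. (T ^^ i) x \<in> P) \<longleftrightarrow> x \<in> P \<and> (\<forall>i\<le>n. (T ^^ i) (T x) \<in> P)" for x
    proof -
      have "(\<forall>i\<le>Suc n. Q i) \<longleftrightarrow> Q 0 \<and> (\<forall>i\<le>n. Q (Suc i))" for Q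
        using All_less_Suc2[of "Suc n" Q] by (simp add: less_Suc_eq_le)
      from this[of "\<lambda>i. (T ^^ i) x \<in> P"] show ?thesis by (simp add: funpow_swap1)
    qed
    then show ?thesis using P(2) unfolding B_def by (auto dest: spec[of _ 0])
  qed
  have Bm: "B n \<in> sets borel \<and> X - B n \<in> null_sets M" for n
  proof (induction n)
    case 0
    have "B 0 = P" by (auto simp: B_def)
    then show ?case using P by simp
  next
    case (Suc n)
    have b: "B (Suc n) \<in> sets borel" using Suc P preimage_regular_borel by (auto simp: BS)
    have "T -` (X - B n) \<inter> X \<in> null_sets M"
      using Suc preimage_in_sets_M preimage_null by auto
    then have "(X - P) \<union> (T -` (X - B n) \<inter> X) \<in> null_sets M" using P by auto
    moreover have "X - B (Suc n) \<subseteq> (X - P) \<union> (T -` (X - B n) \<inter> X)"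
      using T_into P(2) by (auto simp: BS)
    moreover have "X - B (Suc n) \<in> sets M" using b X_borel by (intro borel_in_sets_M) auto
    ultimately show ?case using b by (meson null_sets_subset)
  qed
  show ?thesis
  proof (rule that[of "\<Inter>n. B n"])
    show "(\<Inter>n. B n) \<in> sets borel" using Bm by auto
    show "(\<Inter>n. B n) \<subseteq> P" by (auto simp: B_def)
    have "(\<Union>n. X - B n) \<in> null_sets M" by (rule null_sets_UN) (use Bm in auto)
    moreover have "X - (\<Inter>n. B n) = (\<Union>n. X - B n)" by blast
    ultimately show "X - (\<Inter>n. B n) \<in> null_sets M" by (simp only:)
    show "T \<in> (\<Inter>n. B n) \<rightarrow> (\<Inter>n. B n)"
    proof
      fix x assume x: "x \<in> (\<Inter>n. B n)"
      have "T x \<in> B n" for n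
      proof -
        have "x \<in> B (Suc n)" using x by (rule INT_D) simp
        then show ?thesis unfolding BS by simp
      qed
      then show "T x \<in> (\<Inter>n. B n)" by simp
    qed
  qed
qed

text \<open>
  On a forward invariant set of regular points the sets generated by the cylinders are Borel, although
  \<open>T\<close> is only Lebesgue measurable: there the cylinders are built from continuous branches.
\<close>

lemma cylinder_algebra_borel:
  assumes G: "G \<in> sets borel" "G \<subseteq> regular" "T \<in> G \<rightarrow> G"
    and B: "B \<in> sigma_sets X (cylinder M Z T ` words M N Z T)"
  shows "B \<inter> G \<in> sets borel"
  using B
proof (induction rule: sigma_sets.induct)
  case (Basic a)
  then obtain w where w: "set w \<subseteq> {1..N}" "a = cylinder M Z T w" by (auto simp: words_def)
  have "{x \<in> G. (T ^^ i) x \<in> E} \<in> sets borel" if "E \<in> sets borel" for i E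
    using that
  proof (induction i arbitrary: E)
    case 0
    have "{x \<in> G. (T ^^ 0) x \<in> E} = G \<inter> E" by auto
    then show ?case using G(1) 0 by simp
  next
    case (Suc i)
    have "{x \<in> G. (T ^^ Suc i) x \<in> E} = G \<inter> {x \<in> regular. T x \<in> {x \<in> G. (T ^^ i) x \<in> E}}"
      using G by (auto simp: funpow_swap1)
    then show ?case using preimage_regular_borel[OF Suc.IH[OF Suc.prems]] G(1) by auto
  qed
  then have "(\<Inter>i\<in>{..<length w}. {x \<in> G. (T ^^ i) x \<in> Z (w ! i)}) \<inter> G \<in> sets borel"
    if "w \<noteq> []" using w that G(1) Z_borel
    by (intro sets.Int sets.finite_INT) (auto simp: subset_iff)
  moreover have "a \<inter> G = (\<Inter>i\<in>{..<length w}. {x \<in> G. (T ^^ i) x \<in> Z (w ! i)}) \<inter> G"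
    using G(2) regular_subset unfolding w(2) cylinder_def space_M by auto
  ultimately show ?case using G(1,2) regular_subset by (cases "w = []") auto
next
  case Empty then show ?case by simp
next
  case (Compl a)
  have "(X - a) \<inter> G = G - (a \<inter> G)" using G(2) regular_subset by auto
  then show ?case using Compl G(1) by auto
next
  case (Union a)
  have "(\<Union>i. a i) \<inter> G = (\<Union>i. a i \<inter> G)" by auto
  also have "\<dots> \<in> sets borel" using Union by (intro sets.countable_UN) auto
  finally show ?case .
qed

end

section \<open>Levels, arrows and the set of good points\<close>
lemma null_equal_commute: "null_equal M A B \<Longrightarrow> null_equal M B A"
  by (simp add: null_equal_def Un_commute)

lemma null_equal_trans:
  assumes "null_equal M A B" "null_equal M B C" "A \<in> sets M" "C \<in> sets M"
  shows "null_equal M A C"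
proof -
  have "(A - B \<union> (B - A)) \<union> (B - C \<union> (C - B)) \<in> null_sets M"
    using assms by (auto simp: null_equal_def)
  moreover have "A - C \<union> (C - A) \<subseteq> (A - B \<union> (B - A)) \<union> (B - C \<union> (C - B))" by blast
  moreover have "A - C \<union> (C - A) \<in> sets M" using assms by auto
  ultimately show ?thesis unfolding null_equal_def by (meson null_sets_subset)
qed

lemma null_equal_diff:
  assumes "null_equal M A B" "A \<in> sets M" "B \<in> sets M"
  shows "A - B \<in> null_sets M"
  using assms unfolding null_equal_def
  by (meson null_sets_subset sets.Diff Un_upper1)

context hofbauer_tower
begin

text \<open>
  At each step the image of the cylinder lies in a single \<open>Z j\<close>, where \<open>T\<close> multiplies the measure by
  \<open>s j \<ge> 1\<close>.
\<close>
lemma tower_set_image: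
  assumes w: "w \<in> words M N Z T" and n: "n < length w"
  shows "(T ^^ n) ` cylinder M Z T w \<in> sets M \<and> emeasure M ((T ^^ n) ` cylinder M Z T w) > 0 \<and>
    (T ^^ n) ` cylinder M Z T w \<subseteq> Z (w ! n)"
  using n
proof (induction n)
  case 0
  have "emeasure M (cylinder M Z T w) > 0" using w unfolding words_def by blast
  moreover from this have "cylinder M Z T w \<in> sets M" using emeasure_notin_sets by (metis less_irrefl)
  moreover have "cylinder M Z T w \<subseteq> Z (w ! 0)" using 0 unfolding cylinder_def by auto
  ultimately show ?case by simp
next
  case (Suc n)
  let ?A = "(T ^^ n) ` cylinder M Z T w"
  have A: "?A \<in> sets M" "emeasure M ?A > 0" "?A \<subseteq> Z (w ! n)" using Suc by auto
  have j: "w ! n \<in> {1..N}" using w nth_mem[of n w] Suc(2) unfolding words_def by (metis (lifting) CollectD Suc_lessD subsetD)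
  have eq: "(T ^^ Suc n) ` cylinder M Z T w = T ` ?A" by (simp add: image_comp)
  have "ennreal (s (w ! n)) > 0" using slope_ge_1[OF j] by simp
  then have "emeasure M (T ` ?A) > 0"
    using A(2) unfolding emeasure_image[OF j A(1,3)] by (simp add: ennreal_zero_less_mult_iff)
  moreover have "(T ^^ Suc n) ` cylinder M Z T w \<subseteq> Z (w ! Suc n)"
    using Suc(2) by (auto simp: cylinder_def)
  ultimately show ?case unfolding eq using image_in_sets_M[OF A(1)] by simp
qed

lemma level_set:
  assumes u: "u \<in> \<alpha>"
  shows "compact (D u)" "D u \<in> sets M" "D u \<in> sets borel" "D u \<subseteq> X" "emeasure M (D u) > 0"
    "\<exists>k\<in>{1..N}. D u \<subseteq> Z k"
proof -
  obtain w where w: "w \<in> words M N Z T" "D u = tower_set M Z T w" using D_tower_set[OF u] by auto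
  define n where "n = length w - 1"
  have n: "n < length w" using w(1) by (auto simp: words_def n_def)
  let ?A = "(T ^^ n) ` cylinder M Z T w"
  have A: "?A \<in> sets M" "emeasure M ?A > 0" "?A \<subseteq> Z (w ! n)" using tower_set_image[OF w(1) n] by auto
  have j: "w ! n \<in> {1..N}" using w(1) nth_mem[OF n] unfolding words_def by blast
  have Du: "D u = closure ?A" by (simp add: w(2) tower_set_def n_def)
  have sub: "D u \<subseteq> Z (w ! n)" unfolding Du using A(3) Z_closed[OF j] by (simp add: closure_minimal)
  then show "\<exists>k\<in>{1..N}. D u \<subseteq> Z k" using j by blast
  show X: "D u \<subseteq> X" using sub Z_closed[OF j] by auto
  have cl: "closed (D u)" by (simp add: Du)
  then show "compact (D u)" using X compact_X by (metis closed_Int_compact inf.absorb1)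
  show b: "D u \<in> sets borel" using cl by simp
  show m: "D u \<in> sets M" using b X by (rule borel_in_sets_M)
  have "emeasure M ?A \<le> emeasure M (D u)" unfolding Du
    by (rule emeasure_mono[OF closure_subset]) (use m Du in simp)
  then show "emeasure M (D u) > 0" using A(2) by simp
qed

definition branch :: "nat \<Rightarrow> nat" where
  "branch u = (SOME k. k \<in> {1..N} \<and> D u \<subseteq> Z k)"

definition slope :: "nat \<Rightarrow> real" where
  "slope u = s (branch u)"

lemma branch: "u \<in> \<alpha> \<Longrightarrow> branch u \<in> {1..N}" "u \<in> \<alpha> \<Longrightarrow> D u \<subseteq> Z (branch u)"
  using level_set(6)[of u] unfolding branch_def by (metis (mono_tags, lifting) someI_ex)+

lemma slope: "u \<in> \<alpha> \<Longrightarrow> slope u \<ge> 1"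
  unfolding slope_def using slope_ge_1 branch by auto

text \<open>Two different sets \<open>Z j\<close> overlap in a null set, whereas \<open>D u\<close> has positive measure.\<close>
lemma branch_unique:
  assumes u: "u \<in> \<alpha>" and k: "k \<in> {1..N}" and null: "D u - Z k \<in> null_sets M"
  shows "k = branch u"
proof (rule ccontr)
  assume "k \<noteq> branch u"
  then have "Z k \<inter> Z (branch u) \<in> null_sets M"
    using Z_overlap[OF k branch(1)[OF u]] Z_sets_M k branch(1)[OF u] by auto
  then have "(D u - Z k) \<union> (Z k \<inter> Z (branch u)) \<in> null_sets M" using null by auto
  moreover have "D u \<subseteq> (D u - Z k) \<union> (Z k \<inter> Z (branch u))" using branch(2)[OF u] by blast
  ultimately have "D u \<in> null_sets M" using level_set(2)[OF u] by (meson null_sets_subset)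
  then show False using level_set(5)[OF u] by auto
qed

abbreviation arrows :: "nat \<Rightarrow> nat \<Rightarrow> bool" where
  "arrows \<equiv> arrow M N Z T D"

lemma image_level_sets: "u \<in> \<alpha> \<Longrightarrow> T ` D u \<in> sets M"
  using level_set(2) image_in_sets_M by auto

lemma arrow_via_null:
  assumes "u \<in> \<alpha>" "v \<in> \<alpha>" "j \<in> {1..N}" "arrow_via M Z T D j u v"
  shows "D v - Z j \<inter> T ` D u \<in> null_sets M" "Z j \<inter> T ` D u - D v \<in> null_sets M"
  using assms null_equal_diff null_equal_commute level_set(2) image_level_sets Z_sets_M
  unfolding arrow_via_def by (auto intro!: null_equal_diff)

lemma arrow_via_branch:
  assumes uv: "u \<in> \<alpha>" "v \<in> \<alpha>" and j: "j \<in> {1..N}" "arrow_via M Z T D j u v"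
  shows "j = branch v"
proof (rule branch_unique[OF uv(2) j(1)])
  have "D v - Z j \<in> sets M" using level_set(2)[OF uv(2)] Z_sets_M[OF j(1)] by auto
  moreover have "D v - Z j \<subseteq> D v - Z j \<inter> T ` D u" by blast
  ultimately show "D v - Z j \<in> null_sets M"
    using arrow_via_null(1)[OF uv j] by (meson null_sets_subset)
qed

lemma arrow_iff:
  "u \<in> \<alpha> \<Longrightarrow> v \<in> \<alpha> \<Longrightarrow> arrows u v \<longleftrightarrow> arrow_via M Z T D (branch v) u v"
  unfolding arrow_def using arrow_via_branch branch(1) by metis

lemma successor_unique:
  assumes u: "u \<in> \<alpha>" "v \<in> \<alpha>" "v' \<in> \<alpha>" and j: "j \<in> {1..N}"
    and a: "arrow_via M Z T D j u v" "arrow_via M Z T D j u v'"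
  shows "v = v'"
proof -
  obtain w where w: "w \<in> words M N Z T" "D v = tower_set M Z T w" using D_tower_set u by auto
  have "null_equal M (D v') (D v)"
    using a null_equal_trans[OF _ null_equal_commute] level_set(2) u unfolding arrow_via_def by blast
  moreover have "null_equal M (D v) (D v)" by (simp add: null_equal_def)
  ultimately show ?thesis using D_enum[OF w(1)] u w(2) by auto
qed

text \<open>\<open>T\<close> maps the preimage onto \<open>B\<close> up to a null set, since \<open>T ` D u\<close> covers \<open>D v\<close> up to a null set.\<close>
lemma emeasure_preimage_arrow:
  assumes uv: "u \<in> \<alpha>" "v \<in> \<alpha>" "arrows u v" and B: "B \<in> sets M" "B \<subseteq> D v"
  shows "{x \<in> D u. T x \<in> B} \<in> sets M" "ennreal (slope u) * emeasure M {x \<in> D u. T x \<in> B} = emeasure M B"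
proof -
  have "{x \<in> D u. T x \<in> B} = D u \<inter> (T -` B \<inter> X)" using level_set(4)[OF uv(1)] by auto
  then show m: "{x \<in> D u. T x \<in> B} \<in> sets M"
    using level_set(2)[OF uv(1)] preimage_in_sets_M[OF B(1)] by auto
  have "ennreal (slope u) * emeasure M {x \<in> D u. T x \<in> B} = emeasure M (T ` {x \<in> D u. T x \<in> B})"
    unfolding slope_def using branch[OF uv(1)] m by (subst emeasure_image) auto
  also have "T ` {x \<in> D u. T x \<in> B} = B - (B - T ` D u)" by auto
  also have "emeasure M \<dots> = emeasure M B"
  proof (rule emeasure_Diff_null_set)
    have "D v - Z (branch v) \<inter> T ` D u \<in> null_sets M"
      using arrow_via_null(1)[OF uv(1,2) branch(1)[OF uv(2)]] arrow_iff uv by auto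
    moreover have "B - T ` D u \<in> sets M" using B image_level_sets[OF uv(1)] by auto
    moreover have "B - T ` D u \<subseteq> D v - Z (branch v) \<inter> T ` D u" using B by auto
    ultimately show "B - T ` D u \<in> null_sets M" by (meson null_sets_subset)
  qed (rule B)
  finally show "ennreal (slope u) * emeasure M {x \<in> D u. T x \<in> B} = emeasure M B" .
qed

text \<open>
  On a good set the exceptional cases of the definitions do not occur: each point lies in exactly one
  \<open>Z j\<close>, namely in its interior; the tower map has its intended values; and the generation
  property \<open>c3\<close> holds pointwise for countably many half-spaces that separate points.
\<close>
definition good_set :: "'a set \<Rightarrow> bool" where
  "good_set G \<longleftrightarrow> G \<in> sets borel \<and> G \<subseteq> regular \<and> X - G \<in> null_sets M \<and> T \<in> G \<rightarrow> G \<and>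
    (\<forall>x\<in>G. \<forall>u\<in>\<alpha>. \<forall>j\<in>{1..N}. x \<in> D u \<longrightarrow> T x \<in> Z j \<longrightarrow>
       (\<exists>v\<in>\<alpha>. arrow_via M Z T D j u v \<and> T x \<in> D v)) \<and>
    (\<forall>b\<in>Basis. \<forall>q::rat. \<exists>B\<in>sigma_sets X (cylinder M Z T ` words M N Z T).
       \<forall>x\<in>G. x \<bullet> b < of_rat q \<longleftrightarrow> x \<in> B)"

text \<open>
  The invariant core is taken twice. The sets where the half-spaces differ from the
  generated sets of \<open>c3\<close> are null, but they are known to be Borel only after intersecting with an
  invariant set of regular points.
\<close>
lemma good_set_exists: "\<exists>G. good_set G"
proof -
  define bad where "bad u j = {x \<in> regular. x \<in> D u \<and> T x \<in> Z j \<and>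
    \<not> (\<exists>v\<in>\<alpha>. arrow_via M Z T D j u v \<and> T x \<in> D v)}" for u j
  have bad: "bad u j \<in> sets borel \<and> bad u j \<in> null_sets M" if u: "u \<in> \<alpha>" and j: "j \<in> {1..N}" for u j
  proof -
    \<comment> \<open>\<open>E\<close> will be \<open>Z j - D v\<close> if an arrow to \<open>v\<close> uses \<open>Z j\<close>, and \<open>Z j\<close> if none does.\<close>
    have core: ?thesis if E: "E \<in> sets borel" "E \<in> sets M" and
      eq: "bad u j = regular \<inter> D u \<inter> {x \<in> regular. T x \<in> E}" and null: "E \<inter> T ` D u \<in> null_sets M" for E
    proof -
      have b: "bad u j \<in> sets borel"
        unfolding eq using preimage_regular_borel[OF E(1)] regular_borel level_set(3)[OF u] by auto
      have "T -` (E \<inter> T ` D u) \<inter> X \<in> null_sets M"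
        by (intro null_setsI preimage_null preimage_in_sets_M) (use null in auto)
      moreover have "bad u j \<in> sets M"
        using b regular_subset by (intro borel_in_sets_M) (auto simp: bad_def)
      moreover have "bad u j \<subseteq> T -` (E \<inter> T ` D u) \<inter> X"
        unfolding eq using regular_subset by auto
      ultimately show ?thesis using b by (meson null_sets_subset)
    qed
    show ?thesis
    proof (cases "\<exists>v\<in>\<alpha>. arrow_via M Z T D j u v")
      case True
      then obtain v where v: "v \<in> \<alpha>" "arrow_via M Z T D j u v" by auto
      have "v' = v" if "v' \<in> \<alpha>" "arrow_via M Z T D j u v'" for v'
        using successor_unique[OF u that(1) v(1) j] that v by auto
      then have "(\<exists>v'\<in>\<alpha>. arrow_via M Z T D j u v' \<and> T x \<in> D v') \<longleftrightarrow> T x \<in> D v" for x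
        using v by metis
      then have "bad u j = regular \<inter> D u \<inter> {x \<in> regular. T x \<in> Z j - D v}"
        unfolding bad_def by blast
      moreover have "(Z j - D v) \<inter> T ` D u \<in> null_sets M"
      proof -
        have "(Z j - D v) \<inter> T ` D u = Z j \<inter> T ` D u - D v" by blast
        then show ?thesis using arrow_via_null(2)[OF u v(1) j v(2)] by (simp only:)
      qed
      ultimately show ?thesis
        using Z_borel[OF j] Z_sets_M[OF j] level_set(2,3)[OF v(1)] by (intro core) auto
    next
      case False
      then have "\<not> emeasure M (Z j \<inter> T ` D u) > 0"
        using D_successor[OF u j] unfolding arrow_via_def by blast
      then have "Z j \<inter> T ` D u \<in> null_sets M" using Z_sets_M[OF j] image_level_sets[OF u] by auto
      moreover have "bad u j = regular \<inter> D u \<inter> {x \<in> regular. T x \<in> Z j}"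
        unfolding bad_def using False by auto
      ultimately show ?thesis using Z_borel[OF j] Z_sets_M[OF j] by (intro core) auto
    qed
  qed
  define P where "P = regular - (\<Union>u\<in>\<alpha>. \<Union>j\<in>{1..N}. bad u j)"
  have badU: "(\<Union>u\<in>\<alpha>. \<Union>j\<in>{1..N}. bad u j) \<in> null_sets M"
    by (intro null_sets_UN') (use bad in auto)
  have P: "P \<in> sets borel" "P \<subseteq> regular" "X - P \<in> null_sets M"
  proof -
    have "(\<Union>u\<in>\<alpha>. \<Union>j\<in>{1..N}. bad u j) \<in> sets borel"
      by (intro sets.countable_UN' sets.finite_UN) (use bad in auto)
    then show "P \<in> sets borel" unfolding P_def using regular_borel by auto
    show "P \<subseteq> regular" by (auto simp: P_def)
    have "X - P = (X - regular) \<union> (\<Union>u\<in>\<alpha>. \<Union>j\<in>{1..N}. bad u j)"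
      using regular_subset by (auto simp: P_def bad_def)
    then show "X - P \<in> null_sets M" using regular_full badU by auto
  qed
  obtain G1 where G1: "G1 \<in> sets borel" "G1 \<subseteq> P" "X - G1 \<in> null_sets M" "T \<in> G1 \<rightarrow> G1"
    using forward_invariant_core[OF P] by metis
  define half where "half b q = X \<inter> {x. x \<bullet> b < of_rat q}" for b :: 'a and q :: rat
  have half: "half b q \<in> sets borel" for b q
  proof -
    have "{x. x \<bullet> b < real_of_rat q} \<in> sets borel"
      by (intro borel_open open_Collect_less continuous_intros)
    then show ?thesis using X_borel by (auto simp: half_def)
  qed
  have "\<exists>B. \<forall>b q. B b q \<in> sigma_sets X (cylinder M Z T ` words M N Z T) \<and> null_equal M (half b q) (B b q)"
    using c3[OF borel_in_sets_M[OF half]] unfolding half_def by (metis Int_lower1)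
  then obtain B where B: "\<And>b q. B b q \<in> sigma_sets X (cylinder M Z T ` words M N Z T)"
    "\<And>b q. null_equal M (half b q) (B b q)" by metis
  define E where "E b q = G1 \<inter> ((half b q - B b q) \<union> (B b q - half b q))" for b q
  have Eb: "E b q \<in> sets borel" for b q
  proof -
    have "E b q = ((G1 \<inter> half b q) - (B b q \<inter> G1)) \<union> ((B b q \<inter> G1) - half b q)" by (auto simp: E_def)
    then show ?thesis
      using half G1(1) cylinder_algebra_borel[OF G1(1) _ G1(4) B(1), of b q] G1(2) P(2) by auto
  qed
  have En: "E b q \<in> null_sets M" for b q
  proof -
    have "E b q \<in> sets M"
      using Eb G1(2) P(2) regular_subset by (intro borel_in_sets_M) (auto simp: E_def)
    moreover have "E b q \<subseteq> half b q - B b q \<union> (B b q - half b q)" by (simp add: E_def)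
    ultimately show ?thesis using B(2)[of b q] unfolding null_equal_def by (meson null_sets_subset)
  qed
  have "(\<Union>b\<in>Basis. \<Union>q. E b q) \<in> null_sets M"
    by (intro null_sets_UN' null_sets_UN) (auto simp: En countable_finite)
  moreover have "(\<Union>b\<in>Basis. \<Union>q. E b q) \<in> sets borel"
    by (intro sets.finite_UN sets.countable_UN) (auto simp: Eb)
  ultimately have EU: "(\<Union>b\<in>Basis. \<Union>q. E b q) \<in> null_sets M" "(\<Union>b\<in>Basis. \<Union>q. E b q) \<in> sets borel" .
  define P2 where "P2 = G1 - (\<Union>b\<in>Basis. \<Union>q. E b q)"
  have "X - P2 = (X - G1) \<union> (\<Union>b\<in>Basis. \<Union>q. E b q)"
    using G1(2) P(2) regular_subset by (auto simp: P2_def E_def)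
  then have P2: "P2 \<in> sets borel" "P2 \<subseteq> regular" "X - P2 \<in> null_sets M"
    using G1 P EU by (auto simp: P2_def)
  obtain G where G: "G \<in> sets borel" "G \<subseteq> P2" "X - G \<in> null_sets M" "T \<in> G \<rightarrow> G"
    using forward_invariant_core[OF P2] by metis
  have "G \<subseteq> P" using G(2) G1(2) by (auto simp: P2_def)
  have nxt: "\<exists>v\<in>\<alpha>. arrow_via M Z T D j u v \<and> T x \<in> D v"
    if "x \<in> G" "u \<in> \<alpha>" "j \<in> {1..N}" "x \<in> D u" "T x \<in> Z j" for x u j
  proof -
    have "x \<in> regular" "x \<notin> bad u j" using \<open>G \<subseteq> P\<close> that unfolding P_def by blast+
    then show ?thesis using that unfolding bad_def by blast
  qed
  have sep: "x \<bullet> b < of_rat q \<longleftrightarrow> x \<in> B b q" if "x \<in> G" "b \<in> Basis" for x b q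
  proof -
    have "x \<in> G1" "x \<notin> E b q" using that G(2) unfolding P2_def by blast+
    moreover from this have "x \<in> X" using G1(2) P(2) regular_subset by blast
    ultimately show ?thesis unfolding E_def half_def by blast
  qed
  have "good_set G"
    unfolding good_set_def
  proof (intro conjI ballI allI impI)
    show "G \<subseteq> regular" using \<open>G \<subseteq> P\<close> P(2) by blast
    show "\<exists>B\<in>sigma_sets X (cylinder M Z T ` words M N Z T). \<forall>x\<in>G. x \<bullet> b < of_rat q \<longleftrightarrow> x \<in> B"
      if "b \<in> Basis" for b q
      by (rule bexI[OF _ B(1)[of b q]]) (use sep that in blast)
  qed (use G nxt in blast)+
  then show ?thesis by blast
qed

end

section \<open>A superinvariant vector of finite mass is invariant\<close>

text \<open>
  Read \<open>a t v\<close> as the mass that is moved from \<open>t\<close> to \<open>v\<close>: everything that is at \<open>t\<close> is moved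
  somewhere, and \<open>v\<close> receives at most \<open>h v\<close>. Summing over all \<open>v\<close> gives the same finite total on both
  sides, so each \<open>v\<close> receives exactly \<open>h v\<close>.
\<close>
lemma substochastic_stationary:
  fixes a :: "nat \<Rightarrow> nat \<Rightarrow> real" and h :: "nat \<Rightarrow> real"
  assumes nn: "\<And>t v. 0 \<le> a t v"
    and le: "\<And>n v. (\<Sum>t<n. a t v) \<le> h v"
    and out: "\<And>t. a t sums h t" and h: "summable h"
  shows "(\<lambda>t. a t v) sums h v"
proof -
  have sm: "summable (\<lambda>t. a t v)" for v
    by (rule bounded_imp_summable[of _ "h v"]) (use nn le[where n="Suc _" and v=v] in \<open>simp_all only: lessThan_Suc_atMost\<close>)
  define f where "f v = (\<Sum>t. a t v)" for v
  have f0: "0 \<le> f v" for v unfolding f_def by (rule suminf_nonneg[OF sm]) (rule nn)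
  have fh: "f v \<le> h v" for v unfolding f_def by (rule suminf_le_const[OF sm]) (rule le)
  have sf: "summable f" by (rule summable_comparison_test[OF _ h]) (use f0 fh in auto)
  have h0: "0 \<le> h v" for v using f0 fh order_trans by blast
  have "ennreal (\<Sum>v. f v) = (\<Sum>v. ennreal (f v))" by (rule suminf_ennreal2[symmetric, OF f0 sf])
  also have "\<dots> = (\<Sum>v. \<Sum>t. ennreal (a t v))"
    unfolding f_def by (intro suminf_cong suminf_ennreal2[symmetric] nn sm)
  also have "\<dots> = (\<integral>\<^sup>+v. \<integral>\<^sup>+t. ennreal (a t v) \<partial>count_space UNIV \<partial>count_space UNIV)"
    by (simp add: nn_integral_count_space_nat)
  also have "\<dots> = (\<integral>\<^sup>+t. \<integral>\<^sup>+v. ennreal (a t v) \<partial>count_space UNIV \<partial>count_space UNIV)"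
    by (rule nn_integral_count_space_nn_integral) auto
  also have "\<dots> = (\<Sum>t. \<Sum>v. ennreal (a t v))"
    by (simp add: nn_integral_count_space_nat)
  also have "\<dots> = (\<Sum>t. ennreal (h t))"
    using out by (intro suminf_cong) (auto simp: sums_iff suminf_ennreal2[OF nn])
  also have "\<dots> = ennreal (\<Sum>t. h t)" by (rule suminf_ennreal2[OF h0 h])
  finally have "(\<Sum>v. f v) = (\<Sum>v. h v)"
    using f0 h0 sf h by (simp add: suminf_nonneg)
  then have "(\<Sum>v. h v - f v) = 0" using suminf_diff[OF h sf] by simp
  then have "h v - f v = 0"
    using suminf_eq_zero_iff[OF summable_diff[OF h sf]] fh by simp
  then show ?thesis using sm[of v] by (simp add: f_def sums_iff)
qed

section \<open>The tower map over good points\<close>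
locale good_tower = hofbauer_tower M X N Z T s \<alpha> D
  for M :: "'a::euclidean_space measure" and X N Z T s \<alpha> D +
  fixes G :: "'a set"
  assumes good: "good_set G"
begin

lemma G_borel: "G \<in> sets borel"
  and G_regular: "G \<subseteq> regular"
  and G_full: "X - G \<in> null_sets M"
  and G_invariant: "x \<in> G \<Longrightarrow> T x \<in> G"
  using good unfolding good_set_def by blast+

lemma G_successor:
  "x \<in> G \<Longrightarrow> u \<in> \<alpha> \<Longrightarrow> j \<in> {1..N} \<Longrightarrow> x \<in> D u \<Longrightarrow> T x \<in> Z j \<Longrightarrow>
    \<exists>v\<in>\<alpha>. arrow_via M Z T D j u v \<and> T x \<in> D v"
  using good unfolding good_set_def by blast

lemma G_separating:
  "b \<in> Basis \<Longrightarrow> \<exists>B\<in>sigma_sets X (cylinder M Z T ` words M N Z T).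
       \<forall>x\<in>G. x \<bullet> b < of_rat q \<longleftrightarrow> x \<in> B"
  using good unfolding good_set_def by blast

lemma G_subset: "G \<subseteq> X"
  using G_regular regular_subset by blast

lemma G_sets: "G \<in> sets M"
  using G_borel G_subset by (rule borel_in_sets_M)

lemma emeasure_Int_G: "A \<in> sets M \<Longrightarrow> emeasure M (A \<inter> G) = emeasure M A"
proof -
  assume A: "A \<in> sets M"
  then have "A \<inter> G = A - (X - G)" using sets.sets_into_space[OF A] by (auto simp: space_M)
  then show ?thesis using A G_full by (simp add: emeasure_Diff_null_set)
qed

lemma G_branch: "x \<in> G \<Longrightarrow> u \<in> \<alpha> \<Longrightarrow> x \<in> D u \<Longrightarrow> j \<in> {1..N} \<Longrightarrow> x \<in> Z j \<longleftrightarrow> j = branch u"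
  using regular_D(2)[of x "branch u" j] branch[of u] G_regular by blast

definition nxt :: "'a \<Rightarrow> nat \<Rightarrow> nat" where
  "nxt x u = snd (tower_map M N Z T \<alpha> D (x, u))"

abbreviation tmap :: "'a \<times> nat \<Rightarrow> 'a \<times> nat" where
  "tmap \<equiv> tower_map M N Z T \<alpha> D"

lemma tower_map_eq: "tmap (x, u) = (T x, nxt x u)"
  by (simp add: nxt_def tower_map_def)

lemma nxt_eqI:
  assumes x: "x \<in> G" and u: "u \<in> \<alpha>" "x \<in> D u" and v: "v \<in> \<alpha>" "arrows u v" "T x \<in> D v"
  shows "nxt x u = v"
proof -
  have Tx: "T x \<in> G" using x by (rule G_invariant)
  have v': "arrow_via M Z T D (branch v) u v" using arrow_iff u v by auto
  have j: "j = branch v" if "j \<in> {1..N}" "T x \<in> Z j" for j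
    using G_branch[OF Tx v(1,3) that(1)] that by auto
  have "(LEAST v. v \<in> \<alpha> \<and> (\<exists>j\<in>{1..N}. T x \<in> Z j \<and> arrow_via M Z T D j u v)) = v"
  proof (rule Least_equality)
    show "v \<in> \<alpha> \<and> (\<exists>j\<in>{1..N}. T x \<in> Z j \<and> arrow_via M Z T D j u v)"
      using v v' branch[OF v(1)] by blast
    fix w assume "w \<in> \<alpha> \<and> (\<exists>j\<in>{1..N}. T x \<in> Z j \<and> arrow_via M Z T D j u w)"
    then have "w = v" using successor_unique[OF u(1) _ v(1) branch(1)[OF v(1)] _ v'] j by blast
    then show "v \<le> w" by simp
  qed
  then show ?thesis by (simp add: nxt_def tower_map_def)
qed

lemma nxt:
  assumes x: "x \<in> G" and u: "u \<in> \<alpha>" "x \<in> D u"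
  shows "nxt x u \<in> \<alpha>" "arrows u (nxt x u)" "T x \<in> D (nxt x u)"
proof -
  obtain j where j: "j \<in> {1..N}" "T x \<in> Z j"
    using G_invariant[OF x] G_regular regular_cover by blast
  obtain v where v: "v \<in> \<alpha>" "arrow_via M Z T D j u v" "T x \<in> D v"
    using G_successor[OF x u(1) j(1) u(2) j(2)] by blast
  then have "arrows u v" using j unfolding arrow_def by blast
  then show "nxt x u \<in> \<alpha>" "arrows u (nxt x u)" "T x \<in> D (nxt x u)"
    using nxt_eqI[OF x u v(1) _ v(3)] v by auto
qed

text \<open>The \<open>LEAST\<close> in the tower map depends on the point only through the finite set of \<open>j\<close> with \<open>T x \<in> Z j\<close>.\<close>
lemma nxt_measurable: "(\<lambda>x. nxt x u) \<in> M \<rightarrow>\<^sub>M count_space UNIV"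
proof -
  define S where "S x = {j\<in>{1..N}. T x \<in> Z j}" for x
  define L where "L J = (LEAST v. v \<in> \<alpha> \<and> (\<exists>j\<in>J. arrow_via M Z T D j u v))" for J
  have "(\<lambda>v. v \<in> \<alpha> \<and> (\<exists>j\<in>{1..N}. T x \<in> Z j \<and> arrow_via M Z T D j u v)) =
      (\<lambda>v. v \<in> \<alpha> \<and> (\<exists>j\<in>S x. arrow_via M Z T D j u v))" for x
    by (simp only: S_def Bex_def mem_Collect_eq conj_assoc)
  from arg_cong[where f=Least, OF this] have "nxt x u = L (S x)" for x
    unfolding nxt_def tower_map_def L_def prod.case snd_conv .
  moreover have "S \<in> M \<rightarrow>\<^sub>M count_space (Pow {1..N})"
  proof (rule measurable_count_space_eq2[THEN iffD2])
    show "finite (Pow {1..N})" by simp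
    have "S -` {J} \<inter> space M \<in> sets M" if "J \<in> Pow {1..N}" for J
    proof -
      have *: "S x = J \<longleftrightarrow> (\<forall>j\<in>{1..N}. (x \<in> T -` Z j \<inter> X) = (j \<in> J))" if "x \<in> X" for x
        using that \<open>J \<in> Pow {1..N}\<close> unfolding S_def by blast
      have "S -` {J} \<inter> space M = {x \<in> space M. \<forall>j\<in>{1..N}. (x \<in> T -` Z j \<inter> X) = (j \<in> J)}"
        by (rule set_eqI) (use * in \<open>simp only: Int_iff vimage_singleton_eq mem_Collect_eq space_M conj_commute cong: conj_cong\<close>)
      also have "\<dots> \<in> sets M"
      proof (rule sets.sets_Collect_finite_All)
        fix j assume "j \<in> {1..N}"
        then have E: "T -` Z j \<inter> X \<in> sets M" by (intro preimage_in_sets_M Z_sets_M)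
        have "{x \<in> space M. (x \<in> T -` Z j \<inter> X) = (j \<in> J)} =
            (if j \<in> J then T -` Z j \<inter> X else space M - (T -` Z j \<inter> X))"
          by (auto simp: space_M)
        also have "\<dots> \<in> sets M" using E by (cases "j \<in> J") (simp_all only: if_True if_False sets.compl_sets)
        finally show "{x \<in> space M. (x \<in> T -` Z j \<inter> X) = (j \<in> J)} \<in> sets M" .
      qed simp
      finally show ?thesis .
    qed
    then show "S \<in> space M \<rightarrow> Pow {1..N} \<and> (\<forall>J\<in>Pow {1..N}. S -` {J} \<inter> space M \<in> sets M)"
      by (auto simp: S_def)
  qed
  ultimately show ?thesis
    using measurable_compose[of S M "count_space (Pow {1..N})" L "count_space UNIV"] by simp
qed

section \<open>The measure on the tower and the transfer of densities\<close>

definition fibre :: "('a \<times> nat) set \<Rightarrow> nat \<Rightarrow> 'a set" where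
  "fibre A u = {x. (x, u) \<in> A}"

abbreviation bar where "bar \<equiv> bar_measure M \<alpha> D"

lemma fibre_level: "A \<subseteq> tower \<alpha> D \<Longrightarrow> fst ` (A \<inter> level D u) = fibre A u \<inter> D u"
  by (force simp: fibre_def level_def tower_def)

lemma fibre_tower: "A \<subseteq> tower \<alpha> D \<Longrightarrow> fibre A u \<subseteq> D u"
  by (auto simp: fibre_def level_def tower_def)

lemma bar_sigma:
  "sigma_algebra (tower \<alpha> D) {A. A \<subseteq> tower \<alpha> D \<and> (\<forall>u\<in>\<alpha>. fst ` (A \<inter> level D u) \<in> sets M)}"
  (is "sigma_algebra ?S ?A")
proof -
  have A: "?A = {A. A \<subseteq> ?S \<and> (\<forall>u\<in>\<alpha>. fibre A u \<in> sets M)}"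
    using fibre_level fibre_tower by (auto simp: Int_absorb2)
  have 1: "fibre (?S - A) u = D u - fibre A u" if "u \<in> \<alpha>" for A u
    using that by (auto simp: fibre_def tower_def level_def)
  have 2: "fibre (\<Union>i. A i) u = (\<Union>i. fibre (A i) u)" for A u
    by (auto simp: fibre_def)
  show ?thesis unfolding A
    by (rule sigma_algebra_iff2[THEN iffD2])
      (auto simp: 1 2 level_set(2), auto simp: fibre_def)
qed

lemma space_bar: "space bar = tower \<alpha> D"
  unfolding bar_measure_def by (rule space_measure_of) auto

lemma sets_bar: "A \<in> sets bar \<longleftrightarrow> A \<subseteq> tower \<alpha> D \<and> (\<forall>u\<in>\<alpha>. fibre A u \<in> sets M)"
  unfolding bar_measure_def sigma_algebra.sets_measure_of_eq[OF bar_sigma]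
  using fibre_level[of A] fibre_tower[of A] by (auto simp: Int_absorb2)

lemma emeasure_bar:
  assumes A: "A \<in> sets bar"
  shows "emeasure bar A = (\<integral>\<^sup>+u. emeasure M (fibre A u) \<partial>count_space \<alpha>)"
proof -
  let ?A = "{A. A \<subseteq> tower \<alpha> D \<and> (\<forall>u\<in>\<alpha>. fst ` (A \<inter> level D u) \<in> sets M)}"
  let ?m = "\<lambda>A. \<integral>\<^sup>+u. emeasure M (fst ` (A \<inter> level D u)) \<partial>count_space \<alpha>"
  have AA: "A \<in> ?A" using A unfolding bar_measure_def sigma_algebra.sets_measure_of_eq[OF bar_sigma] .
  have "emeasure bar A = ?m A"
    unfolding bar_measure_def
  proof (rule emeasure_measure_of_sigma[OF bar_sigma _ _ AA])
    show "positive ?A ?m" by (simp add: positive_def)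
    show "countably_additive ?A ?m"
    proof (rule countably_additiveI)
      fix B :: "nat \<Rightarrow> ('a \<times> nat) set"
      assume B: "range B \<subseteq> ?A" "disjoint_family B"
      have "(\<Sum>i. ?m (B i)) = (\<integral>\<^sup>+u. (\<Sum>i. emeasure M (fst ` (B i \<inter> level D u))) \<partial>count_space \<alpha>)"
        by (rule nn_integral_suminf[symmetric]) simp
      also have "\<dots> = ?m (\<Union>i. B i)"
      proof (rule nn_integral_cong)
        fix u assume "u \<in> space (count_space \<alpha>)"
        then have u: "u \<in> \<alpha>" by simp
        have "disjoint_family (\<lambda>i. fst ` (B i \<inter> level D u))"
          using B(2) unfolding disjoint_family_on_def by (fastforce simp: level_def)
        then have "(\<Sum>i. emeasure M (fst ` (B i \<inter> level D u))) = emeasure M (\<Union>i. fst ` (B i \<inter> level D u))"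
          by (rule suminf_emeasure[rotated]) (use B u in auto)
        also have "(\<Union>i. fst ` (B i \<inter> level D u)) = fst ` ((\<Union>i. B i) \<inter> level D u)" by blast
        finally show "(\<Sum>i. emeasure M (fst ` (B i \<inter> level D u))) = emeasure M (fst ` (\<Union> (range B) \<inter> level D u))" .
      qed
      finally show "(\<Sum>i. ?m (B i)) = ?m (\<Union>i. B i)" .
    qed
  qed
  also have "\<dots> = (\<integral>\<^sup>+u. emeasure M (fibre A u) \<partial>count_space \<alpha>)"
    using A fibre_level[of A] fibre_tower[of A] by (intro nn_integral_cong) (auto simp: sets_bar Int_absorb2)
  finally show ?thesis .
qed

lemma emeasure_bar_level:
  assumes u: "u \<in> \<alpha>" and A: "A \<in> sets M" "A \<subseteq> D u"
  shows "A \<times> {u} \<in> sets bar" "emeasure bar (A \<times> {u}) = emeasure M A"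
proof -
  have sec: "fibre (A \<times> {u}) v = (if v = u then A else {})" for v by (auto simp: fibre_def)
  show m: "A \<times> {u} \<in> sets bar"
    using A u unfolding sets_bar sec by (auto simp: tower_def level_def)
  have "emeasure bar (A \<times> {u}) = (\<integral>\<^sup>+v. emeasure M A * indicator {u} v \<partial>count_space \<alpha>)"
    unfolding emeasure_bar[OF m] sec by (intro nn_integral_cong) (auto simp: indicator_def)
  also have "\<dots> = emeasure M A" using u by (subst nn_integral_cmult_indicator) auto
  finally show "emeasure bar (A \<times> {u}) = emeasure M A" .
qed

lemma level_sets_bar: "u \<in> \<alpha> \<Longrightarrow> level D u \<in> sets bar"
  unfolding level_def using emeasure_bar_level(1)[of u "D u"] level_set(2) by simp

lemma measure_bar_level: "u \<in> \<alpha> \<Longrightarrow> measure bar (level D u) = measure M (D u)"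
  unfolding level_def measure_def using emeasure_bar_level(2)[of u "D u"] level_set(2) by simp

lemma tower_preimage_sets:
  assumes A: "\<And>v. fibre A v \<in> sets M"
  shows "{x \<in> X. (T x, nxt x u) \<in> A} \<in> sets M"
proof -
  have "{x \<in> X. (T x, nxt x u) \<in> A} = (\<Union>v. (T -` fibre A v \<inter> X) \<inter> ((\<lambda>x. nxt x u) -` {v} \<inter> space M))"
    by (auto simp: fibre_def space_M)
  also have "\<dots> \<in> sets M"
    using preimage_in_sets_M[OF A] measurable_sets[OF nxt_measurable]
    by (intro sets.Int sets.countable_UN') auto
  finally show ?thesis .
qed

text \<open>
  The Markov property of the tower: over good points, level \<open>u\<close> is cut into the disjoint preimages of
  the levels \<open>v\<close> with \<open>u \<rightarrow> v\<close>, and each piece is stretched by the slope.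
\<close>
lemma emeasure_tower_preimage:
  assumes u: "u \<in> \<alpha>" and A: "\<And>v. fibre A v \<in> sets M"
  shows "emeasure M {x \<in> D u. (T x, nxt x u) \<in> A} =
    (\<integral>\<^sup>+v. (if arrows u v then emeasure M (fibre A v \<inter> D v) / ennreal (slope u) else 0) \<partial>count_space \<alpha>)"
proof -
  define Y where "Y v = (if arrows u v then {x \<in> D u \<inter> G. T x \<in> fibre A v \<inter> D v} else {})" for v
  have m: "{x \<in> D u. T x \<in> fibre A v \<inter> D v} \<in> sets M \<and>
      emeasure M {x \<in> D u. T x \<in> fibre A v \<inter> D v} = emeasure M (fibre A v \<inter> D v) / ennreal (slope u)"
    if v: "v \<in> \<alpha>" "arrows u v" for v
  proof -
    have B: "fibre A v \<inter> D v \<in> sets M" using A level_set(2)[OF v(1)] by auto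
    have "ennreal (slope u) \<noteq> 0" "ennreal (slope u) \<noteq> top" using slope[OF u] by auto
    then show ?thesis
      using emeasure_preimage_arrow[OF u v B] by (auto simp: ennreal_mult_divide_eq mult.commute[of "ennreal (slope u)"] dest!: sym[of "emeasure _ _ * _"])
  qed
  have mY: "Y v \<in> sets M \<and> emeasure M (Y v) = (if arrows u v then emeasure M (fibre A v \<inter> D v) / ennreal (slope u) else 0)"
    if v: "v \<in> \<alpha>" for v
  proof (cases "arrows u v")
    case True
    have "Y v = {x \<in> D u. T x \<in> fibre A v \<inter> D v} \<inter> G" using True by (auto simp: Y_def)
    then show ?thesis using m[OF v True] True sets.Int[OF _ G_sets] emeasure_Int_G by simp
  qed (simp add: Y_def)
  have eq: "{x \<in> D u. (T x, nxt x u) \<in> A} \<inter> G = (\<Union>v\<in>\<alpha>. Y v)"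
  proof (intro subset_antisym subsetI)
    fix x assume x: "x \<in> {x \<in> D u. (T x, nxt x u) \<in> A} \<inter> G"
    then have "x \<in> Y (nxt x u)" using nxt[of x u] u by (auto simp: Y_def fibre_def)
    then show "x \<in> (\<Union>v\<in>\<alpha>. Y v)" using nxt[of x u] u x by blast
  next
    fix x assume "x \<in> (\<Union>v\<in>\<alpha>. Y v)"
    then obtain v where v: "v \<in> \<alpha>" "x \<in> Y v" by auto
    then have "nxt x u = v" using nxt_eqI[of x u v] u by (auto simp: Y_def split: if_splits)
    then show "x \<in> {x \<in> D u. (T x, nxt x u) \<in> A} \<inter> G"
      using v by (auto simp: Y_def fibre_def split: if_splits)
  qed
  have "{x \<in> D u. (T x, nxt x u) \<in> A} = D u \<inter> {x \<in> X. (T x, nxt x u) \<in> A}"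
    using level_set(4)[OF u] by auto
  then have "{x \<in> D u. (T x, nxt x u) \<in> A} \<in> sets M"
    using level_set(2)[OF u] tower_preimage_sets[OF A] by simp
  then have "emeasure M {x \<in> D u. (T x, nxt x u) \<in> A} = emeasure M (\<Union>v\<in>\<alpha>. Y v)"
    using emeasure_Int_G eq by metis
  also have "\<dots> = (\<integral>\<^sup>+v. emeasure M (Y v) \<partial>count_space \<alpha>)"
  proof (rule emeasure_UN_countable)
    show "disjoint_family_on Y \<alpha>"
      unfolding disjoint_family_on_def using nxt_eqI[OF _ u] by (auto simp: Y_def split: if_splits)
  qed (use mY in auto)
  also have "\<dots> = (\<integral>\<^sup>+v. (if arrows u v then emeasure M (fibre A v \<inter> D v) / ennreal (slope u) else 0) \<partial>count_space \<alpha>)"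
    by (rule nn_integral_cong) (use mY in auto)
  finally show ?thesis .
qed

end

lemma sums_of_ennreal_suminf:
  fixes f :: "nat \<Rightarrow> real"
  assumes nn: "\<And>i. 0 \<le> f i" and eq: "(\<Sum>i. ennreal (f i)) = ennreal c" and c: "0 \<le> c"
  shows "f sums c"
proof -
  have sm: "summable f" using summable_suminf_not_top[of f] nn eq by simp
  then have "ennreal (\<Sum>i. f i) = ennreal c" using suminf_ennreal2[OF nn sm] eq by simp
  then have "(\<Sum>i. f i) = c" using suminf_nonneg[OF sm nn] c by simp
  then show ?thesis using sm by (simp add: sums_iff)
qed

context good_tower
begin

abbreviation base where "base \<equiv> tower_base N D"

lemma base_subset: "base \<subseteq> tower \<alpha> D" "base \<subseteq> X \<times> UNIV"
  using base_index level_set(4) by (auto simp: tower_base_def tower_def level_def)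

lemma tmap_iterate_into: "p \<in> X \<times> UNIV \<Longrightarrow> (tmap ^^ k) p \<in> X \<times> UNIV"
proof (induction k)
  case (Suc k)
  obtain x u where xu: "(tmap ^^ k) p = (x, u)" by fastforce
  then have "x \<in> X" using Suc by simp
  then show ?case using T_into xu by (auto simp: tower_map_eq)
qed simp

text \<open>
  The densities of the images of the measure on the base under the iterates of the tower map, as
  \<open>iterate_density\<close> shows.
\<close>
fun density :: "nat \<Rightarrow> nat \<Rightarrow> ennreal" where
  "density 0 u = (if u \<in> {1..N} then 1 else 0)"
| "density (Suc k) v = (\<integral>\<^sup>+u. (if arrows u v then density k u / ennreal (slope u) else 0) \<partial>count_space \<alpha>)"

lemma iterate_density:
  assumes "A \<subseteq> X \<times> UNIV" "\<And>u. fibre A u \<in> sets M"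
  shows "(tmap ^^ k) -` A \<inter> base \<in> sets bar \<and>
    emeasure bar ((tmap ^^ k) -` A \<inter> base) = (\<integral>\<^sup>+u. density k u * emeasure M (fibre A u \<inter> D u) \<partial>count_space \<alpha>)"
  using assms
proof (induction k arbitrary: A)
  case 0
  have fib: "fibre (A \<inter> base) u = (if u \<in> {1..N} then fibre A u \<inter> D u else {})" for u
    by (auto simp: fibre_def tower_base_def level_def)
  have m: "A \<inter> base \<in> sets bar"
    unfolding sets_bar fib using base_subset(1) 0(2) level_set(2) by auto
  then show ?case
    by (auto simp: emeasure_bar fib intro!: nn_integral_cong)
next
  case (Suc k)
  define A' where "A' = tmap -` A \<inter> X \<times> UNIV"
  have fib: "fibre A' u = {x \<in> X. (T x, nxt x u) \<in> A}" for u
    by (auto simp: A'_def fibre_def tower_map_eq)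
  have A': "A' \<subseteq> X \<times> UNIV" "\<And>u. fibre A' u \<in> sets M"
    unfolding fib using tower_preimage_sets[OF Suc.prems(2)] by (auto simp: A'_def)
  have eq: "(tmap ^^ Suc k) -` A \<inter> base = (tmap ^^ k) -` A' \<inter> base"
    using tmap_iterate_into base_subset(2) unfolding A'_def by auto
  have fD: "fibre A' u \<inter> D u = {x \<in> D u. (T x, nxt x u) \<in> A}" if "u \<in> \<alpha>" for u
    unfolding fib using level_set(4)[OF that] by auto
  have "emeasure bar ((tmap ^^ k) -` A' \<inter> base) =
      (\<integral>\<^sup>+u. density k u * emeasure M (fibre A' u \<inter> D u) \<partial>count_space \<alpha>)"
    using Suc.IH[OF A'] by simp
  also have "\<dots> = (\<integral>\<^sup>+u. \<integral>\<^sup>+v. density k u *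
      (if arrows u v then emeasure M (fibre A v \<inter> D v) / ennreal (slope u) else 0) \<partial>count_space \<alpha> \<partial>count_space \<alpha>)"
    by (rule nn_integral_cong) (simp add: fD emeasure_tower_preimage[OF _ Suc.prems(2)] nn_integral_cmult)
  also have "\<dots> = (\<integral>\<^sup>+v. \<integral>\<^sup>+u. density k u *
      (if arrows u v then emeasure M (fibre A v \<inter> D v) / ennreal (slope u) else 0) \<partial>count_space \<alpha> \<partial>count_space \<alpha>)"
    by (rule nn_integral_count_space_nn_integral) auto
  also have "\<dots> = (\<integral>\<^sup>+v. \<integral>\<^sup>+u. (if arrows u v then density k u / ennreal (slope u) else 0) *
      emeasure M (fibre A v \<inter> D v) \<partial>count_space \<alpha> \<partial>count_space \<alpha>)"
    by (intro nn_integral_cong) (auto simp: divide_ennreal_def mult_ac)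
  also have "\<dots> = (\<integral>\<^sup>+v. density (Suc k) v * emeasure M (fibre A v \<inter> D v) \<partial>count_space \<alpha>)"
    by (simp add: nn_integral_multc)
  finally show ?case unfolding eq using Suc.IH[OF A'] by simp
qed

text \<open>The sets \<open>Z u\<close> are disjoint over the good points.\<close>
lemma emeasure_base: "emeasure bar base \<le> 1"
proof -
  have fib: "fibre base u = (if u \<in> {1..N} then D u else {})" for u
    by (auto simp: fibre_def tower_base_def level_def)
  have sub: "{1..N} \<subseteq> \<alpha>" by (rule base_index)
  have m: "base \<in> sets bar"
    unfolding sets_bar fib using base_subset(1) level_set(2) by auto
  have "emeasure bar base = (\<integral>\<^sup>+u. emeasure M (D u \<inter> G) * indicator {1..N} u \<partial>count_space \<alpha>)"
    unfolding emeasure_bar[OF m] fib using level_set(2)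
    by (intro nn_integral_cong) (auto simp: indicator_def emeasure_Int_G)
  also have "\<dots> = (\<integral>\<^sup>+u. emeasure M (D u \<inter> G) \<partial>count_space {1..N})"
    using sub by (subst (1 2) nn_integral_count_space_indicator) (auto intro!: nn_integral_cong simp: indicator_def)
  also have "\<dots> = emeasure M (\<Union>u\<in>{1..N}. D u \<inter> G)"
  proof (rule emeasure_UN_countable[symmetric])
    show "D u \<inter> G \<in> sets M" if "u \<in> {1..N}" for u
      using that sub level_set(2) G_sets by blast
    show "disjoint_family_on (\<lambda>u. D u \<inter> G) {1..N}"
      unfolding disjoint_family_on_def
    proof (intro ballI impI equals0I)
      fix u v x assume uv: "u \<in> {1..N}" "v \<in> {1..N}" "u \<noteq> v" and x: "x \<in> D u \<inter> G \<inter> (D v \<inter> G)"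
      have "x \<in> Z u" "x \<in> Z v" "x \<in> regular" using x base_set uv G_regular by blast+
      then show False using regular_D(2)[of x u v] uv by blast
    qed
  qed auto
  also have "\<dots> \<le> 1" by (rule emeasure_le_1)
  finally show ?thesis .
qed

definition visits :: "nat \<Rightarrow> nat \<Rightarrow> ennreal" where
  "visits k v = density k v * emeasure M (D v)"

lemma visits_eq:
  assumes v: "v \<in> \<alpha>"
  shows "emeasure bar ((tmap ^^ k) -` level D v \<inter> base) = visits k v"
proof -
  have fib: "fibre (level D v) u = (if u = v then D v else {})" for u
    by (auto simp: fibre_def level_def)
  have sub: "level D v \<subseteq> X \<times> UNIV" using level_set(4)[OF v] by (auto simp: level_def)
  have fm: "fibre (level D v) u \<in> sets M" for u using level_set(2)[OF v] by (simp add: fib)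
  have "emeasure bar ((tmap ^^ k) -` level D v \<inter> base) =
      (\<integral>\<^sup>+u. density k u * emeasure M (fibre (level D v) u \<inter> D u) \<partial>count_space \<alpha>)"
    using iterate_density[OF sub fm] by blast
  also have "\<dots> = (\<integral>\<^sup>+u. visits k v * indicator {v} u \<partial>count_space \<alpha>)"
    unfolding fib visits_def by (intro nn_integral_cong) (auto simp: indicator_def)
  also have "\<dots> = visits k v" using v by (subst nn_integral_cmult_indicator) auto
  finally show ?thesis .
qed

lemma visits_total: "(\<integral>\<^sup>+v. visits k v \<partial>count_space \<alpha>) \<le> 1"
proof -
  have "(\<integral>\<^sup>+v. visits k v \<partial>count_space \<alpha>) = emeasure bar ((tmap ^^ k) -` (X \<times> UNIV) \<inter> base)"
  proof -
    have fib: "fibre (X \<times> UNIV) u = X" for u by (auto simp: fibre_def)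
    have "X \<in> sets M" by (metis sets.top space_M)
    then have "emeasure bar ((tmap ^^ k) -` (X \<times> UNIV) \<inter> base) =
      (\<integral>\<^sup>+u. density k u * emeasure M (X \<inter> D u) \<partial>count_space \<alpha>)"
      using iterate_density[of "X \<times> UNIV" k] unfolding fib by simp
    also have "\<dots> = (\<integral>\<^sup>+v. visits k v \<partial>count_space \<alpha>)"
      unfolding visits_def using level_set(4) by (intro nn_integral_cong) (auto simp: Int_absorb1)
    finally show ?thesis by simp
  qed
  also have "(tmap ^^ k) -` (X \<times> UNIV) \<inter> base = base"
    using tmap_iterate_into base_subset(2) by blast
  finally show ?thesis using emeasure_base by simp
qed

lemma visits_le_1:
  assumes "finite F" "F \<subseteq> \<alpha>"
  shows "(\<Sum>v\<in>F. visits k v) \<le> 1"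
proof -
  have "(\<Sum>v\<in>F. visits k v) = (\<integral>\<^sup>+v. visits k v \<partial>count_space F)"
    using assms by (simp add: nn_integral_count_space_finite)
  also have "\<dots> \<le> (\<integral>\<^sup>+v. visits k v \<partial>count_space \<alpha>)"
    using assms by (subst (1 2) nn_integral_count_space_indicator) (auto intro!: nn_integral_mono simp: indicator_def)
  finally show ?thesis using visits_total order_trans by blast
qed

lemma visits_finite: "v \<in> \<alpha> \<Longrightarrow> visits k v < top"
proof -
  assume "v \<in> \<alpha>"
  then have "visits k v \<le> 1" using visits_le_1[of "{v}" k] by simp
  also have "(1 :: ennreal) < top" by simp
  finally show ?thesis .
qed

abbreviation mass :: "nat \<Rightarrow> real" where "mass u \<equiv> measure M (D u)"

lemma mass_pos: "u \<in> \<alpha> \<Longrightarrow> mass u > 0"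
  using level_set(5)[of u] by (simp add: emeasure_eq_measure)

text \<open>
  The transition matrix on \<open>\<alpha>\<close>, extended by \<open>0\<close> so as to be summed over all natural numbers.
\<close>
definition transition :: "nat \<Rightarrow> nat \<Rightarrow> real" where
  "transition t v = (if t \<in> \<alpha> \<and> v \<in> \<alpha> \<and> arrows t v then mass v / (slope t * mass t) else 0)"

lemma transition_nonneg: "transition t v \<ge> 0"
  unfolding transition_def using slope[of t] by auto

lemma visits_Suc:
  assumes v: "v \<in> \<alpha>"
  shows "visits (Suc k) v = (\<integral>\<^sup>+t. visits k t * ennreal (transition t v) \<partial>count_space \<alpha>)"
proof -
  have "visits (Suc k) v = (\<integral>\<^sup>+t. (if arrows t v then density k t / ennreal (slope t) else 0) * emeasure M (D v) \<partial>count_space \<alpha>)"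
    unfolding visits_def by (simp add: nn_integral_multc)
  also have "\<dots> = (\<integral>\<^sup>+t. visits k t * ennreal (transition t v) \<partial>count_space \<alpha>)"
  proof (rule nn_integral_cong)
    fix t assume "t \<in> space (count_space \<alpha>)"
    then have t: "t \<in> \<alpha>" by simp
    have "density k t / ennreal (slope t) * ennreal (mass v) =
        density k t * ennreal (mass t) * ennreal (mass v / (slope t * mass t))"
    proof -
      have "ennreal (mass t) * ennreal (mass v / (slope t * mass t)) = ennreal (mass v / slope t)"
        using mass_pos[OF t] slope[OF t] by (subst ennreal_mult[symmetric]) auto
      also have "\<dots> = ennreal (mass v) / ennreal (slope t)"
        using slope[OF t] by (simp add: divide_ennreal)
      finally have *: "ennreal (mass t) * ennreal (mass v / (slope t * mass t)) = ennreal (mass v) / ennreal (slope t)" .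
      show ?thesis unfolding mult.assoc * by (simp add: divide_ennreal_def mult_ac)
    qed
    then show "(if arrows t v then density k t / ennreal (slope t) else 0) * emeasure M (D v) =
        visits k t * ennreal (transition t v)"
      using t v by (simp add: visits_def transition_def emeasure_eq_measure)
  qed
  finally show ?thesis .
qed

lemma transition_sums:
  assumes t: "t \<in> \<alpha>" shows "transition t sums 1"
proof (rule sums_of_ennreal_suminf)
  have X: "X \<in> sets M" by (metis sets.top space_M)
  have fib: "fibre (X \<times> UNIV) u = X" for u by (auto simp: fibre_def)
  have "ennreal (mass t) = emeasure M {x \<in> D t. (T x, nxt x t) \<in> X \<times> UNIV}"
    using level_set(4)[OF t] T_into by (auto simp: emeasure_eq_measure Pi_iff subset_iff intro!: arg_cong[where f="measure M"])
  also have "\<dots> = (\<integral>\<^sup>+v. (if arrows t v then emeasure M (X \<inter> D v) / ennreal (slope t) else 0) \<partial>count_space \<alpha>)"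
    using emeasure_tower_preimage[OF t, of "X \<times> UNIV"] X unfolding fib by simp
  also have "\<dots> = (\<integral>\<^sup>+v. ennreal (mass t) * ennreal (transition t v) \<partial>count_space \<alpha>)"
  proof (rule nn_integral_cong)
    fix v assume "v \<in> space (count_space \<alpha>)"
    then have v: "v \<in> \<alpha>" by simp
    have "ennreal (mass v) / ennreal (slope t) = ennreal (mass t) * ennreal (mass v / (slope t * mass t))"
      using mass_pos[OF t] slope[OF t] by (subst ennreal_mult[symmetric]) (auto simp: divide_ennreal)
    then show "(if arrows t v then emeasure M (X \<inter> D v) / ennreal (slope t) else 0) = ennreal (mass t) * ennreal (transition t v)"
      using t v level_set(4)[OF v] by (simp add: transition_def emeasure_eq_measure Int_absorb1)
  qed
  also have "\<dots> = (\<integral>\<^sup>+v. ennreal (mass t) * ennreal (transition t v) \<partial>count_space UNIV)"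
    by (subst nn_integral_count_space_indicator) (auto intro!: nn_integral_cong simp: indicator_def transition_def)
  also have "\<dots> = ennreal (mass t) * (\<Sum>v. ennreal (transition t v))"
    by (simp add: nn_integral_cmult nn_integral_count_space_nat)
  finally have "ennreal (mass t) * 1 = ennreal (mass t) * (\<Sum>v. ennreal (transition t v))" by simp
  then show "(\<Sum>v. ennreal (transition t v)) = ennreal 1"
    using mass_pos[OF t] by (subst (asm) ennreal_mult_cancel_left) auto
qed (auto simp: transition_nonneg)

lemma transition_matrix_eq:
  assumes tu: "t \<in> \<alpha>" "u \<in> \<alpha>"
  shows "transition_matrix M N Z T \<alpha> D t u = transition t u"
proof -
  have fib: "fibre (level D u) v = (if v = u then D u else {})" for v
    by (auto simp: fibre_def level_def)
  let ?A = "{x \<in> D t. (T x, nxt x t) \<in> level D u}"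
  have A: "?A \<in> sets M"
  proof -
    have "?A = D t \<inter> {x \<in> X. (T x, nxt x t) \<in> level D u}" using level_set(4)[OF tu(1)] by auto
    also have "\<dots> \<in> sets M"
      using level_set(2) tu by (intro sets.Int tower_preimage_sets) (auto simp: fib)
    finally show ?thesis .
  qed
  have "level D t \<inter> tmap -` level D u = ?A \<times> {t}"
    by (auto simp: level_def tower_map_eq)
  then have "emeasure bar (level D t \<inter> tmap -` level D u) = emeasure M ?A"
    using emeasure_bar_level(2)[OF tu(1) A] by auto
  also have "\<dots> = (\<integral>\<^sup>+v. (if arrows t v then emeasure M (fibre (level D u) v \<inter> D v) / ennreal (slope t) else 0) \<partial>count_space \<alpha>)"
    using level_set(2)[OF tu(2)] by (intro emeasure_tower_preimage[OF tu(1)]) (simp add: fib)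
  also have "\<dots> = (\<integral>\<^sup>+v. (if arrows t u then ennreal (mass u / slope t) else 0) * indicator {u} v \<partial>count_space \<alpha>)"
    using slope[OF tu(1)]
    by (intro nn_integral_cong) (auto simp: fib indicator_def emeasure_eq_measure divide_ennreal)
  also have "\<dots> = ennreal (if arrows t u then mass u / slope t else 0)"
    using tu by (subst nn_integral_cmult_indicator) auto
  finally have "measure bar (level D t \<inter> tmap -` level D u) = (if arrows t u then mass u / slope t else 0)"
    unfolding measure_def using slope[OF tu(1)] by (simp add: measure_nonneg)
  then show ?thesis
    unfolding transition_matrix_def measure_bar_level[OF tu(1)] transition_def using tu by simp
qed

lemma emeasure_lift_average:
  assumes v: "v \<in> \<alpha>"
  shows "emeasure (lift_average M N Z T \<alpha> D n) (level D v) = ennreal (1 / real n) * (\<Sum>k<n. visits k v)"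
proof -
  let ?m = "\<lambda>A. ennreal (1 / real n) * (\<Sum>k<n. emeasure bar ((tmap ^^ k) -` A \<inter> base))"
  have "sigma_algebra (tower \<alpha> D) (sets bar)" by (metis sets.sigma_algebra_axioms space_bar)
  then have "emeasure (lift_average M N Z T \<alpha> D n) (level D v) = ?m (level D v)"
    unfolding lift_average_def
  proof (rule emeasure_measure_of_sigma)
    show "positive (sets bar) ?m" by (simp add: positive_def)
    show "countably_additive (sets bar) ?m"
    proof (rule countably_additiveI)
      fix A :: "nat \<Rightarrow> ('a \<times> nat) set"
      assume A: "range A \<subseteq> sets bar" "disjoint_family A"
      have m: "(tmap ^^ k) -` A i \<inter> base \<in> sets bar" for i k
      proof -
        have Ai: "A i \<in> sets bar" using A by auto
        have "fibre (A i) u \<in> sets M" for u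
        proof (cases "u \<in> \<alpha>")
          case True then show ?thesis using Ai by (simp add: sets_bar)
        next
          case False
          then have "fibre (A i) u = {}" using Ai by (auto simp: sets_bar fibre_def tower_def level_def)
          then show ?thesis by simp
        qed
        moreover have "A i \<subseteq> X \<times> UNIV" using Ai level_set(4) by (fastforce simp: sets_bar tower_def level_def)
        ultimately show ?thesis using iterate_density by blast
      qed
      have "(\<Sum>i. ?m (A i)) = ennreal (1 / real n) * (\<Sum>i. \<Sum>k<n. emeasure bar ((tmap ^^ k) -` A i \<inter> base))"
        by (rule ennreal_suminf_cmult)
      also have "(\<Sum>i. \<Sum>k<n. emeasure bar ((tmap ^^ k) -` A i \<inter> base)) =
          (\<Sum>k<n. \<Sum>i. emeasure bar ((tmap ^^ k) -` A i \<inter> base))"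
        by (rule suminf_sum) simp
      also have "\<dots> = (\<Sum>k<n. emeasure bar ((tmap ^^ k) -` (\<Union>i. A i) \<inter> base))"
      proof (rule sum.cong)
        fix k
        have "(\<Sum>i. emeasure bar ((tmap ^^ k) -` A i \<inter> base)) = emeasure bar (\<Union>i. (tmap ^^ k) -` A i \<inter> base)"
        proof (rule suminf_emeasure)
          show "disjoint_family (\<lambda>i. (tmap ^^ k) -` A i \<inter> base)"
            using A(2) unfolding disjoint_family_on_def by blast
        qed (use m in blast)
        also have "(\<Union>i. (tmap ^^ k) -` A i \<inter> base) = (tmap ^^ k) -` (\<Union>i. A i) \<inter> base" by blast
        finally show "(\<Sum>i. emeasure bar ((tmap ^^ k) -` A i \<inter> base)) =
          emeasure bar ((tmap ^^ k) -` (\<Union>i. A i) \<inter> base)" .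
      qed simp
      finally show "(\<Sum>i. ?m (A i)) = ?m (\<Union>i. A i)" .
    qed
    show "level D v \<in> sets bar" using v by (rule level_sets_bar)
  qed
  then show ?thesis by (simp add: visits_eq[OF v])
qed

end

section \<open>The lift is stationary\<close>

locale lifted_tower = good_tower M X N Z T s \<alpha> D G
  for M :: "'a::euclidean_space measure" and X N Z T s \<alpha> D G +
  fixes H :: "('a \<times> nat) measure"
  assumes lifts: "lifts_to M N Z T \<alpha> D H"
begin

abbreviation I :: "nat set" where "I \<equiv> kept \<alpha> D H"
abbreviation \<rho> :: "nat \<Rightarrow> real" where "\<rho> \<equiv> rho M \<alpha> D H"

definition lift_mass :: "nat \<Rightarrow> real" where
  "lift_mass v = (if v \<in> \<alpha> then measure H (level D v) else 0)"

lemma lift_mass_nonneg: "0 \<le> lift_mass v" by (simp add: lift_mass_def)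

definition average :: "nat \<Rightarrow> nat \<Rightarrow> real" where
  "average n v = (\<Sum>k<n. enn2real (visits k v)) / real n"

text \<open>
  The indicator function of a level is an admissible test function: the levels are compact, and open
  in the tower.
\<close>
lemma average_tendsto:
  assumes v: "v \<in> \<alpha>" shows "(\<lambda>n. average n v) \<longlonglongrightarrow> lift_mass v"
proof -
  let ?L = "lift_average M N Z T \<alpha> D"
  define f where "f = (indicat_real (UNIV \<times> {v}) :: 'a \<times> nat \<Rightarrow> real)"
  have "continuous_on (tower \<alpha> D) ((\<lambda>u::nat. indicat_real {v} u) \<circ> snd)"
    by (intro continuous_on_compose continuous_intros) simp
  moreover have "(\<lambda>u::nat. indicat_real {v} u) \<circ> snd = f"
    by (auto simp: f_def fun_eq_iff indicator_def)
  ultimately have 1: "continuous_on (tower \<alpha> D) f" by simp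
  have "compact (level D v)" unfolding level_def by (intro compact_Times level_set(1) v) simp
  moreover have "level D v \<subseteq> tower \<alpha> D" using v by (auto simp: tower_def)
  moreover have "\<forall>p\<in>tower \<alpha> D - level D v. f p = 0" by (auto simp: f_def tower_def level_def indicator_def)
  ultimately have "(\<lambda>n. integral\<^sup>L (?L n) f) \<longlonglongrightarrow> integral\<^sup>L H f"
    using lifts 1 unfolding lifts_to_def by blast
  moreover have tow: "UNIV \<times> {v} \<inter> tower \<alpha> D = level D v" using v by (auto simp: tower_def level_def)
  have "space H = tower \<alpha> D"
    using lifts sets_eq_imp_space_eq space_bar unfolding lifts_to_def by metis
  then have "integral\<^sup>L H f = lift_mass v"
    unfolding f_def using v tow by (simp add: lift_mass_def)
  moreover have "integral\<^sup>L (?L n) f = average n v" for n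
  proof -
    have "space (?L n) = tower \<alpha> D"
      unfolding lift_average_def using sets.space_closed[of bar] by (simp add: space_bar)
    then have "integral\<^sup>L (?L n) f = measure (?L n) (level D v)"
      unfolding f_def using tow by simp
    also have "\<dots> = average n v"
      using visits_finite[OF v] unfolding measure_def emeasure_lift_average[OF v] average_def
      by (simp add: enn2real_mult enn2real_sum)
    finally show ?thesis .
  qed
  ultimately show ?thesis by simp
qed

lemma lift_mass_sum_le_1:
  assumes F: "finite F" shows "(\<Sum>v\<in>F. lift_mass v) \<le> 1"
proof -
  let ?F = "F \<inter> \<alpha>"
  have "(\<lambda>n. \<Sum>v\<in>?F. average n v) \<longlonglongrightarrow> (\<Sum>v\<in>?F. lift_mass v)"
    by (intro tendsto_sum average_tendsto) auto
  moreover have "(\<Sum>v\<in>?F. average n v) \<le> 1" for n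
  proof -
    have le: "(\<Sum>v\<in>?F. enn2real (visits k v)) \<le> 1" for k
    proof -
      have "(\<Sum>v\<in>?F. enn2real (visits k v)) = enn2real (\<Sum>v\<in>?F. visits k v)"
        by (subst enn2real_sum) (auto simp: visits_finite)
      also have "\<dots> \<le> enn2real 1"
        using visits_le_1[of ?F k] F by (intro enn2real_mono) auto
      finally show ?thesis by simp
    qed
    have "(\<Sum>v\<in>?F. average n v) = (\<Sum>k<n. \<Sum>v\<in>?F. enn2real (visits k v)) / real n"
      unfolding average_def sum_divide_distrib[symmetric] by (subst sum.swap) simp
    also have "\<dots> \<le> (\<Sum>k<n. 1) / real n"
      by (intro divide_right_mono sum_mono le) simp
    also have "\<dots> \<le> 1" by simp
    finally show ?thesis .
  qed
  ultimately have "(\<Sum>v\<in>?F. lift_mass v) \<le> 1" by (blast intro: LIMSEQ_le_const2)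
  moreover have "(\<Sum>v\<in>F. lift_mass v) = (\<Sum>v\<in>?F. lift_mass v)"
    using F by (intro sum.mono_neutral_right) (auto simp: lift_mass_def)
  ultimately show ?thesis by simp
qed

text \<open>
  Moving an average one step forward changes only its first and last term, so it costs at most
  \<open>1 / n\<close>. Finite sums pass to the limit; infinitely many levels together may lose mass.
\<close>
lemma lift_mass_superinvariant: "(\<Sum>t<m. lift_mass t * transition t v) \<le> lift_mass v"
proof (cases "v \<in> \<alpha>")
  case False then show ?thesis by (simp add: transition_def lift_mass_def)
next
  case v: True
  let ?F = "{..<m} \<inter> \<alpha>"
  let ?c = "\<lambda>k t. enn2real (visits k t)"
  have step: "(\<Sum>t\<in>?F. ?c k t * transition t v) \<le> ?c (Suc k) v" for k
  proof -
    have "(\<Sum>t\<in>?F. ?c k t * transition t v) = enn2real (\<Sum>t\<in>?F. visits k t * ennreal (transition t v))"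
      using visits_finite transition_nonneg
      by (subst enn2real_sum) (auto simp: enn2real_mult ennreal_mult_less_top)
    also have "\<dots> \<le> enn2real (visits (Suc k) v)"
    proof (rule enn2real_mono)
      have "(\<Sum>t\<in>?F. visits k t * ennreal (transition t v)) = (\<integral>\<^sup>+t. visits k t * ennreal (transition t v) \<partial>count_space ?F)"
        by (simp add: nn_integral_count_space_finite)
      also have "\<dots> \<le> (\<integral>\<^sup>+t. visits k t * ennreal (transition t v) \<partial>count_space \<alpha>)"
        by (subst (1 2) nn_integral_count_space_indicator) (auto intro!: nn_integral_mono simp: indicator_def)
      finally show "(\<Sum>t\<in>?F. visits k t * ennreal (transition t v)) \<le> visits (Suc k) v"
        by (simp only: visits_Suc[OF v])
    qed (rule visits_finite[OF v])
    finally show ?thesis .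
  qed
  have "(\<lambda>n. \<Sum>t\<in>?F. average n t * transition t v) \<longlonglongrightarrow> (\<Sum>t\<in>?F. lift_mass t * transition t v)"
    by (intro tendsto_intros average_tendsto) auto
  moreover have "(\<lambda>n. average n v + 1 / real n) \<longlonglongrightarrow> lift_mass v + 0"
    by (intro tendsto_add average_tendsto v lim_1_over_n)
  moreover have "(\<Sum>t\<in>?F. average n t * transition t v) \<le> average n v + 1 / real n" for n
  proof -
    have "(\<Sum>t\<in>?F. average n t * transition t v) = (\<Sum>k<n. \<Sum>t\<in>?F. ?c k t * transition t v) / real n"
      unfolding average_def by (subst sum.swap) (simp add: sum_divide_distrib sum_distrib_right)
    also have "\<dots> \<le> (\<Sum>k<n. ?c (Suc k) v) / real n"
      by (intro divide_right_mono sum_mono step) simp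
    also have "(\<Sum>k<n. ?c (Suc k) v) \<le> (\<Sum>k<n. ?c k v) + 1"
    proof -
      have "(\<Sum>k<n. ?c (Suc k) v) + ?c 0 v = (\<Sum>k<n. ?c k v) + ?c n v"
        using sum.lessThan_Suc_shift[of "\<lambda>k. ?c k v" n] by simp
      moreover have "?c n v \<le> 1"
        using visits_le_1[of "{v}" n] v enn2real_mono[of "visits n v" 1] by simp
      ultimately show ?thesis using enn2real_nonneg[of "visits 0 v"] by linarith
    qed
    then have "(\<Sum>k<n. ?c (Suc k) v) / real n \<le> average n v + 1 / real n"
      unfolding average_def add_divide_distrib[symmetric] by (rule divide_right_mono) simp
    finally show ?thesis .
  qed
  ultimately have "(\<Sum>t\<in>?F. lift_mass t * transition t v) \<le> lift_mass v + 0" by (blast intro: LIMSEQ_le)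
  moreover have "(\<Sum>t<m. lift_mass t * transition t v) = (\<Sum>t\<in>?F. lift_mass t * transition t v)"
    by (intro sum.mono_neutral_right) (auto simp: lift_mass_def)
  ultimately show ?thesis by simp
qed

lemma lift_mass_summable: "summable lift_mass"
  by (rule bounded_imp_summable[of _ 1]) (use lift_mass_nonneg lift_mass_sum_le_1 in auto)

lemma lift_mass_stationary: "(\<lambda>t. lift_mass t * transition t v) sums lift_mass v"
proof (rule substochastic_stationary[OF _ lift_mass_superinvariant _ lift_mass_summable])
  show "(\<lambda>v. lift_mass t * transition t v) sums lift_mass t" for t
  proof (cases "t \<in> \<alpha>")
    case True then show ?thesis using sums_mult[OF transition_sums, of t "lift_mass t"] by simp
  qed (simp add: lift_mass_def)
qed (simp add: lift_mass_nonneg transition_nonneg)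

lemma emeasure_H_level: "v \<in> \<alpha> \<Longrightarrow> emeasure H (level D v) = ennreal (lift_mass v)"
proof -
  assume v: "v \<in> \<alpha>"
  have "compact (level D v)" unfolding level_def by (intro compact_Times level_set(1) v) simp
  moreover have "level D v \<subseteq> tower \<alpha> D" using v by (auto simp: tower_def)
  ultimately have "emeasure H (level D v) < \<infinity>" using lifts unfolding lifts_to_def by blast
  then show ?thesis using v by (simp add: lift_mass_def emeasure_eq_ennreal_measure)
qed

lemma I_subset: "I \<subseteq> \<alpha>" by (auto simp: kept_def)

lemma I_iff: "v \<in> I \<longleftrightarrow> v \<in> \<alpha> \<and> lift_mass v > 0"
  using emeasure_H_level by (auto simp: kept_def ennreal_less_zero_iff)

lemma I_nonempty: "I \<noteq> {}"
proof
  assume "I = {}"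
  then have null: "level D u \<in> null_sets H" if "u \<in> \<alpha>" for u
    using that emeasure_H_level[OF that] lift_mass_nonneg[of u] I_iff[of u] level_sets_bar[OF that] lifts
    unfolding lifts_to_def by (auto intro!: null_setsI)
  have "tower \<alpha> D \<in> null_sets H" unfolding tower_def
    by (rule null_sets_UN') (use null in auto)
  then show False using lifts unfolding lifts_to_def by auto
qed

lemma \<rho>_eq: "u \<in> \<alpha> \<Longrightarrow> \<rho> u = lift_mass u / mass u"
  by (simp add: rho_def lift_mass_def measure_bar_level)

lemma \<rho>_pos: "u \<in> I \<Longrightarrow> \<rho> u > 0"
  using I_iff mass_pos \<rho>_eq by auto

lemma lift_vector_eq: "u \<in> I \<Longrightarrow> lift_vector D H u = \<rho> u * mass u"
  using mass_pos[of u] \<rho>_eq[of u] I_subset by (auto simp: lift_vector_def lift_mass_def)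

text \<open>The height of the strip of rug \<open>v\<close> that is covered by the image of rug \<open>t\<close>.\<close>
definition width :: "nat \<Rightarrow> nat \<Rightarrow> real" where
  "width t v = (if t \<in> I \<and> arrows t v then \<rho> t / slope t else 0)"

lemma width_nonneg: "width t v \<ge> 0"
  unfolding width_def using \<rho>_pos[of t] slope[of t] I_subset by auto

lemma width_sums:
  assumes v: "v \<in> \<alpha>" shows "(\<lambda>t. width t v) sums \<rho> v"
proof -
  have "lift_mass t * transition t v / mass v = width t v" for t
    using v lift_mass_nonneg[of t] I_iff[of t] mass_pos[of v] mass_pos[of t] slope[of t]
    by (auto simp: transition_def width_def \<rho>_eq)
  then show ?thesis using sums_divide[OF lift_mass_stationary, of v "mass v"] by (simp add: \<rho>_eq v)
qed

lemma I_closed: "t \<in> I \<Longrightarrow> v \<in> \<alpha> \<Longrightarrow> arrows t v \<Longrightarrow> v \<in> I"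
proof -
  assume t: "t \<in> I" and v: "v \<in> \<alpha>" "arrows t v"
  have "0 < width t v" using t v \<rho>_pos[OF t] slope[of t] I_subset by (auto simp: width_def)
  also have "\<dots> \<le> \<rho> v"
    using sum_le_suminf[OF sums_summable[OF width_sums[OF v(1)]], of "{t}"] width_nonneg
      sums_unique[OF width_sums[OF v(1)]] by auto
  finally show "v \<in> I" using v mass_pos[OF v(1)] by (auto simp: I_iff \<rho>_eq zero_less_divide_iff)
qed

lemma width_sum_less: "v \<in> \<alpha> \<Longrightarrow> (\<Sum>t<u. width t v) \<le> \<rho> v"
  using sum_le_suminf[OF sums_summable[OF width_sums], of v "{..<u}"] width_nonneg
    sums_unique[OF width_sums, of v] by auto

end

section \<open>The rug map preserves the measure\<close>

abbreviation tag :: "('a \<times> nat) \<times> real \<Rightarrow> nat" where "tag z \<equiv> snd (fst z)"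
abbreviation point :: "('a \<times> nat) \<times> real \<Rightarrow> 'a" where "point z \<equiv> fst (fst z)"

lemma tag_measurable: "(tag :: ('a::euclidean_space \<times> nat) \<times> real \<Rightarrow> nat) \<in> borel \<rightarrow>\<^sub>M count_space UNIV"
proof -
  have "(tag :: ('a \<times> nat) \<times> real \<Rightarrow> nat) \<in> borel_measurable borel"
    by (intro borel_measurable_continuous_onI continuous_intros)
  then show ?thesis by (simp add: measurable_def sets_borel_eq_count_space)
qed

lemma point_measurable: "(point :: ('a::euclidean_space \<times> nat) \<times> real \<Rightarrow> 'a) \<in> borel_measurable borel"
  by (intro borel_measurable_continuous_onI continuous_intros)

lemma snd_borel_measurable: "(snd :: ('a::euclidean_space \<times> nat) \<times> real \<Rightarrow> real) \<in> borel_measurable borel"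
  by (intro borel_measurable_continuous_onI continuous_intros)

lemma box_borel:
  fixes B :: "'a::euclidean_space set" and J :: "real set"
  shows "B \<in> sets borel \<Longrightarrow> J \<in> sets borel \<Longrightarrow> (B \<times> {u::nat}) \<times> J \<in> sets borel"
  by (intro borel_Times) auto

context lifted_tower
begin

abbreviation Y where "Y \<equiv> rug_space M \<alpha> D H"
abbreviation \<nu> where "\<nu> \<equiv> rug_measure M \<alpha> D H"
abbreviation F where "F \<equiv> rug_map M N Z T s \<alpha> D H"

lemma rug_subset_Y: "u \<in> I \<Longrightarrow> (D u \<times> {u}) \<times> {0..\<rho> u} \<subseteq> Y"
  by (auto simp: rug_space_def rug_def level_def)

lemma Y_eq: "Y = (\<Union>u\<in>I. (D u \<times> {u}) \<times> {0..\<rho> u})"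
  by (auto simp: rug_space_def rug_def level_def)

lemma Y_borel: "Y \<in> sets borel"
  unfolding Y_eq using level_set(3) I_subset by (intro sets.countable_UN'' box_borel) auto

lemma Y_subset: "Y \<subseteq> tower \<alpha> D \<times> UNIV"
  using I_subset by (auto simp: Y_eq tower_def level_def)

lemma space_\<nu>: "space \<nu> = Y"
  unfolding rug_measure_def
  by (rule space_measure_of) (metis sets.space_closed space_restrict_space2 Y_borel)

lemma sets_\<nu>: "E \<in> sets \<nu> \<longleftrightarrow> E \<in> sets borel \<and> E \<subseteq> Y"
proof -
  have "sigma_algebra Y (sets (restrict_space borel Y))"
    by (metis sets.sigma_algebra_axioms space_restrict_space2 Y_borel)
  then have "sets \<nu> = sets (restrict_space borel Y)"
    unfolding rug_measure_def by (rule sigma_algebra.sets_measure_of_eq)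
  then show ?thesis using Y_borel by (auto simp: sets_restrict_space_iff)
qed

lemma bar_sigma_finite: "sigma_finite_measure bar"
proof
  show "\<exists>A. countable A \<and> A \<subseteq> sets bar \<and> \<Union>A = space bar \<and> (\<forall>a\<in>A. emeasure bar a \<noteq> \<infinity>)"
  proof (intro exI[of _ "level D ` \<alpha>"] conjI ballI)
    show "\<Union> (level D ` \<alpha>) = space bar" by (simp add: space_bar tower_def)
    fix a assume "a \<in> level D ` \<alpha>"
    then obtain u where "u \<in> \<alpha>" "a = D u \<times> {u}" by (auto simp: level_def)
    then show "emeasure bar a \<noteq> \<infinity>" using emeasure_bar_level(2)[of u "D u"] level_set(2) by simp
  qed (auto simp: level_sets_bar)
qed

interpretation bar_lborel: pair_sigma_finite bar "lborel :: real measure"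
  unfolding pair_sigma_finite_def using bar_sigma_finite sigma_finite_lborel by auto

lemma borel_product_sets:
  assumes E: "E \<in> sets borel" "E \<subseteq> tower \<alpha> D \<times> (UNIV :: real set)"
  shows "E \<in> sets (bar \<Otimes>\<^sub>M lborel)"
proof -
  have "(\<lambda>p. p) \<in> bar \<rightarrow>\<^sub>M borel"
  proof (rule measurableI)
    fix A :: "('a \<times> nat) set" assume A: "A \<in> sets borel"
    have "fibre (A \<inter> tower \<alpha> D) u \<in> sets M" if u: "u \<in> \<alpha>" for u
    proof -
      have "(\<lambda>x. (x, u)) \<in> borel_measurable borel"
        by (intro borel_measurable_continuous_onI continuous_intros)
      then have "(\<lambda>x. (x, u)) -` A \<inter> D u \<in> sets borel"
        using measurable_sets_borel[OF _ A] level_set(3)[OF u] by blast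
      moreover have "fibre (A \<inter> tower \<alpha> D) u = (\<lambda>x. (x, u)) -` A \<inter> D u"
        using u by (auto simp: fibre_def tower_def level_def)
      ultimately show ?thesis using level_set(4)[OF u] by (intro borel_in_sets_M) auto
    qed
    then show "(\<lambda>p. p) -` A \<inter> space bar \<in> sets bar"
      unfolding space_bar by (simp add: sets_bar)
  qed simp
  then have "(\<lambda>p. (fst p, snd p)) \<in> bar \<Otimes>\<^sub>M lborel \<rightarrow>\<^sub>M borel \<Otimes>\<^sub>M borel"
    by (intro measurable_Pair) (auto intro: measurable_compose[OF measurable_fst])
  then have "(\<lambda>p. p) \<in> bar \<Otimes>\<^sub>M lborel \<rightarrow>\<^sub>M borel" by (simp add: borel_prod)
  from measurable_sets[OF this E(1)] show ?thesis
    using E(2) by (simp add: space_pair_measure space_bar Int_absorb2)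
qed

lemma emeasure_\<nu>:
  assumes E: "E \<in> sets \<nu>" shows "emeasure \<nu> E = emeasure (bar \<Otimes>\<^sub>M lborel) E"
proof -
  have sub: "A \<in> sets (bar \<Otimes>\<^sub>M lborel)" if "A \<in> sets \<nu>" for A
    using that borel_product_sets Y_subset unfolding sets_\<nu> by blast
  have eq: "sets \<nu> = sets (restrict_space borel Y)"
    unfolding rug_measure_def
    by (rule sigma_algebra.sets_measure_of_eq) (metis sets.sigma_algebra_axioms space_restrict_space2 Y_borel)
  show ?thesis
  proof (subst rug_measure_def, rule emeasure_measure_of_sigma)
    show "sigma_algebra Y (sets (restrict_space borel Y))"
      by (metis sets.sigma_algebra_axioms space_restrict_space2 Y_borel)
    show "countably_additive (sets (restrict_space borel Y)) (emeasure (bar \<Otimes>\<^sub>M lborel))"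
      unfolding eq[symmetric] using sub by (intro countably_additiveI suminf_emeasure) auto
  qed (use E eq in \<open>auto simp: positive_def\<close>)
qed

lemma emeasure_box:
  assumes u: "u \<in> I" and B: "B \<in> sets borel" "B \<subseteq> D u" and J: "J \<in> sets borel" "J \<subseteq> {0..\<rho> u}"
  shows "(B \<times> {u}) \<times> J \<in> sets \<nu>" "emeasure \<nu> ((B \<times> {u}) \<times> J) = emeasure M B * emeasure lborel J"
proof -
  have ua: "u \<in> \<alpha>" using u I_subset by auto
  have BM: "B \<in> sets M" using B level_set(4)[OF ua] by (intro borel_in_sets_M) auto
  show m: "(B \<times> {u}) \<times> J \<in> sets \<nu>"
    unfolding sets_\<nu> using box_borel[OF B(1) J(1)] rug_subset_Y[OF u] B(2) J(2) by auto
  show "emeasure \<nu> ((B \<times> {u}) \<times> J) = emeasure M B * emeasure lborel J"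
    unfolding emeasure_\<nu>[OF m]
    using emeasure_bar_level[OF ua BM B(2)] J(1) by (simp add: lborel.emeasure_pair_measure_Times)
qed

text \<open>
  A subset of a single rug is measured by its horizontal slices, because \<open>c4\<close> can be applied to these.
\<close>
lemma emeasure_horizontal:
  assumes v: "v \<in> I" and E: "E \<in> sets \<nu>" "E \<subseteq> (D v \<times> {v}) \<times> UNIV"
  shows "emeasure \<nu> E = (\<integral>\<^sup>+y. emeasure M {x. ((x, v), y) \<in> E} \<partial>lborel)"
    "(\<lambda>y. emeasure M {x. ((x, v), y) \<in> E}) \<in> borel_measurable borel"
    "{x. ((x, v), y) \<in> E} \<in> sets borel" "{x. ((x, v), y) \<in> E} \<subseteq> D v"
proof -
  have va: "v \<in> \<alpha>" using v I_subset by auto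
  have Eb: "E \<in> sets borel" "E \<subseteq> Y" using E(1) by (auto simp: sets_\<nu>)
  have EP: "E \<in> sets (bar \<Otimes>\<^sub>M lborel)" using borel_product_sets Eb Y_subset by blast
  show sub: "{x. ((x, v), y) \<in> E} \<subseteq> D v" for y using E(2) by auto
  show b: "{x. ((x, v), y) \<in> E} \<in> sets borel" for y
  proof -
    have "(\<lambda>x. ((x, v), y)) \<in> borel_measurable borel"
      by (intro borel_measurable_continuous_onI continuous_intros)
    from measurable_sets_borel[OF this Eb(1)] show ?thesis by (simp add: vimage_def)
  qed
  have m: "{x. ((x, v), y) \<in> E} \<in> sets M" for y
    using b sub level_set(4)[OF va] by (intro borel_in_sets_M) auto
  have "(\<lambda>p. (p, y)) -` E = {x. ((x, v), y) \<in> E} \<times> {v}" for y using E(2) by auto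
  then have eq: "emeasure bar ((\<lambda>p. (p, y)) -` E) = emeasure M {x. ((x, v), y) \<in> E}" for y
    using emeasure_bar_level(2)[OF va m sub] by simp
  show "emeasure \<nu> E = (\<integral>\<^sup>+y. emeasure M {x. ((x, v), y) \<in> E} \<partial>lborel)"
    unfolding emeasure_\<nu>[OF E(1)] bar_lborel.emeasure_pair_measure_alt2[OF EP] eq ..
  show "(\<lambda>y. emeasure M {x. ((x, v), y) \<in> E}) \<in> borel_measurable borel"
    using bar_lborel.measurable_emeasure_Pair2[OF EP] unfolding eq by simp
qed

lemma emeasure_rug:
  assumes u: "u \<in> I" shows "emeasure \<nu> ((D u \<times> {u}) \<times> {0..\<rho> u}) = ennreal (lift_mass u)"
proof -
  have ua: "u \<in> \<alpha>" using u I_subset by auto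
  have "emeasure \<nu> ((D u \<times> {u}) \<times> {0..\<rho> u}) = ennreal (mass u) * ennreal (\<rho> u)"
    using emeasure_box(2)[OF u level_set(3)[OF ua], of "{0..\<rho> u}"] \<rho>_pos[OF u] by (simp add: emeasure_eq_measure)
  also have "\<dots> = ennreal (lift_mass u)"
    using mass_pos[OF ua] lift_mass_nonneg[of u] by (simp add: \<rho>_eq[OF ua] ennreal_mult[symmetric])
  finally show ?thesis .
qed

lemma \<nu>_finite: "emeasure \<nu> Y < \<infinity>"
proof -
  have "emeasure \<nu> Y = emeasure \<nu> (\<Union>u\<in>I. (D u \<times> {u}) \<times> {0..\<rho> u})" by (simp only: Y_eq)
  also have "\<dots> = (\<integral>\<^sup>+u. emeasure \<nu> ((D u \<times> {u}) \<times> {0..\<rho> u}) \<partial>count_space I)"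
    using emeasure_box(1) level_set(3) I_subset
    by (intro emeasure_UN_countable) (auto simp: disjoint_family_on_def)
  also have "\<dots> = (\<integral>\<^sup>+u. ennreal (lift_mass u) \<partial>count_space I)"
    by (intro nn_integral_cong) (simp add: emeasure_rug)
  also have "\<dots> \<le> (\<integral>\<^sup>+u. ennreal (lift_mass u) \<partial>count_space UNIV)"
    by (subst nn_integral_count_space_indicator) (auto intro!: nn_integral_mono simp: indicator_def)
  also have "\<dots> = ennreal (\<Sum>u. lift_mass u)"
    by (simp add: nn_integral_count_space_nat suminf_ennreal2 lift_mass_nonneg lift_mass_summable)
  finally show ?thesis by (auto simp: top_unique less_top[symmetric])
qed

text \<open>The bottom of the strip of rug \<open>v\<close> that is covered by the image of rug \<open>t\<close>.\<close>
definition offset :: "nat \<Rightarrow> nat \<Rightarrow> real" where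
  "offset t v = (\<Sum>t'<t. width t' v)"

lemma offset_Suc: "offset (Suc t) v = offset t v + width t v"
  by (simp add: offset_def)

lemma offset_mono: "t \<le> t' \<Longrightarrow> offset t v \<le> offset t' v"
  unfolding offset_def by (rule sum_mono2) (auto simp: width_nonneg)

lemma offset_nonneg: "0 \<le> offset t v"
  unfolding offset_def by (simp add: sum_nonneg width_nonneg)

lemma offset_le: "v \<in> \<alpha> \<Longrightarrow> offset t v \<le> \<rho> v"
  unfolding offset_def by (rule width_sum_less)

lemma rug_map_eq:
  assumes t: "t \<in> I" and x: "x \<in> D t" "x \<in> G"
  shows "F ((x, t), y) = ((T x, nxt x t), y / slope t + offset t (nxt x t))"
proof -
  have ta: "t \<in> \<alpha>" using t I_subset by auto
  have j: "(LEAST j. j \<in> {1..N} \<and> x \<in> Z j) = branch t"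
  proof (rule Least_equality)
    show "branch t \<in> {1..N} \<and> x \<in> Z (branch t)" using branch[OF ta] x by blast
    fix j assume "j \<in> {1..N} \<and> x \<in> Z j"
    then show "branch t \<le> j" using G_branch[OF x(2) ta x(1)] by auto
  qed
  \<comment> \<open>Each \<open>D t'\<close> lies in exactly one \<open>Z k\<close>, so the double sum in the definition is a sum over \<open>t'\<close>.\<close>
  have sub: "D t' \<subseteq> Z k \<longleftrightarrow> k = branch t'" if "t' \<in> I" "k \<in> {1..N}" for t' k
  proof
    assume "D t' \<subseteq> Z k"
    then have "D t' - Z k \<in> null_sets M" by (metis Diff_eq_empty_iff null_sets.empty_sets)
    then show "k = branch t'" using branch_unique that I_subset by blast
  next
    assume "k = branch t'" then show "D t' \<subseteq> Z k" using branch that I_subset by blast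
  qed
  have "(\<Sum>k\<in>{1..N}. \<Sum>t' | t' \<in> I \<and> t' < t \<and> D t' \<subseteq> Z k \<and> arrows t' v. \<rho> t' / s k) = offset t v" for v
  proof -
    have "(\<Sum>k\<in>{1..N}. \<Sum>t' | t' \<in> I \<and> t' < t \<and> D t' \<subseteq> Z k \<and> arrows t' v. \<rho> t' / s k) =
        (\<Sum>k\<in>{1..N}. \<Sum>t'<t. if k = branch t' then width t' v else 0)"
    proof (rule sum.cong[OF refl])
      fix k assume k: "k \<in> {1..N}"
      show "(\<Sum>t' | t' \<in> I \<and> t' < t \<and> D t' \<subseteq> Z k \<and> arrows t' v. \<rho> t' / s k) =
          (\<Sum>t'<t. if k = branch t' then width t' v else 0)"
      proof (rule sum.mono_neutral_cong_left)
        show "{t' \<in> I. t' < t \<and> D t' \<subseteq> Z k \<and> arrows t' v} \<subseteq> {..<t}"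
          unfolding lessThan_def by blast
        show "\<forall>i\<in>{..<t} - {t' \<in> I. t' < t \<and> D t' \<subseteq> Z k \<and> arrows t' v}. (if k = branch i then width i v else 0) = 0"
          using sub[OF _ k] by (auto simp: width_def)
        show "\<rho> t' / s k = (if k = branch t' then width t' v else 0)"
          if "t' \<in> {t' \<in> I. t' < t \<and> D t' \<subseteq> Z k \<and> arrows t' v}" for t'
          using that sub[OF _ k, of t'] by (auto simp: width_def slope_def)
      qed simp
    qed
    also have "\<dots> = (\<Sum>t'<t. \<Sum>k\<in>{1..N}. if k = branch t' then width t' v else 0)"
      by (rule sum.swap)
    also have "\<dots> = (\<Sum>t'<t. width t' v)"
    proof (rule sum.cong[OF refl])
      fix t'
      show "(\<Sum>k\<in>{1..N}. if k = branch t' then width t' v else 0) = width t' v"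
        using branch(1)[of t'] I_subset by (cases "t' \<in> I") (auto simp: width_def)
    qed
    finally show ?thesis by (simp add: offset_def)
  qed
  then show ?thesis
    unfolding rug_map_def Let_def prod.case tower_map_eq snd_conv j by (simp add: slope_def)
qed

text \<open>
  Heights form half-open intervals, so that the strips in a rug do not even share end points and \<open>F\<close>
  is injective on this set.
\<close>
definition good_rugs :: "(('a \<times> nat) \<times> real) set" where
  "good_rugs = (\<Union>t\<in>I. ((D t \<inter> G) \<times> {t}) \<times> {0..<\<rho> t})"

lemma good_rugs_iff: "((x, t), y) \<in> good_rugs \<longleftrightarrow> t \<in> I \<and> x \<in> D t \<and> x \<in> G \<and> 0 \<le> y \<and> y < \<rho> t"
  by (auto simp: good_rugs_def)

lemma good_rugs_sets: "good_rugs \<in> sets \<nu>"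
  unfolding good_rugs_def using level_set(3) I_subset G_borel
  by (intro sets.countable_UN'' emeasure_box(1)) auto

lemma good_rugs_full: "emeasure \<nu> (space \<nu> - good_rugs) = 0"
proof -
  have 1: "((D t - G) \<times> {t}) \<times> {0..\<rho> t} \<in> null_sets \<nu>" if t: "t \<in> I" for t
  proof -
    have ta: "t \<in> \<alpha>" using t I_subset by auto
    have b: "D t - G \<in> sets borel" using level_set(3)[OF ta] G_borel by auto
    have "D t - G \<in> sets M" using b level_set(4)[OF ta] by (intro borel_in_sets_M) auto
    moreover have "D t - G \<subseteq> X - G" using level_set(4)[OF ta] by auto
    ultimately have "D t - G \<in> null_sets M" using G_full by (meson null_sets_subset)
    then show ?thesis
      using emeasure_box[OF t b, of "{0..\<rho> t}"] by (intro null_setsI) auto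
  qed
  have 2: "(D t \<times> {t}) \<times> {\<rho> t} \<in> null_sets \<nu>" if t: "t \<in> I" for t
    using emeasure_box[where u=t and B="D t" and J="{\<rho> t}"] level_set(3) I_subset \<rho>_pos[OF t] t by (intro null_setsI) auto
  have null: "(\<Union>t\<in>I. ((D t - G) \<times> {t}) \<times> {0..\<rho> t}) \<union> (\<Union>t\<in>I. (D t \<times> {t}) \<times> {\<rho> t}) \<in> null_sets \<nu>"
    by (intro null_sets.Un null_sets_UN' 1 2) auto
  have "space \<nu> - good_rugs \<subseteq> (\<Union>t\<in>I. ((D t - G) \<times> {t}) \<times> {0..\<rho> t}) \<union> (\<Union>t\<in>I. (D t \<times> {t}) \<times> {\<rho> t})"
    unfolding space_\<nu> Y_eq by (auto simp: good_rugs_iff)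
  then have "space \<nu> - good_rugs \<in> null_sets \<nu>"
    using null_sets_subset[OF null, of "space \<nu> - good_rugs"] good_rugs_sets by auto
  then show ?thesis by auto
qed

lemma F_point:
  assumes z: "((x, t), y) \<in> good_rugs"
  shows "nxt x t \<in> I" "arrows t (nxt x t)" "T x \<in> D (nxt x t)" "T x \<in> G"
    "offset t (nxt x t) \<le> y / slope t + offset t (nxt x t)"
    "y / slope t + offset t (nxt x t) < offset (Suc t) (nxt x t)"
proof -
  have zz: "t \<in> I" "x \<in> D t" "x \<in> G" "0 \<le> y" "y < \<rho> t" using z by (auto simp: good_rugs_iff)
  then have t: "t \<in> \<alpha>" using I_subset by auto
  show a: "arrows t (nxt x t)" "T x \<in> D (nxt x t)" "T x \<in> G"
    using nxt[OF zz(3) t zz(2)] G_invariant[OF zz(3)] by auto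
  show "nxt x t \<in> I" using I_closed[OF zz(1) nxt(1)[OF zz(3) t zz(2)] a(1)] .
  show "offset t (nxt x t) \<le> y / slope t + offset t (nxt x t)"
    using zz(4) slope[OF t] by simp
  have "y / slope t < \<rho> t / slope t" using zz(5) slope[OF t] by (simp add: divide_strict_right_mono)
  then show "y / slope t + offset t (nxt x t) < offset (Suc t) (nxt x t)"
    using a(1) zz(1) by (simp add: offset_Suc width_def)
qed

lemma F_into: "F \<in> good_rugs \<rightarrow> good_rugs"
proof
  fix z assume zA: "z \<in> good_rugs"
  obtain x t y where z: "z = ((x, t), y)" by (metis surj_pair)
  have zz: "t \<in> I" "x \<in> D t" "x \<in> G" using zA by (auto simp: good_rugs_iff z)
  note p = F_point[OF zA[unfolded z]]
  have "y / slope t + offset t (nxt x t) < \<rho> (nxt x t)"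
    using p(6) offset_le[of "nxt x t" "Suc t"] p(1) I_subset by force
  moreover have "0 \<le> y / slope t + offset t (nxt x t)"
    using p(5) offset_nonneg[of t "nxt x t"] by simp
  ultimately show "F z \<in> good_rugs" unfolding z rug_map_eq[OF zz] good_rugs_iff using p by simp
qed

text \<open>The strip determines the rug that the point comes from, and there \<open>F\<close> is an injective product map.\<close>
lemma F_inj: "inj_on F good_rugs"
proof (rule inj_onI)
  fix z z' assume zA: "z \<in> good_rugs" "z' \<in> good_rugs" and eq: "F z = F z'"
  obtain x t y where z: "z = ((x, t), y)" by (metis surj_pair)
  obtain x' t' y' where z': "z' = ((x', t'), y')" by (metis surj_pair)
  have zz: "t \<in> I" "x \<in> D t" "x \<in> G" using zA by (auto simp: good_rugs_iff z)
  have zz': "t' \<in> I" "x' \<in> D t'" "x' \<in> G" using zA by (auto simp: good_rugs_iff z')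
  note p = F_point[OF zA(1)[unfolded z]] and p' = F_point[OF zA(2)[unfolded z']]
  define v where "v = nxt x t"
  have e: "T x = T x'" "nxt x' t' = v" "y / slope t + offset t v = y' / slope t' + offset t' v"
    using eq unfolding z z' rug_map_eq[OF zz] rug_map_eq[OF zz'] v_def by auto
  have "\<not> t < t'"
    using p(6) p'(5) offset_mono[of "Suc t" t' v] e unfolding v_def[symmetric] e(2) by linarith
  moreover have "\<not> t' < t"
    using p'(6) p(5) offset_mono[of "Suc t'" t v] e unfolding v_def[symmetric] e(2) by linarith
  ultimately have t: "t' = t" by simp
  have ta: "t \<in> \<alpha>" using zz I_subset by auto
  have "x \<in> intZ (branch t)" "x' \<in> intZ (branch t)"
    using regular_D(1) G_regular zz zz' branch[OF ta] t by blast+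
  then have "x = x'" using inj_on_intZ[OF branch(1)[OF ta]] e(1) by (auto dest: inj_onD)
  moreover have "y = y'" using e(3) slope[OF ta] t by simp
  ultimately show "z = z'" by (simp add: z z' t)
qed

definition piece :: "nat \<Rightarrow> nat \<Rightarrow> (('a \<times> nat) \<times> real) set" where
  "piece t v = {z \<in> good_rugs. tag z = t \<and> nxt (point z) t = v}"

lemma piece_D:
  assumes "((x, u), y) \<in> piece t v"
  shows "u = t" "t \<in> I" "x \<in> D t" "x \<in> G" "0 \<le> y" "y < \<rho> t" "nxt x t = v" "v \<in> I" "arrows t v" "T x \<in> D v"
    "x \<in> intZ (branch t)" "F ((x, u), y) = ((T x, v), y / slope t + offset t v)"
proof -
  show *: "u = t" "t \<in> I" "x \<in> D t" "x \<in> G" "0 \<le> y" "y < \<rho> t" "nxt x t = v"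
    using assms by (auto simp: piece_def good_rugs_iff)
  have "((x, t), y) \<in> good_rugs" using * by (simp add: good_rugs_iff)
  from F_point[OF this] show "v \<in> I" "arrows t v" "T x \<in> D v" using * by auto
  have "t \<in> \<alpha>" using * I_subset by auto
  then show "x \<in> intZ (branch t)" using regular_D(1) G_regular * branch by blast
  show "F ((x, u), y) = ((T x, v), y / slope t + offset t v)"
    using rug_map_eq[OF *(2-4)] * by simp
qed

lemma good_rugs_pieces: "good_rugs = (\<Union>(t, v)\<in>I \<times> I. piece t v)"
proof (intro subset_antisym subsetI)
  fix z assume zA: "z \<in> good_rugs"
  obtain x t y where z: "z = ((x, t), y)" by (metis surj_pair)
  have "t \<in> I" "nxt x t \<in> I" using F_point[OF zA[unfolded z]] zA by (auto simp: z good_rugs_iff)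
  moreover have "z \<in> piece t (nxt x t)" using zA by (simp add: piece_def z)
  ultimately show "z \<in> (\<Union>(t, v)\<in>I \<times> I. piece t v)" by blast
qed (auto simp: piece_def)

lemma piece_borel: assumes t: "t \<in> I" and v: "v \<in> I" shows "piece t v \<in> sets borel"
proof (cases "arrows t v")
  case False
  then have "piece t v = {}" using piece_D(9) by (metis equals0I prod.exhaust)
  then show ?thesis by simp
next
  case True
  have ta: "t \<in> \<alpha>" "v \<in> \<alpha>" using t v I_subset by auto
  have "piece t v = ((D t \<inter> G \<inter> {x \<in> regular. T x \<in> D v}) \<times> {t}) \<times> {0..<\<rho> t}"
  proof (intro subset_antisym subsetI)
    fix z assume z: "z \<in> piece t v"
    obtain x u y where zz: "z = ((x, u), y)" by (metis surj_pair)
    show "z \<in> ((D t \<inter> G \<inter> {x \<in> regular. T x \<in> D v}) \<times> {t}) \<times> {0..<\<rho> t}"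
      using piece_D[OF z[unfolded zz]] G_regular by (auto simp: zz)
  next
    fix z assume z: "z \<in> ((D t \<inter> G \<inter> {x \<in> regular. T x \<in> D v}) \<times> {t}) \<times> {0..<\<rho> t}"
    then obtain x y where zz: "z = ((x, t), y)" "x \<in> D t" "x \<in> G" "T x \<in> D v" "0 \<le> y" "y < \<rho> t" by auto
    then show "z \<in> piece t v" using nxt_eqI[OF _ ta(1) _ ta(2) True, of x] t by (simp add: piece_def good_rugs_iff)
  qed
  then show ?thesis
    using level_set(3)[OF ta(1)] G_borel preimage_regular_borel[OF level_set(3)[OF ta(2)]]
    by (simp add: box_borel)
qed

lemma F_preimage_sets:
  assumes E: "E \<in> sets \<nu>" shows "F -` E \<inter> good_rugs \<in> sets \<nu>"
proof -
  have Eb: "E \<in> sets borel" using E by (simp add: sets_\<nu>)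
  have "F -` E \<inter> piece t v \<in> sets borel" if t: "t \<in> I" and v: "v \<in> I" for t v
  proof -
    have ta: "t \<in> \<alpha>" using t I_subset by auto
    obtain g where g: "g \<in> borel_measurable borel" "\<And>x. x \<in> intZ (branch t) \<Longrightarrow> g x = T x"
      using branch_extension[OF branch(1)[OF ta]] by metis
    define \<Phi> where "\<Phi> z = ((g (point z), v), snd z / slope t + offset t v)" for z :: "('a \<times> nat) \<times> real"
    have "\<Phi> \<in> borel_measurable borel"
      unfolding \<Phi>_def
      by (intro borel_measurable_Pair measurable_compose[OF point_measurable g(1)] borel_measurable_const
          borel_measurable_add borel_measurable_divide snd_borel_measurable)
    then have "\<Phi> -` E \<in> sets borel" using Eb by (rule measurable_sets_borel)
    moreover have "F -` E \<inter> piece t v = \<Phi> -` E \<inter> piece t v"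
    proof -
      have "F z = \<Phi> z" if "z \<in> piece t v" for z
      proof -
        obtain x u y where z: "z = ((x, u), y)" by (metis surj_pair)
        show ?thesis using piece_D[OF that[unfolded z]] g(2) by (simp add: z \<Phi>_def)
      qed
      then show ?thesis by auto
    qed
    ultimately show ?thesis using piece_borel[OF t v] by auto
  qed
  then have "(\<Union>(t, v)\<in>I \<times> I. F -` E \<inter> piece t v) \<in> sets borel"
    by (intro sets.countable_UN'') (auto intro: countable_SIGMA)
  moreover have "F -` E \<inter> good_rugs = (\<Union>(t, v)\<in>I \<times> I. F -` E \<inter> piece t v)" by (subst good_rugs_pieces) blast
  moreover have "F -` E \<inter> good_rugs \<subseteq> Y" using good_rugs_sets by (auto simp: sets_\<nu>)
  ultimately show ?thesis by (simp add: sets_\<nu>)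
qed

text \<open>
  The slice of \<open>F ` E\<close> at height \<open>y'\<close> is the image under \<open>T\<close> of the slice of \<open>E\<close> at height
  \<open>slope t * (y' - offset t v)\<close>. So \<open>c4\<close> contributes the factor \<open>slope t\<close>, and the affine
  substitution in the height cancels it.
\<close>
lemma F_image_piece:
  assumes t: "t \<in> I" and v: "v \<in> I" and E: "E \<in> sets \<nu>" "E \<subseteq> piece t v"
  shows "F ` E \<in> sets \<nu>" "emeasure \<nu> (F ` E) = emeasure \<nu> E"
proof -
  have ta: "t \<in> \<alpha>" "branch t \<in> {1..N}" using t I_subset branch by auto
  have sl: "slope t \<noteq> 0" using slope[OF ta(1)] by simp
  obtain k where k: "k \<in> borel_measurable borel" "\<And>x. x \<in> intZ (branch t) \<Longrightarrow> k (T x) = x"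
    "T ` intZ (branch t) \<in> sets borel"
    using branch_extension[OF ta(2)] by metis
  have Eb: "E \<in> sets borel" using E by (simp add: sets_\<nu>)
  define \<Phi> where "\<Phi> z = ((k (point z), t), slope t * (snd z - offset t v))" for z :: "('a \<times> nat) \<times> real"
  have "\<Phi> \<in> borel_measurable borel"
    unfolding \<Phi>_def
    by (intro borel_measurable_Pair measurable_compose[OF point_measurable k(1)] borel_measurable_const
        borel_measurable_diff borel_measurable_times snd_borel_measurable)
  then have \<Phi>E: "\<Phi> -` E \<in> sets borel" using Eb by (rule measurable_sets_borel)
  have img: "((x', u'), y') \<in> F ` E \<longleftrightarrow> u' = v \<and> x' \<in> T ` {x. ((x, t), slope t * (y' - offset t v)) \<in> E}" for x' u' y'
  proof
    assume "((x', u'), y') \<in> F ` E"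
    then obtain p where "p \<in> E" "((x', u'), y') = F p" by (rule imageE)
    moreover obtain x u y where "p = ((x, u), y)" by (metis surj_pair)
    ultimately have z: "((x, u), y) \<in> E" "((x', u'), y') = F ((x, u), y)" by simp_all
    have zp: "((x, u), y) \<in> piece t v" using z E by auto
    note p = piece_D[OF zp]
    have "x' = T x" "u' = v" "y' = y / slope t + offset t v" using z(2) unfolding p(12) by simp_all
    then show "u' = v \<and> x' \<in> T ` {x. ((x, t), slope t * (y' - offset t v)) \<in> E}"
      using z(1) p(1) sl by auto
  next
    assume "u' = v \<and> x' \<in> T ` {x. ((x, t), slope t * (y' - offset t v)) \<in> E}"
    then obtain x where x: "u' = v" "x' = T x" "((x, t), slope t * (y' - offset t v)) \<in> E" by auto
    then have "F ((x, t), slope t * (y' - offset t v)) = ((x', u'), y')"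
      using piece_D(12)[of x t "slope t * (y' - offset t v)" t v] E sl by auto
    then show "((x', u'), y') \<in> F ` E" using x(3) by (metis image_eqI)
  qed
  have "F ` E = \<Phi> -` E \<inter> (T ` intZ (branch t) \<times> {v}) \<times> UNIV"
  proof (rule set_eqI)
    fix z :: "('a \<times> nat) \<times> real"
    obtain x' u' y' where z: "z = ((x', u'), y')" by (metis surj_pair)
    have "x' \<in> T ` {x. ((x, t), y) \<in> E} \<longleftrightarrow> ((k x', t), y) \<in> E \<and> x' \<in> T ` intZ (branch t)" for y
    proof
      assume "x' \<in> T ` {x. ((x, t), y) \<in> E}"
      then obtain x where x: "x' = T x" "((x, t), y) \<in> E" by auto
      then have "x \<in> intZ (branch t)" using piece_D(11)[of x t y t v] E by auto
      then show "((k x', t), y) \<in> E \<and> x' \<in> T ` intZ (branch t)" using x k(2) by auto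
    next
      assume *: "((k x', t), y) \<in> E \<and> x' \<in> T ` intZ (branch t)"
      then obtain x where "x' = T x" "x \<in> intZ (branch t)" by auto
      then show "x' \<in> T ` {x. ((x, t), y) \<in> E}" using k(2) * by auto
    qed
    then show "z \<in> F ` E \<longleftrightarrow> z \<in> \<Phi> -` E \<inter> (T ` intZ (branch t) \<times> {v}) \<times> UNIV"
      unfolding z img by (auto simp: \<Phi>_def)
  qed
  moreover have "(T ` intZ (branch t) \<times> {v}) \<times> (UNIV :: real set) \<in> sets borel"
    using k(3) by (rule box_borel) simp
  ultimately have Fb: "F ` E \<in> sets borel" using \<Phi>E by auto
  have FA: "F ` E \<subseteq> good_rugs" using E(2) F_into by (auto simp: piece_def)
  show m: "F ` E \<in> sets \<nu>" using Fb FA good_rugs_sets by (auto simp: sets_\<nu>)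
  have sub: "F ` E \<subseteq> (D v \<times> {v}) \<times> UNIV"
  proof
    fix z assume zF: "z \<in> F ` E"
    obtain x' u' y' where z: "z = ((x', u'), y')" by (metis surj_pair)
    have "u' = v" using zF unfolding z img by simp
    moreover have "((x', u'), y') \<in> good_rugs" using zF FA unfolding z by (rule rev_subsetD)
    ultimately show "z \<in> (D v \<times> {v}) \<times> UNIV" by (simp add: z good_rugs_iff)
  qed
  have subE: "E \<subseteq> (D t \<times> {t}) \<times> UNIV"
    using E(2) by (auto simp: piece_def good_rugs_iff subset_iff)
  note hE = emeasure_horizontal[OF t E(1) subE]
  let ?E = "\<lambda>y. {x. ((x, t), y) \<in> E}"
  have "emeasure \<nu> (F ` E) = (\<integral>\<^sup>+y'. emeasure M {x'. ((x', v), y') \<in> F ` E} \<partial>lborel)"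
    by (rule emeasure_horizontal(1)[OF v m sub])
  also have "\<dots> = (\<integral>\<^sup>+y'. ennreal (slope t) * emeasure M (?E (- slope t * offset t v + slope t * y')) \<partial>lborel)"
  proof (rule nn_integral_cong)
    fix y'
    have "?E y \<in> sets M" for y
      using hE(3,4) level_set(4)[OF ta(1)] by (intro borel_in_sets_M) (auto intro: order_trans)
    moreover have "?E y \<subseteq> Z (branch t)" for y
      using hE(4) branch(2)[OF ta(1)] by blast
    ultimately show "emeasure M {x'. ((x', v), y') \<in> F ` E} =
        ennreal (slope t) * emeasure M (?E (- slope t * offset t v + slope t * y'))"
      unfolding img by (simp add: emeasure_image[OF ta(2)] slope_def algebra_simps)
  qed
  also have "\<dots> = ennreal (slope t) * (\<integral>\<^sup>+y'. emeasure M (?E (- slope t * offset t v + slope t * y')) \<partial>lborel)"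
    using hE(2) by (intro nn_integral_cmult) (auto intro!: measurable_compose[OF _ hE(2)])
  also have "\<dots> = (\<integral>\<^sup>+y. emeasure M (?E y) \<partial>lborel)"
    using nn_integral_real_affine[OF hE(2) sl, of "- slope t * offset t v"] slope[OF ta(1)] by simp
  also have "\<dots> = emeasure \<nu> E" by (rule hE(1)[symmetric])
  finally show "emeasure \<nu> (F ` E) = emeasure \<nu> E" .
qed

lemma F_image:
  assumes E: "E \<in> sets \<nu>" "E \<subseteq> good_rugs"
  shows "F ` E \<in> sets \<nu> \<and> emeasure \<nu> (F ` E) = emeasure \<nu> E"
proof -
  let ?P = "\<lambda>(t, v). E \<inter> piece t v"
  have P: "?P i \<in> sets \<nu>" if "i \<in> I \<times> I" for i
    using that piece_borel E by (auto simp: sets_\<nu>)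
  have FP: "F ` ?P i \<in> sets \<nu>" "emeasure \<nu> (F ` ?P i) = emeasure \<nu> (?P i)" if "i \<in> I \<times> I" for i
    using F_image_piece[of "fst i" "snd i" "?P i"] P[OF that] that by auto
  have cI: "countable (I \<times> I)" by (simp add: countable_SIGMA)
  have "E = E \<inter> (\<Union>(t, v)\<in>I \<times> I. piece t v)" using E(2) good_rugs_pieces by blast
  then have eq: "E = (\<Union>i\<in>I \<times> I. ?P i)" by auto
  have d: "disjoint_family_on ?P (I \<times> I)" by (auto simp: disjoint_family_on_def piece_def)
  have dF: "disjoint_family_on (\<lambda>i. F ` ?P i) (I \<times> I)"
    unfolding disjoint_family_on_def
  proof (intro ballI impI)
    fix i j assume ij: "i \<in> I \<times> I" "j \<in> I \<times> I" "i \<noteq> j"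
    have "?P i \<subseteq> good_rugs" "?P j \<subseteq> good_rugs" using E(2) by auto
    then have "F ` ?P i \<inter> F ` ?P j = F ` (?P i \<inter> ?P j)" by (rule inj_on_image_Int[OF F_inj, symmetric])
    also have "?P i \<inter> ?P j = {}" using d ij unfolding disjoint_family_on_def by blast
    finally show "F ` ?P i \<inter> F ` ?P j = {}" by simp
  qed
  have img: "F ` E = (\<Union>i\<in>I \<times> I. F ` ?P i)" by (subst eq) (rule image_UN)
  have m: "F ` E \<in> sets \<nu>" unfolding img using FP(1) cI by (intro sets.countable_UN'')
  have "emeasure \<nu> (F ` E) = (\<integral>\<^sup>+i. emeasure \<nu> (F ` ?P i) \<partial>count_space (I \<times> I))"
    unfolding img by (rule emeasure_UN_countable) (use FP cI dF in auto)
  also have "\<dots> = (\<integral>\<^sup>+i. emeasure \<nu> (?P i) \<partial>count_space (I \<times> I))"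
    by (rule nn_integral_cong) (use FP in auto)
  also have "\<dots> = emeasure \<nu> (\<Union>i\<in>I \<times> I. ?P i)"
    by (rule emeasure_UN_countable[symmetric]) (use P cI d in auto)
  finally show ?thesis using m eq by simp
qed

end

section \<open>Itineraries\<close>

context lifted_tower
begin

lemma orbit_good_rugs: "z \<in> good_rugs \<Longrightarrow> (F ^^ n) z \<in> good_rugs"
  using F_into by (induction n) auto

lemma F_eq:
  assumes "z \<in> good_rugs"
  shows "F z = ((T (point z), nxt (point z) (tag z)), snd z / slope (tag z) + offset (tag z) (nxt (point z) (tag z)))"
proof -
  obtain x t y where z: "z = ((x, t), y)" by (metis surj_pair)
  show ?thesis using rug_map_eq[of t x y] assms by (simp add: z good_rugs_iff)
qed

lemma good_rugs_D:
  assumes "z \<in> good_rugs" shows "tag z \<in> I" "point z \<in> D (tag z)" "point z \<in> G" "0 \<le> snd z" "snd z < \<rho> (tag z)"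
  using assms good_rugs_iff[of "point z" "tag z" "snd z"] by auto

lemma point_orbit: "z \<in> good_rugs \<Longrightarrow> point ((F ^^ n) z) = (T ^^ n) (point z)"
  by (induction n) (simp_all add: F_eq orbit_good_rugs)

definition future :: "('a \<times> nat) \<times> real \<Rightarrow> nat \<Rightarrow> nat" where
  "future z = (\<lambda>i. tag ((F ^^ i) z))"

lemma future_in_I: "z \<in> good_rugs \<Longrightarrow> future z i \<in> I"
  unfolding future_def using good_rugs_D(1) orbit_good_rugs by blast

lemma cylinder_iff_future:
  assumes z: "z \<in> good_rugs" and w: "set w \<subseteq> {1..N}"
  shows "point z \<in> cylinder M Z T w \<longleftrightarrow> (\<forall>i<length w. branch (future z i) = w ! i)"
proof -
  have "(T ^^ i) (point z) \<in> Z (w ! i) \<longleftrightarrow> branch (future z i) = w ! i" if "i < length w" for i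
  proof -
    note a = good_rugs_D[OF orbit_good_rugs[OF z, of i], unfolded point_orbit[OF z]]
    have "w ! i \<in> {1..N}" using that w nth_mem by blast
    then show ?thesis using G_branch[OF a(3) _ a(2)] a(1) I_subset unfolding future_def by auto
  qed
  moreover have "point z \<in> space M" using good_rugs_D(3)[OF z] G_subset by (auto simp: space_M)
  ultimately show ?thesis by (simp add: cylinder_def)
qed

text \<open>
  Cylinders of \<open>T\<close> are recorded by the itinerary of levels, because each level lies in a single \<open>Z j\<close>
  and good points lie in only one.
\<close>
lemma cylinder_algebra_future:
  assumes B: "B \<in> sigma_sets X (cylinder M Z T ` words M N Z T)"
  shows "\<exists>C\<in>sets (PiM UNIV (\<lambda>_::nat. count_space I)). \<forall>z\<in>good_rugs. point z \<in> B \<longleftrightarrow> future z \<in> C"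
  using B
proof (induction rule: sigma_sets.induct)
  case (Basic a)
  let ?P = "PiM UNIV (\<lambda>_::nat. count_space I)"
  obtain w where w: "set w \<subseteq> {1..N}" "a = cylinder M Z T w" using Basic by (auto simp: words_def)
  let ?C = "{b \<in> space ?P. \<forall>i\<in>{..<length w}. branch (b i) = w ! i}"
  have "?C \<in> sets ?P"
  proof (rule sets.sets_Collect_finite_All)
    fix i
    have "(\<lambda>b. b i) -` {u \<in> I. branch u = w ! i} \<inter> space ?P \<in> sets ?P"
      by (rule measurable_sets[OF measurable_component_singleton]) auto
    also have "(\<lambda>b. b i) -` {u \<in> I. branch u = w ! i} \<inter> space ?P = {b \<in> space ?P. branch (b i) = w ! i}"
      by (auto simp: space_PiM)
    finally show "{b \<in> space ?P. branch (b i) = w ! i} \<in> sets ?P" .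
  qed simp
  moreover have "\<forall>z\<in>good_rugs. point z \<in> a \<longleftrightarrow> future z \<in> ?C"
    using cylinder_iff_future[OF _ w(1)] future_in_I w(2) by (auto simp: space_PiM)
  ultimately show ?case by blast
next
  case Empty
  show ?case by (rule bexI[of _ "{}"]) auto
next
  case (Compl a)
  let ?P = "PiM UNIV (\<lambda>_::nat. count_space I)"
  obtain C where C: "C \<in> sets ?P" "\<forall>z\<in>good_rugs. point z \<in> a \<longleftrightarrow> future z \<in> C" using Compl.IH by blast
  have "\<forall>z\<in>good_rugs. point z \<in> X - a \<longleftrightarrow> future z \<in> space ?P - C"
    using C(2) good_rugs_D(3) G_subset future_in_I by (auto simp: space_PiM)
  then show ?case using C(1) by (intro bexI[of _ "space ?P - C"]) auto
next
  case (Union a)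
  let ?P = "PiM UNIV (\<lambda>_::nat. count_space I)"
  have "\<exists>C. \<forall>i. C i \<in> sets ?P \<and> (\<forall>z\<in>good_rugs. point z \<in> a i \<longleftrightarrow> future z \<in> C i)"
    using Union.IH by (intro choice) blast
  then obtain C where C: "\<And>i. C i \<in> sets ?P" "\<And>i. \<forall>z\<in>good_rugs. point z \<in> a i \<longleftrightarrow> future z \<in> C i" by blast
  have "(\<Union>i. C i) \<in> sets ?P" using C(1) by (intro sets.countable_UN) auto
  moreover have "\<forall>z\<in>good_rugs. point z \<in> (\<Union>i. a i) \<longleftrightarrow> future z \<in> (\<Union>i. C i)" using C(2) by blast
  ultimately show ?case by (intro bexI[of _ "\<Union>i. C i"])
qed

lemma half_space_future:
  assumes "b \<in> Basis"
  shows "\<exists>C\<in>sets (PiM UNIV (\<lambda>_::nat. count_space I)). \<forall>z\<in>good_rugs. point z \<bullet> b < real_of_rat q \<longleftrightarrow> future z \<in> C"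
proof -
  obtain B where B: "B \<in> sigma_sets X (cylinder M Z T ` words M N Z T)" "\<forall>x\<in>G. x \<bullet> b < real_of_rat q \<longleftrightarrow> x \<in> B"
    using G_separating[OF assms] by blast
  obtain C where "C \<in> sets (PiM UNIV (\<lambda>_::nat. count_space I))" "\<forall>z\<in>good_rugs. point z \<in> B \<longleftrightarrow> future z \<in> C"
    using cylinder_algebra_future[OF B(1)] by blast
  then show ?thesis using B(2) good_rugs_D(3) by (intro bexI[of _ C]) auto
qed

lemma future_determines_point:
  assumes z: "z \<in> good_rugs" "z' \<in> good_rugs" and eq: "future z = future z'"
  shows "point z = point z'"
proof (rule euclidean_eqI)
  fix b :: 'a assume b: "b \<in> Basis"
  have q: "point z \<bullet> b < real_of_rat q \<longleftrightarrow> point z' \<bullet> b < real_of_rat q" for q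
    using half_space_future[OF b, of q] z eq by metis
  show "point z \<bullet> b = point z' \<bullet> b"
  proof (rule ccontr)
    assume "point z \<bullet> b \<noteq> point z' \<bullet> b"
    then consider "point z \<bullet> b < point z' \<bullet> b" | "point z' \<bullet> b < point z \<bullet> b" by linarith
    then show False
      using q of_rat_dense by cases (metis less_asym)+
  qed
qed

text \<open>
  The base of the cylinder \<open>cyl w\<close> defined below; the clause for the empty word is a default value.
\<close>
fun path :: "nat list \<Rightarrow> 'a set" where
  "path [] = G"
| "path [t] = D t \<inter> G"
| "path (t # u # w) = {x \<in> D t \<inter> G. arrows t u \<and> T x \<in> path (u # w)}"

fun weight :: "nat list \<Rightarrow> real" where
  "weight [] = 1"
| "weight [t] = 1"
| "weight (t # u # w) = transition t u * weight (u # w)"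

lemma weight_eq_prod: "weight w = (\<Prod>i<length w - 1. transition (w ! i) (w ! Suc i))"
  by (induction w rule: weight.induct) (simp_all add: prod.lessThan_Suc_shift del: prod.lessThan_Suc)

lemma path_subset: "w \<noteq> [] \<Longrightarrow> path w \<subseteq> D (hd w) \<inter> G"
  by (induction w rule: path.induct) auto

lemma path_borel: "w \<noteq> [] \<Longrightarrow> set w \<subseteq> I \<Longrightarrow> path w \<in> sets borel"
proof (induction w rule: path.induct)
  case (2 t)
  then show ?case using level_set(3)[of t] I_subset G_borel by auto
next
  case (3 t u w)
  have "path (t # u # w) = (if arrows t u then D t \<inter> G \<inter> {x \<in> regular. T x \<in> path (u # w)} else {})"
    using G_regular by auto
  moreover have "D t \<in> sets borel" using 3 level_set(3) I_subset by auto
  ultimately show ?case using 3 preimage_regular_borel[of "path (u # w)"] G_borel by auto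
qed simp

lemma path_sets: "w \<noteq> [] \<Longrightarrow> set w \<subseteq> I \<Longrightarrow> path w \<in> sets M"
  using path_borel path_subset G_subset by (intro borel_in_sets_M) blast+

lemma path_measure:
  "w \<noteq> [] \<Longrightarrow> set w \<subseteq> I \<Longrightarrow> measure M (path w) = mass (hd w) * weight w"
proof (induction w rule: path.induct)
  case (2 t)
  then have "D t \<in> sets M" using level_set(2) I_subset by auto
  from emeasure_Int_G[OF this] show ?case by (simp add: measure_def)
next
  case (3 t u w)
  have tu: "t \<in> \<alpha>" "u \<in> \<alpha>" "set (u # w) \<subseteq> I" using 3 I_subset by auto
  show ?case
  proof (cases "arrows t u")
    case False then show ?thesis by (simp add: transition_def)
  next
    case True
    let ?B = "path (u # w)"
    have B: "?B \<in> sets M" "?B \<subseteq> D u" using path_sets[of "u # w"] path_subset[of "u # w"] tu by auto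
    note pre = emeasure_preimage_arrow[OF tu(1,2) True B]
    have "path (t # u # w) = {x \<in> D t. T x \<in> ?B} \<inter> G" using True by auto
    then have "emeasure M (path (t # u # w)) = emeasure M {x \<in> D t. T x \<in> ?B}"
      using emeasure_Int_G[OF pre(1)] by simp
    then have "slope t * measure M (path (t # u # w)) = measure M ?B"
      using pre(2) slope[OF tu(1)] by (simp add: emeasure_eq_measure ennreal_mult[symmetric])
    also have "\<dots> = mass u * weight (u # w)" using 3 tu by simp
    finally show ?thesis
      using True tu slope[OF tu(1)] mass_pos[OF tu(1)] by (simp add: transition_def field_simps)
  qed
qed simp

definition cyl :: "nat list \<Rightarrow> (('a \<times> nat) \<times> real) set" where
  "cyl w = (path w \<times> {hd w}) \<times> {0..<\<rho> (hd w)}"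

lemma cyl_iff: "z \<in> cyl w \<longleftrightarrow> point z \<in> path w \<and> tag z = hd w \<and> 0 \<le> snd z \<and> snd z < \<rho> (hd w)"
  by (cases z) (auto simp: cyl_def)

lemma cyl_subset: "w \<noteq> [] \<Longrightarrow> set w \<subseteq> I \<Longrightarrow> cyl w \<subseteq> good_rugs"
proof
  fix z assume w: "w \<noteq> []" "set w \<subseteq> I" "z \<in> cyl w"
  obtain x t y where z: "z = ((x, t), y)" by (metis surj_pair)
  have "hd w \<in> I" using w by auto
  then show "z \<in> good_rugs" using w path_subset[OF w(1)] by (auto simp: z cyl_iff good_rugs_iff)
qed

text \<open>The height has no influence on the future, so a cylinder is a product.\<close>
lemma cyl_measure:
  assumes w: "w \<noteq> []" "set w \<subseteq> I"
  shows "cyl w \<in> sets \<nu>" "emeasure \<nu> (cyl w) = ennreal (\<rho> (hd w) * mass (hd w) * weight w)"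
proof -
  have u: "hd w \<in> I" using w by auto
  have sub: "path w \<subseteq> D (hd w)" using path_subset[OF w(1)] by auto
  have sub2: "{0..<\<rho> (hd w)} \<subseteq> {0..\<rho> (hd w)}" by auto
  note box = emeasure_box[OF u path_borel[OF w] sub _ sub2]
  show "cyl w \<in> sets \<nu>" unfolding cyl_def by (rule box(1)) simp
  have "emeasure \<nu> (cyl w) = ennreal (measure M (path w)) * ennreal (\<rho> (hd w))"
    unfolding cyl_def using box(2) \<rho>_pos[OF u] by (auto simp: emeasure_eq_measure)
  also have "\<dots> = ennreal (measure M (path w) * \<rho> (hd w))"
    using \<rho>_pos[OF u] by (simp add: ennreal_mult)
  also have "measure M (path w) * \<rho> (hd w) = \<rho> (hd w) * mass (hd w) * weight w"
    by (simp add: path_measure[OF w])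
  finally show "emeasure \<nu> (cyl w) = ennreal (\<rho> (hd w) * mass (hd w) * weight w)" .
qed

lemma cyl_Cons:
  assumes z: "z \<in> good_rugs" and u: "u \<in> I"
  shows "z \<in> cyl (t # u # w) \<longleftrightarrow> tag z = t \<and> F z \<in> cyl (u # w)"
proof -
  let ?x = "point z"
  note a = good_rugs_D[OF z]
  have ta: "tag z \<in> \<alpha>" "u \<in> \<alpha>" using a u I_subset by auto
  have FA: "F z \<in> good_rugs" using F_into z by auto
  have n: "arrows (tag z) u \<and> T ?x \<in> path (u # w) \<longleftrightarrow> nxt ?x (tag z) = u \<and> T ?x \<in> path (u # w)"
  proof
    assume "arrows (tag z) u \<and> T ?x \<in> path (u # w)"
    moreover from this have "T ?x \<in> D u" using path_subset[of "u # w"] by auto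
    ultimately show "nxt ?x (tag z) = u \<and> T ?x \<in> path (u # w)"
      using nxt_eqI[OF a(3) ta(1) a(2) ta(2)] by auto
  next
    assume "nxt ?x (tag z) = u \<and> T ?x \<in> path (u # w)"
    then show "arrows (tag z) u \<and> T ?x \<in> path (u # w)" using nxt(2)[OF a(3) ta(1) a(2)] by auto
  qed
  have FF: "point (F z) = T ?x" "tag (F z) = nxt ?x (tag z)" by (simp_all add: F_eq[OF z])
  show ?thesis
  proof (cases "tag z = t")
    case True
    then have "z \<in> cyl (t # u # w) \<longleftrightarrow> arrows (tag z) u \<and> T ?x \<in> path (u # w)"
      using a by (auto simp: cyl_iff)
    also have "\<dots> \<longleftrightarrow> F z \<in> cyl (u # w)"
      unfolding n cyl_iff FF using good_rugs_D(4,5)[OF FA] FF by auto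
    finally show ?thesis using True by simp
  qed (auto simp: cyl_iff)
qed

lemma cyl_iff_future:
  "z \<in> good_rugs \<Longrightarrow> w \<noteq> [] \<Longrightarrow> set w \<subseteq> I \<Longrightarrow> z \<in> cyl w \<longleftrightarrow> (\<forall>i<length w. future z i = w ! i)"
proof (induction w arbitrary: z rule: path.induct)
  case (2 t)
  then show ?case using good_rugs_D[OF 2(1)] by (auto simp: cyl_iff future_def)
next
  case (3 t u w)
  have Fz: "F z \<in> good_rugs" using F_into 3(2) by auto
  have shift: "future z (Suc i) = future (F z) i" for i by (simp add: future_def funpow_swap1)
  have "(\<forall>i<length (t # u # w). future z i = (t # u # w) ! i) \<longleftrightarrow>
      future z 0 = t \<and> (\<forall>i<length (u # w). future (F z) i = (u # w) ! i)"
    using All_less_Suc2[of "length (u # w)" "\<lambda>i. future z i = (t # u # w) ! i"] by (simp add: shift del: All_less_Suc2)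
  then show ?case using cyl_Cons[OF 3(2)] 3(1)[OF Fz] 3(4) by (simp add: future_def)
qed simp

definition word :: "nat \<Rightarrow> ('a \<times> nat) \<times> real \<Rightarrow> nat list" where
  "word n z = map (future z) [0..<Suc n]"

lemma word_props:
  assumes "z \<in> good_rugs"
  shows "word n z \<noteq> []" "set (word n z) \<subseteq> I" "length (word n z) = Suc n" "hd (word n z) = tag z"
    "z \<in> cyl (word n z)"
proof -
  show 1: "word n z \<noteq> []" "set (word n z) \<subseteq> I" "length (word n z) = Suc n"
    using future_in_I[OF assms] by (auto simp: word_def)
  show "hd (word n z) = tag z" by (simp add: word_def upt_conv_Cons future_def del: upt_Suc)
  show "z \<in> cyl (word n z)"
    using cyl_iff_future[OF assms 1(1,2)] unfolding 1(3) by (simp add: word_def nth_append del: upt_Suc)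
qed

lemma word_Suc: "word (Suc n) z = tag z # word n (F z)"
proof -
  have "[0..<Suc (Suc n)] = 0 # map Suc [0..<Suc n]" by (simp add: upt_conv_Cons map_Suc_upt del: upt_Suc)
  then have "word (Suc n) z = future z 0 # map (\<lambda>i. future z (Suc i)) [0..<Suc n]"
    unfolding word_def by (simp add: comp_def del: upt_Suc)
  then show ?thesis by (simp add: future_def word_def funpow_swap1 del: upt_Suc)
qed

lemma cyl_word_iff: "z \<in> good_rugs \<Longrightarrow> z' \<in> good_rugs \<Longrightarrow> z' \<in> cyl (word n z) \<longleftrightarrow> (\<forall>i\<le>n. future z' i = future z i)"
  using cyl_iff_future[of z' "word n z"] word_props[of z n]
  by (simp add: word_def less_Suc_eq_le del: upt_Suc)

definition prob_word :: "nat \<Rightarrow> ('a \<times> nat) \<times> real \<Rightarrow> real" where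
  "prob_word n z = measure \<nu> (cyl (word n z))"

lemma \<nu>_finite_measure: "finite_measure \<nu>"
  by (rule finite_measureI) (use \<nu>_finite in \<open>simp add: space_\<nu>\<close>)

lemma prob_word_eq: "z \<in> good_rugs \<Longrightarrow> prob_word n z = \<rho> (tag z) * mass (tag z) * weight (word n z)"
proof -
  assume z: "z \<in> good_rugs"
  have "0 \<le> weight w" for w by (induction w rule: weight.induct) (simp_all add: transition_nonneg)
  then show ?thesis
    using cyl_measure(2)[OF word_props(1,2)[OF z]] \<rho>_pos[OF good_rugs_D(1)[OF z]] word_props(4)[OF z, of n]
    by (simp add: prob_word_def measure_def)
qed

lemma prob_word_decreasing:
  assumes z: "z \<in> good_rugs" shows "prob_word (Suc n) z \<le> prob_word n z"
proof -
  interpret finite_measure \<nu> by (rule \<nu>_finite_measure)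
  have "cyl (word (Suc n) z) \<subseteq> cyl (word n z)"
  proof
    fix z' assume z': "z' \<in> cyl (word (Suc n) z)"
    then have "z' \<in> good_rugs" using cyl_subset word_props[OF z] by blast
    then show "z' \<in> cyl (word n z)" using cyl_word_iff[OF z] z' by simp
  qed
  then show ?thesis
    unfolding prob_word_def using cyl_measure(1) word_props[OF z] by (intro finite_measure_mono) auto
qed

end

section \<open>The past determines the height\<close>

locale atomless_lift = lifted_tower M X N Z T s \<alpha> D G H
  for M :: "'a::euclidean_space measure" and X N Z T s \<alpha> D G H +
  assumes no_atoms: "x \<in> X \<Longrightarrow> emeasure M {x} = 0"
begin

text \<open>
  The intersection of the cylinders around \<open>z\<close> is contained in a vertical segment over \<open>point z\<close>, and
  \<open>point z\<close> is not an atom.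
\<close>
lemma prob_word_tendsto_0:
  assumes z: "z \<in> good_rugs" shows "(\<lambda>n. prob_word n z) \<longlonglongrightarrow> 0"
proof -
  interpret finite_measure \<nu> by (rule \<nu>_finite_measure)
  have m: "cyl (word n z) \<in> sets \<nu>" for n using cyl_measure(1) word_props[OF z] by blast
  have sub: "cyl (word n z) \<subseteq> good_rugs" for n using cyl_subset word_props[OF z] by blast
  have "decseq (\<lambda>n. cyl (word n z))"
    unfolding decseq_def
  proof (intro allI impI subsetI)
    fix i j :: nat and z' assume ij: "i \<le> j" and z': "z' \<in> cyl (word j z)"
    then have "z' \<in> good_rugs" using sub by blast
    then show "z' \<in> cyl (word i z)" using cyl_word_iff[OF z] z' ij by simp
  qed
  then have "(\<lambda>n. measure \<nu> (cyl (word n z))) \<longlonglongrightarrow> measure \<nu> (\<Inter>n. cyl (word n z))"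
    using m by (intro finite_Lim_measure_decseq) auto
  moreover have "measure \<nu> (\<Inter>n. cyl (word n z)) = 0"
  proof -
    let ?B = "({point z} \<times> {tag z}) \<times> {0..\<rho> (tag z)}"
    note a = good_rugs_D[OF z]
    have "(\<Inter>n. cyl (word n z)) \<subseteq> ?B"
    proof
      fix z' assume z': "z' \<in> (\<Inter>n. cyl (word n z))"
      then have A': "z' \<in> good_rugs" using sub by blast
      have "future z' i = future z i" for i
        using cyl_word_iff[OF z A', of i] z' by blast
      then have f: "future z' = future z" by (rule ext)
      have "point z' = point z" using future_determines_point[OF A' z f] .
      moreover have "tag z' = tag z" using fun_cong[OF f, of 0] by (simp add: future_def)
      ultimately show "z' \<in> ?B" using good_rugs_D(4,5)[OF A'] by (cases z') auto
    qed
    moreover have "?B \<in> sets \<nu>" "emeasure \<nu> ?B = 0"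
      using emeasure_box[OF a(1), of "{point z}" "{0..\<rho> (tag z)}"] a no_atoms[of "point z"] G_subset by auto
    ultimately have "emeasure \<nu> (\<Inter>n. cyl (word n z)) \<le> 0"
      by (metis emeasure_mono)
    then show ?thesis by (simp add: measure_def)
  qed
  ultimately show ?thesis by (simp add: prob_word_def)
qed

definition heavy :: "nat \<Rightarrow> real \<Rightarrow> (('a \<times> nat) \<times> real) set" where
  "heavy n \<epsilon> = {z \<in> good_rugs. \<epsilon> \<le> prob_word n z}"

lemma heavy_sets: "heavy n \<epsilon> \<in> sets \<nu>"
proof -
  let ?W = "{w. w \<noteq> [] \<and> set w \<subseteq> I \<and> length w = Suc n \<and> \<epsilon> \<le> measure \<nu> (cyl w)}"
  have "heavy n \<epsilon> = (\<Union>w\<in>?W. cyl w)"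
  proof (intro subset_antisym subsetI)
    fix z assume z: "z \<in> heavy n \<epsilon>"
    then have "z \<in> good_rugs" by (simp add: heavy_def)
    then have "word n z \<in> ?W" "z \<in> cyl (word n z)"
      using word_props z by (auto simp: heavy_def prob_word_def)
    then show "z \<in> (\<Union>w\<in>?W. cyl w)" by blast
  next
    fix z assume "z \<in> (\<Union>w\<in>?W. cyl w)"
    then obtain w where w: "w \<noteq> []" "set w \<subseteq> I" "length w = Suc n" "\<epsilon> \<le> measure \<nu> (cyl w)" "z \<in> cyl w" by auto
    then have z: "z \<in> good_rugs" using cyl_subset by blast
    have "word n z = w"
      using cyl_iff_future[OF z w(1,2)] w(3,5) by (intro nth_equalityI) (auto simp: word_def simp del: upt_Suc)
    then show "z \<in> heavy n \<epsilon>" using z w by (simp add: heavy_def prob_word_def)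
  qed
  also have "\<dots> \<in> sets \<nu>" using cyl_measure(1) by (intro sets.countable_UN'') auto
  finally show ?thesis .
qed

lemma heavy_tendsto_0:
  assumes \<epsilon>: "\<epsilon> > 0" shows "(\<lambda>n. emeasure \<nu> (heavy n \<epsilon>)) \<longlonglongrightarrow> 0"
proof -
  interpret finite_measure \<nu> by (rule \<nu>_finite_measure)
  have "decseq (\<lambda>n. heavy n \<epsilon>)"
    by (rule decseq_SucI) (auto simp: heavy_def intro: order_trans[OF _ prob_word_decreasing])
  then have "(\<lambda>n. emeasure \<nu> (heavy n \<epsilon>)) \<longlonglongrightarrow> emeasure \<nu> (\<Inter>n. heavy n \<epsilon>)"
    using heavy_sets by (intro Lim_emeasure_decseq) auto
  moreover have "z \<notin> (\<Inter>n. heavy n \<epsilon>)" for z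
  proof
    assume z: "z \<in> (\<Inter>n. heavy n \<epsilon>)"
    then have "z \<in> good_rugs" by (auto simp: heavy_def)
    from prob_word_tendsto_0[OF this] have "\<epsilon> \<le> 0"
      by (rule LIMSEQ_le_const) (use z in \<open>auto simp: heavy_def\<close>)
    then show False using \<epsilon> by simp
  qed
  then have "(\<Inter>n. heavy n \<epsilon>) = {}" by blast
  ultimately show ?thesis by simp
qed

lemma F_iterate_image:
  assumes E: "E \<in> sets \<nu>" "E \<subseteq> good_rugs"
  shows "(F ^^ n) ` E \<in> sets \<nu> \<and> (F ^^ n) ` E \<subseteq> good_rugs \<and> emeasure \<nu> ((F ^^ n) ` E) = emeasure \<nu> E"
proof (induction n)
  case 0 show ?case using E by simp
next
  case (Suc n)
  have eq: "(F ^^ Suc n) ` E = F ` ((F ^^ n) ` E)" by (simp add: image_comp)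
  have "F ` good_rugs \<subseteq> good_rugs" using F_into by auto
  then have "F ` ((F ^^ n) ` E) \<subseteq> good_rugs" using Suc by (meson image_mono order_trans)
  then show ?case unfolding eq using F_image[of "(F ^^ n) ` E"] Suc by simp
qed

text \<open>
  By invariance, the points with an exceptionally heavy past of length \<open>n\<close> are as rare as those with
  an exceptionally heavy future of length \<open>n\<close>. So a point whose past is heavy for every \<open>n\<close> belongs to
  a null set, which \<open>invertible_core\<close> can discard.
\<close>
lemma contracting_core:
  obtains Y0 where "Y0 \<in> sets \<nu>" "Y0 \<subseteq> good_rugs" "emeasure \<nu> (space \<nu> - Y0) = 0" "bij_betw F Y0 Y0"
    "\<And>z \<epsilon>. z \<in> Y0 \<Longrightarrow> \<epsilon> > 0 \<Longrightarrow> \<exists>n. \<forall>z'\<in>good_rugs. (F ^^ n) z' = z \<longrightarrow> prob_word n z' < \<epsilon>"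
proof -
  define B where "B m = (\<Inter>n. (F ^^ n) ` heavy n (1 / real (Suc m)))" for m
  have hA: "heavy n \<epsilon> \<subseteq> good_rugs" for n \<epsilon> by (auto simp: heavy_def)
  note h = F_iterate_image[OF heavy_sets hA]
  have "B m \<in> null_sets \<nu>" for m
  proof
    show m: "B m \<in> sets \<nu>" unfolding B_def using h by auto
    have "emeasure \<nu> (B m) \<le> emeasure \<nu> (heavy n (1 / real (Suc m)))" for n
    proof -
      have "emeasure \<nu> (B m) \<le> emeasure \<nu> ((F ^^ n) ` heavy n (1 / real (Suc m)))"
        by (rule emeasure_mono) (use h in \<open>auto simp: B_def\<close>)
      then show ?thesis using h by simp
    qed
    then have "emeasure \<nu> (B m) \<le> 0"
      using LIMSEQ_le_const[OF heavy_tendsto_0[of "1 / real (Suc m)"]] by auto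
    then show "emeasure \<nu> (B m) = 0" by simp
  qed
  then have null: "(\<Union>m. B m) \<in> null_sets \<nu>" by (intro null_sets_UN) auto
  have fin: "emeasure \<nu> (space \<nu>) < \<infinity>" using \<nu>_finite by (simp add: space_\<nu>)
  obtain Y0 where Y0: "Y0 \<in> sets \<nu>" "Y0 \<subseteq> good_rugs - (\<Union>m. B m)" "emeasure \<nu> (space \<nu> - Y0) = 0" "bij_betw F Y0 Y0"
    by (rule invertible_core[OF good_rugs_sets good_rugs_full fin F_into F_inj F_image F_preimage_sets
          null_setsD2[OF null] null_setsD1[OF null]])
  show ?thesis
  proof (rule that[OF Y0(1) _ Y0(3,4)])
    show "Y0 \<subseteq> good_rugs" using Y0(2) by blast
    fix z and \<epsilon> :: real assume z: "z \<in> Y0" and \<epsilon>: "\<epsilon> > 0"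
    obtain m where m: "1 / real (Suc m) < \<epsilon>" using nat_approx_posE[OF \<epsilon>] by (auto simp: inverse_eq_divide)
    have "z \<notin> B m" using z Y0(2) by blast
    then obtain n where n: "z \<notin> (F ^^ n) ` heavy n (1 / real (Suc m))" unfolding B_def by blast
    have "prob_word n z' < \<epsilon>" if "z' \<in> good_rugs" "(F ^^ n) z' = z" for z'
    proof -
      have "z' \<notin> heavy n (1 / real (Suc m))" using n that by blast
      then show ?thesis using that m by (simp add: heavy_def)
    qed
    then show "\<exists>n. \<forall>z'\<in>good_rugs. (F ^^ n) z' = z \<longrightarrow> prob_word n z' < \<epsilon>" by blast
  qed
qed

text \<open>
  If a point of rug \<open>t\<close> has height in \<open>[a, a + l)\<close> and visits the levels \<open>w\<close> next, then its height at
  the end lies in an interval with bottom \<open>low t a w\<close> and length \<open>len t l w\<close>.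
\<close>
fun low :: "nat \<Rightarrow> real \<Rightarrow> nat list \<Rightarrow> real" where
  "low t a [] = a"
| "low t a (u # w) = low u (a / slope t + offset t u) w"

fun len :: "nat \<Rightarrow> real \<Rightarrow> nat list \<Rightarrow> real" where
  "len t l [] = l"
| "len t l (u # w) = len u (l / slope t) w"

lemma height_bounds:
  assumes "z \<in> good_rugs" "a \<le> snd z" "snd z < a + l"
  shows "low (tag z) a (tl (word n z)) \<le> snd ((F ^^ n) z) \<and>
    snd ((F ^^ n) z) < low (tag z) a (tl (word n z)) + len (tag z) l (tl (word n z))"
  using assms
proof (induction n arbitrary: z a l)
  case 0 then show ?case by (simp add: word_def)
next
  case (Suc n)
  let ?t = "tag z" and ?u = "tag (F z)"
  have Fz: "F z \<in> good_rugs" using F_into Suc.prems(1) by auto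
  have sl: "slope ?t > 0" using slope[of ?t] good_rugs_D(1)[OF Suc.prems(1)] I_subset by auto
  have y: "snd (F z) = snd z / slope ?t + offset ?t ?u" using F_eq[OF Suc.prems(1)] by simp
  have w: "word n (F z) = ?u # tl (word n (F z))"
    using word_props(1,4)[OF Fz, of n] by (metis list.collapse)
  have "a / slope ?t + offset ?t ?u \<le> snd (F z)" "snd (F z) < (a / slope ?t + offset ?t ?u) + l / slope ?t"
    unfolding y using Suc.prems(2,3) sl
    by (auto simp: divide_right_mono add_divide_distrib[symmetric] divide_strict_right_mono)
  note IH = Suc.IH[OF Fz this]
  have "tl (word (Suc n) z) = ?u # tl (word n (F z))" unfolding word_Suc using w by simp
  then show ?case using IH by (simp add: funpow_swap1)
qed

text \<open>
  Along an arrow \<open>t \<rightarrow> u\<close> the length is divided by \<open>slope t\<close>, that is, multiplied by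
  \<open>transition t u * mass t / mass u\<close>.
\<close>
lemma len_word:
  assumes "z \<in> good_rugs"
  shows "len (tag z) l (tl (word n z)) * mass (tag ((F ^^ n) z)) = l * mass (tag z) * weight (word n z)"
  using assms
proof (induction n arbitrary: z l)
  case 0 then show ?case by (simp add: word_def)
next
  case (Suc n)
  let ?t = "tag z" and ?u = "tag (F z)"
  note a = good_rugs_D[OF Suc.prems]
  have ta: "?t \<in> \<alpha>" using a I_subset by auto
  have Fz: "F z \<in> good_rugs" using F_into Suc.prems(1) by auto
  have w: "word n (F z) = ?u # tl (word n (F z))"
    using word_props(1,4)[OF Fz, of n] by (metis list.collapse)
  have ar: "arrows ?t ?u" "?u \<in> \<alpha>"
    using nxt(1,2)[OF a(3) ta a(2)] F_eq[OF Suc.prems] by auto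
  have "weight (word (Suc n) z) = transition ?t ?u * weight (word n (F z))"
    unfolding word_Suc by (subst (1 2) w) simp
  moreover have "tl (word (Suc n) z) = ?u # tl (word n (F z))" unfolding word_Suc using w by simp
  ultimately show ?case
    using Suc.IH[OF Fz, of "l / slope ?t"] ar ta mass_pos[OF ta] by (simp add: funpow_swap1 transition_def)
qed

lemma height_bounds_word:
  assumes z: "z \<in> good_rugs"
  shows "low (tag z) 0 (tl (word n z)) \<le> snd ((F ^^ n) z)"
    "snd ((F ^^ n) z) < low (tag z) 0 (tl (word n z)) + prob_word n z / mass (tag ((F ^^ n) z))"
proof -
  have h: "0 \<le> snd z" "snd z < 0 + \<rho> (tag z)" using good_rugs_D[OF z] by auto
  note b = height_bounds[OF z h, of n]
  then show "low (tag z) 0 (tl (word n z)) \<le> snd ((F ^^ n) z)" by blast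
  have "mass (tag ((F ^^ n) z)) > 0"
    using mass_pos good_rugs_D(1)[OF orbit_good_rugs[OF z]] I_subset by blast
  then have "len (tag z) (\<rho> (tag z)) (tl (word n z)) = prob_word n z / mass (tag ((F ^^ n) z))"
    using len_word[OF z, of "\<rho> (tag z)" n] prob_word_eq[OF z, of n] by (simp add: field_simps)
  then show "snd ((F ^^ n) z) < low (tag z) 0 (tl (word n z)) + prob_word n z / mass (tag ((F ^^ n) z))"
    using b by simp
qed

end

section \<open>Two-sided iterates\<close>

lemma int_iterate_0: "int_iterate f S 0 z = z"
  by (simp add: int_iterate_def)

lemma int_iterate_nonpos: "k \<le> 0 \<Longrightarrow> int_iterate f S k = inv_into S f ^^ nat (- k)"
  by (auto simp: int_iterate_def)

lemma int_iterate_in: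
  assumes f: "bij_betw f S S" and z: "z \<in> S" shows "int_iterate f S k z \<in> S"
proof -
  have 1: "f x \<in> S" "inv_into S f x \<in> S" if "x \<in> S" for x
    using f that by (auto simp: bij_betw_def intro: inv_into_into)
  have "(f ^^ n) z \<in> S" "(inv_into S f ^^ n) z \<in> S" for n by (induction n) (auto simp: z 1)
  then show ?thesis by (simp add: int_iterate_def)
qed

lemma map_int_iterate:
  assumes f: "bij_betw f S S" and z: "z \<in> S"
  shows "f (int_iterate f S k z) = int_iterate f S (k + 1) z"
proof (cases "k \<ge> 0")
  case True
  then have "nat (k + 1) = Suc (nat k)" by simp
  then show ?thesis using True by (simp add: int_iterate_def)
next
  case False
  define n where "n = nat (- (k + 1))"
  have n: "nat (- k) = Suc n" using False by (simp add: n_def)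
  have in_S: "(inv_into S f ^^ n) z \<in> S"
    using int_iterate_in[OF f z, of "k + 1"] False by (simp add: int_iterate_nonpos n_def)
  have "f (inv_into S f ((inv_into S f ^^ n) z)) = (inv_into S f ^^ n) z"
    using f in_S by (auto simp: bij_betw_def intro!: f_inv_into_f)
  then show ?thesis using False n by (simp add: int_iterate_nonpos n_def)
qed

lemma int_iterate_map:
  assumes f: "bij_betw f S S" and z: "z \<in> S"
  shows "int_iterate f S k (f z) = int_iterate f S (k + 1) z"
proof (cases "k \<ge> 0")
  case True
  then have "nat (k + 1) = Suc (nat k)" by simp
  then show ?thesis using True by (simp add: int_iterate_def funpow_swap1)
next
  case False
  define n where "n = nat (- (k + 1))"
  have n: "nat (- k) = Suc n" using False by (simp add: n_def)
  have "inv_into S f (f z) = z" using f z by (auto simp: bij_betw_def)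
  then show ?thesis using False n by (simp add: int_iterate_nonpos n_def funpow_swap1)
qed

lemma funpow_int_iterate:
  assumes f: "bij_betw f S S" and z: "z \<in> S"
  shows "(f ^^ n) (int_iterate f S k z) = int_iterate f S (k + int n) z"
proof (induction n)
  case (Suc n)
  then show ?case using map_int_iterate[OF f z, of "k + int n"] by (simp add: ac_simps)
qed simp

section \<open>Recovering a point from its itinerary\<close>

lemma INF_rationals_above: "(INF q::rat. if x < of_rat q then ereal (of_rat q) else \<infinity>) = ereal x"
proof (rule antisym)
  show "(INF q::rat. if x < of_rat q then ereal (of_rat q) else \<infinity>) \<le> ereal x"
  proof (rule dense_ge)
    fix y assume y: "ereal x < y"
    then obtain r where r: "ereal x < ereal r" "ereal r < y" using ereal_dense2 by blast
    then obtain q where q: "x < of_rat q" "of_rat q < r" using of_rat_dense by auto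
    have "(INF q::rat. if x < of_rat q then ereal (of_rat q) else \<infinity>) \<le> (if x < of_rat q then ereal (of_rat q) else \<infinity>)"
      by (rule INF_lower) simp
    also have "\<dots> \<le> ereal r" using q by simp
    finally show "(INF q::rat. if x < of_rat q then ereal (of_rat q) else \<infinity>) \<le> y" using r(2) by simp
  qed
  show "ereal x \<le> (INF q::rat. if x < of_rat q then ereal (of_rat q) else \<infinity>)"
    by (rule INF_greatest) auto
qed

lemma SUP_approximations:
  fixes e :: "nat \<Rightarrow> real"
  assumes "\<And>n. e n \<le> y" "\<And>\<epsilon>. \<epsilon> > 0 \<Longrightarrow> \<exists>n. y < e n + \<epsilon>"
  shows "(SUP n. ereal (e n)) = ereal y"
proof (rule antisym)
  show "(SUP n. ereal (e n)) \<le> ereal y" using assms(1) by (auto intro!: SUP_least)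
  show "ereal y \<le> (SUP n. ereal (e n))"
  proof (rule dense_le)
    fix c assume c: "c < ereal y"
    then obtain r where r: "c < ereal r" "ereal r < ereal y" using ereal_dense2 by blast
    then obtain n where "y < e n + (y - r)" using assms(2)[of "y - r"] by auto
    then have "ereal r \<le> ereal (e n)" by simp
    also have "\<dots> \<le> (SUP n. ereal (e n))" by (rule SUP_upper) simp
    finally show "c \<le> (SUP n. ereal (e n))" using r(1) by simp
  qed
qed

lemma measurable_map_list:
  fixes f :: "'i \<Rightarrow> 'a \<Rightarrow> 'b::countable"
  assumes "\<And>i. i \<in> set xs \<Longrightarrow> f i \<in> M \<rightarrow>\<^sub>M count_space UNIV"
  shows "(\<lambda>x. map (\<lambda>i. f i x) xs) \<in> M \<rightarrow>\<^sub>M count_space UNIV"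
  using assms
proof (induction xs)
  case (Cons i xs)
  have "(\<lambda>x. u # map (\<lambda>i. f i x) xs) \<in> M \<rightarrow>\<^sub>M count_space UNIV" for u
    using Cons by (intro measurable_compose[of _ M "count_space UNIV" "\<lambda>l. u # l"]) auto
  then show ?case
    using Cons.prems by (auto intro: measurable_compose_countable[where f="\<lambda>u x. u # map (\<lambda>i. f i x) xs"])
qed simp

context atomless_lift
begin

abbreviation P where "P \<equiv> PiM UNIV (\<lambda>_::int. count_space I)"

lemma space_P: "\<omega> \<in> space P \<longleftrightarrow> (\<forall>k. \<omega> k \<in> I)"
  by (auto simp: space_PiM)

lemma coordinate_measurable: "(\<lambda>\<omega>. \<omega> k) \<in> P \<rightarrow>\<^sub>M count_space UNIV"
  by (rule measurable_compose[OF measurable_component_singleton[of k]]) (auto simp: measurable_count_space_eq1)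

lemma nonneg_coordinates_measurable:
  "(\<lambda>\<omega> i. \<omega> (int i)) \<in> P \<rightarrow>\<^sub>M PiM UNIV (\<lambda>_::nat. count_space I)"
  by (rule measurable_PiM_single') (auto simp: space_PiM intro: measurable_component_singleton)

definition half_code :: "'a \<Rightarrow> rat \<Rightarrow> (nat \<Rightarrow> nat) set" where
  "half_code b q = (SOME C. C \<in> sets (PiM UNIV (\<lambda>_::nat. count_space I)) \<and>
     (\<forall>z\<in>good_rugs. point z \<bullet> b < real_of_rat q \<longleftrightarrow> future z \<in> C))"

lemma half_code:
  assumes "b \<in> Basis"
  shows "half_code b q \<in> sets (PiM UNIV (\<lambda>_::nat. count_space I))"
    "z \<in> good_rugs \<Longrightarrow> point z \<bullet> b < real_of_rat q \<longleftrightarrow> future z \<in> half_code b q"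
proof -
  have "\<exists>C. C \<in> sets (PiM UNIV (\<lambda>_::nat. count_space I)) \<and>
     (\<forall>z\<in>good_rugs. point z \<bullet> b < real_of_rat q \<longleftrightarrow> future z \<in> C)"
    using half_space_future[OF assms, of q] by blast
  from someI_ex[OF this] show "half_code b q \<in> sets (PiM UNIV (\<lambda>_::nat. count_space I))"
    "z \<in> good_rugs \<Longrightarrow> point z \<bullet> b < real_of_rat q \<longleftrightarrow> future z \<in> half_code b q"
    unfolding half_code_def by blast+
qed

text \<open>
  A number is the infimum of the rationals above it, and the itinerary knows which rationals are above
  a coordinate of the point. Written in this way the coordinate is measurable in the itinerary.
\<close>
definition coordinate_of :: "'a \<Rightarrow> (int \<Rightarrow> nat) \<Rightarrow> real" where
  "coordinate_of b \<omega> =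
     real_of_ereal (INF q::rat. if (\<lambda>i. \<omega> (int i)) \<in> half_code b q then ereal (of_rat q) else \<infinity>)"

definition past :: "nat \<Rightarrow> (int \<Rightarrow> nat) \<Rightarrow> nat list" where
  "past n \<omega> = map (\<lambda>i. \<omega> (int i - int n)) [0..<Suc n]"

text \<open>
  The intervals to which finite pasts confine the height have arbitrarily small length, so the height is
  the supremum of their bottoms.
\<close>
definition height_of :: "(int \<Rightarrow> nat) \<Rightarrow> real" where
  "height_of \<omega> = real_of_ereal (SUP n. ereal (low (hd (past n \<omega>)) 0 (tl (past n \<omega>))))"

definition decode :: "(int \<Rightarrow> nat) \<Rightarrow> ('a \<times> nat) \<times> real" where
  "decode \<omega> = ((\<Sum>b\<in>Basis. coordinate_of b \<omega> *\<^sub>R b, \<omega> 0), height_of \<omega>)"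

lemma decode_measurable: "decode \<in> P \<rightarrow>\<^sub>M borel"
proof -
  have c: "coordinate_of b \<in> P \<rightarrow>\<^sub>M borel" if b: "b \<in> Basis" for b
  proof -
    have "(\<lambda>\<omega>. if (\<lambda>i. \<omega> (int i)) \<in> half_code b q then ereal (of_rat q) else \<infinity>) \<in> P \<rightarrow>\<^sub>M borel" for q
    proof (rule measurable_If)
      have "(\<lambda>\<omega> i. \<omega> (int i)) -` half_code b q \<inter> space P \<in> sets P"
        by (rule measurable_sets[OF nonneg_coordinates_measurable half_code(1)[OF b]])
      also have "(\<lambda>\<omega> i. \<omega> (int i)) -` half_code b q \<inter> space P = {\<omega> \<in> space P. (\<lambda>i. \<omega> (int i)) \<in> half_code b q}"
        by auto
      finally show "{\<omega> \<in> space P. (\<lambda>i. \<omega> (int i)) \<in> half_code b q} \<in> sets P" .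
    qed auto
    then have "(\<lambda>\<omega>. INF q::rat. if (\<lambda>i. \<omega> (int i)) \<in> half_code b q then ereal (of_rat q) else \<infinity>) \<in> P \<rightarrow>\<^sub>M borel"
      by (intro borel_measurable_INF) auto
    then show ?thesis unfolding coordinate_of_def[abs_def] by (rule borel_measurable_real_of_ereal)
  qed
  have "past n \<in> P \<rightarrow>\<^sub>M count_space UNIV" for n
    unfolding past_def[abs_def] by (rule measurable_map_list) (rule coordinate_measurable)
  then have "(\<lambda>\<omega>. ereal (low (hd (past n \<omega>)) 0 (tl (past n \<omega>)))) \<in> P \<rightarrow>\<^sub>M borel" for n
    by (rule measurable_compose) simp
  then have "(\<lambda>\<omega>. SUP n. ereal (low (hd (past n \<omega>)) 0 (tl (past n \<omega>)))) \<in> P \<rightarrow>\<^sub>M borel"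
    by (intro borel_measurable_SUP) auto
  then have hm: "height_of \<in> P \<rightarrow>\<^sub>M borel"
    unfolding height_of_def[abs_def] by (rule borel_measurable_real_of_ereal)
  have "(\<lambda>\<omega>. \<omega> 0) \<in> P \<rightarrow>\<^sub>M borel"
    by (rule measurable_compose[OF coordinate_measurable]) simp
  then show ?thesis
    unfolding decode_def[abs_def] using c hm
    by (intro borel_measurable_Pair borel_measurable_sum borel_measurable_scaleR) auto
qed

context
  fixes Y0 :: "(('a \<times> nat) \<times> real) set"
  assumes Y0: "Y0 \<in> sets \<nu>" "Y0 \<subseteq> good_rugs" "emeasure \<nu> (space \<nu> - Y0) = 0" "bij_betw F Y0 Y0"
    and contracting: "\<And>z \<epsilon>. z \<in> Y0 \<Longrightarrow> \<epsilon> > 0 \<Longrightarrow> \<exists>n. \<forall>z'\<in>good_rugs. (F ^^ n) z' = z \<longrightarrow> prob_word n z' < \<epsilon>"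
begin

abbreviation iter where "iter \<equiv> int_iterate F Y0"
abbreviation \<psi> where "\<psi> \<equiv> itinerary M N Z T s \<alpha> D H Y0"

lemma Y0_borel: "Y0 \<in> sets borel" and Y0_subset_Y: "Y0 \<subseteq> Y"
  using Y0(1) by (auto simp: sets_\<nu>)

lemma emeasure_Int_Y0: "E \<in> sets \<nu> \<Longrightarrow> emeasure \<nu> (E \<inter> Y0) = emeasure \<nu> E"
proof -
  assume E: "E \<in> sets \<nu>"
  then have "E \<inter> Y0 = E - (space \<nu> - Y0)" using sets.sets_into_space[OF E] by auto
  moreover have "space \<nu> - Y0 \<in> null_sets \<nu>" using Y0(1,3) by auto
  ultimately show ?thesis using E by (simp add: emeasure_Diff_null_set)
qed

lemma itinerary_eq:
  assumes z: "z \<in> Y0" shows "\<psi> z k = tag (iter k z)" "\<psi> z k \<in> I"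
proof -
  have "iter k z \<in> good_rugs" using int_iterate_in[OF Y0(4) z] Y0(2) by blast
  then have "tag (iter k z) \<in> I \<and> iter k z \<in> rug M \<alpha> D H (tag (iter k z))"
    using good_rugs_D[of "iter k z"] by (cases "iter k z") (auto simp: rug_def level_def)
  then have "(THE u. u \<in> I \<and> iter k z \<in> rug M \<alpha> D H u) = tag (iter k z)"
    by (intro the_equality) (auto simp: rug_def level_def)
  then show "\<psi> z k = tag (iter k z)" by (simp add: itinerary_def)
  then show "\<psi> z k \<in> I" using good_rugs_D(1) \<open>iter k z \<in> good_rugs\<close> by simp
qed

lemma future_iter:
  assumes z: "z \<in> Y0" shows "future (iter k z) i = \<psi> z (k + int i)"
  unfolding future_def funpow_int_iterate[OF Y0(4) z] itinerary_eq(1)[OF z] ..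

text \<open>Induction in both directions, since \<open>F\<close> preserves the measure of images and, within \<open>Y0\<close>, of preimages.\<close>
lemma iter_preimage:
  "\<forall>E\<in>sets \<nu>. {z \<in> Y0. iter k z \<in> E} \<in> sets \<nu> \<and> emeasure \<nu> {z \<in> Y0. iter k z \<in> E} = emeasure \<nu> E"
proof (induction k rule: int_induct[where k=0])
  case base
  have "{z \<in> Y0. iter 0 z \<in> E} = E \<inter> Y0" for E by (auto simp: int_iterate_0)
  then show ?case using emeasure_Int_Y0 Y0(1) by auto
next
  case (step1 k)
  show ?case
  proof
    fix E assume E: "E \<in> sets \<nu>"
    define E' where "E' = F -` E \<inter> good_rugs \<inter> Y0"
    have E': "E' \<in> sets \<nu>" "E' \<subseteq> good_rugs" using F_preimage_sets[OF E] Y0(1) by (auto simp: E'_def)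
    have "F ` E' = E \<inter> Y0"
    proof (intro subset_antisym subsetI)
      fix z assume "z \<in> F ` E'"
      then show "z \<in> E \<inter> Y0" using bij_betwE[OF Y0(4)] by (auto simp: E'_def)
    next
      fix z assume z: "z \<in> E \<inter> Y0"
      then have "z \<in> F ` Y0" using Y0(4) by (simp add: bij_betw_def)
      then obtain y where "y \<in> Y0" "z = F y" by (rule imageE) blast
      then show "z \<in> F ` E'" using z Y0(2) unfolding E'_def by blast
    qed
    then have "emeasure \<nu> E' = emeasure \<nu> E" using F_image[OF E'] emeasure_Int_Y0[OF E] by simp
    moreover have "{z \<in> Y0. iter (k + 1) z \<in> E} = {z \<in> Y0. iter k z \<in> E'}"
      using map_int_iterate[OF Y0(4), symmetric] int_iterate_in[OF Y0(4)] Y0(2) by (auto simp: E'_def)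
    ultimately show "{z \<in> Y0. iter (k + 1) z \<in> E} \<in> sets \<nu> \<and> emeasure \<nu> {z \<in> Y0. iter (k + 1) z \<in> E} = emeasure \<nu> E"
      using step1 E'(1) by simp
  qed
next
  case (step2 k)
  show ?case
  proof
    fix E assume E: "E \<in> sets \<nu>"
    have E0: "E \<inter> Y0 \<in> sets \<nu>" "E \<inter> Y0 \<subseteq> good_rugs" using E Y0(1,2) by auto
    have "iter (k - 1) z \<in> E \<longleftrightarrow> iter k z \<in> F ` (E \<inter> Y0)" if z: "z \<in> Y0" for z
    proof -
      have 1: "F (iter (k - 1) z) = iter k z" "iter (k - 1) z \<in> Y0"
        using map_int_iterate[OF Y0(4) z, of "k - 1"] int_iterate_in[OF Y0(4) z] by auto
      have "inj_on F Y0" using Y0(4) by (simp add: bij_betw_def)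
      then have "F (iter (k - 1) z) \<in> F ` (E \<inter> Y0) \<longleftrightarrow> iter (k - 1) z \<in> E \<inter> Y0"
        by (rule inj_on_image_mem_iff[OF _ 1(2)]) blast
      then show ?thesis using 1 by simp
    qed
    then have "{z \<in> Y0. iter (k - 1) z \<in> E} = {z \<in> Y0. iter k z \<in> F ` (E \<inter> Y0)}" by blast
    then show "{z \<in> Y0. iter (k - 1) z \<in> E} \<in> sets \<nu> \<and> emeasure \<nu> {z \<in> Y0. iter (k - 1) z \<in> E} = emeasure \<nu> E"
      using step2 F_image[OF E0] emeasure_Int_Y0[OF E] by simp
  qed
qed

lemma decode_itinerary:
  assumes z: "z \<in> Y0" shows "decode (\<psi> z) = z"
proof -
  have zA: "z \<in> good_rugs" using z Y0(2) by auto
  have f: "(\<lambda>i. \<psi> z (int i)) = future z" using future_iter[OF z, of 0] by (simp add: int_iterate_0 fun_eq_iff)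
  have "coordinate_of b (\<psi> z) = point z \<bullet> b" if b: "b \<in> Basis" for b
    unfolding coordinate_of_def f half_code(2)[OF b zA, symmetric] INF_rationals_above by simp
  then have 1: "(\<Sum>b\<in>Basis. coordinate_of b (\<psi> z) *\<^sub>R b) = point z"
    by (simp add: euclidean_representation)
  have 2: "\<psi> z 0 = tag z" by (simp add: itinerary_eq[OF z] int_iterate_0)
  \<comment> \<open>The future word of \<open>iter (- int n) z\<close> of length \<open>n + 1\<close> is the past word of \<open>z\<close>.\<close>
  let ?e = "\<lambda>n. low (hd (past n (\<psi> z))) 0 (tl (past n (\<psi> z)))"
  have bounds: "?e n \<le> snd z" "snd z < ?e n + prob_word n (iter (- int n) z) / mass (tag z)" for n
  proof -
    let ?z' = "iter (- int n) z"
    have z': "?z' \<in> good_rugs" using int_iterate_in[OF Y0(4) z] Y0(2) by blast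
    have Fn: "(F ^^ n) ?z' = z" using funpow_int_iterate[OF Y0(4) z, of n "- int n"] by (simp add: int_iterate_0)
    have "past n (\<psi> z) = word n ?z'"
      unfolding past_def word_def by (rule map_cong) (simp_all add: future_iter[OF z])
    then show "?e n \<le> snd z" "snd z < ?e n + prob_word n ?z' / mass (tag z)"
      using height_bounds_word[OF z', of n] word_props(4)[OF z', of n] unfolding Fn by simp_all
  qed
  have "(SUP n. ereal (?e n)) = ereal (snd z)"
  proof (rule SUP_approximations[OF bounds(1)])
    fix \<epsilon> :: real assume \<epsilon>: "\<epsilon> > 0"
    have m: "mass (tag z) > 0" using mass_pos good_rugs_D(1)[OF zA] I_subset by blast
    then have "\<epsilon> * mass (tag z) > 0" using \<epsilon> by simp
    from contracting[OF z this] obtain n where n: "\<forall>z'\<in>good_rugs. (F ^^ n) z' = z \<longrightarrow> prob_word n z' < \<epsilon> * mass (tag z)" by blast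
    have "iter (- int n) z \<in> good_rugs" using int_iterate_in[OF Y0(4) z] Y0(2) by blast
    then have "prob_word n (iter (- int n) z) < \<epsilon> * mass (tag z)"
      using n funpow_int_iterate[OF Y0(4) z, of n "- int n"] by (simp add: int_iterate_0)
    then have "prob_word n (iter (- int n) z) / mass (tag z) < \<epsilon>" using m by (simp add: field_simps)
    then show "\<exists>n. snd z < ?e n + \<epsilon>" using bounds(2)[of n] by (intro exI[of _ n]) linarith
  qed
  then have 3: "height_of (\<psi> z) = snd z" unfolding height_of_def by simp
  show ?thesis unfolding decode_def 1 2 3 by simp
qed

definition u0 :: nat where "u0 = (SOME u. u \<in> I)"

lemma u0: "u0 \<in> I" unfolding u0_def using I_nonempty by (simp add: some_in_eq)

text \<open>The itinerary, extended by a constant to a Borel map of the whole space.\<close>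
definition code :: "('a \<times> nat) \<times> real \<Rightarrow> int \<Rightarrow> nat" where
  "code z = (if z \<in> Y0 then \<psi> z else (\<lambda>_. u0))"

lemma code_measurable: "code \<in> borel \<rightarrow>\<^sub>M P"
proof -
  have "(\<lambda>z. code z k) \<in> borel \<rightarrow>\<^sub>M count_space I" for k
  proof (rule measurableI)
    show "code z k \<in> space (count_space I)" for z using itinerary_eq(2) u0 by (auto simp: code_def)
    fix B assume "B \<in> sets (count_space I)"
    have "tag -` B \<inter> Y \<in> sets \<nu>"
      using measurable_sets_borel[OF tag_measurable, of B] Y_borel by (auto simp: sets_\<nu>)
    then have "{z \<in> Y0. iter k z \<in> tag -` B \<inter> Y} \<in> sets \<nu>"
      using iter_preimage[of k] by blast
    then have "{z \<in> Y0. iter k z \<in> tag -` B \<inter> Y} \<in> sets borel"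
      unfolding sets_\<nu> by (rule conjunct1)
    moreover have "(\<lambda>z. code z k) -` B \<inter> space borel =
        {z \<in> Y0. iter k z \<in> tag -` B \<inter> Y} \<union> (if u0 \<in> B then - Y0 else {})"
    proof (rule set_eqI)
      fix z
      show "z \<in> (\<lambda>z. code z k) -` B \<inter> space borel \<longleftrightarrow>
          z \<in> {z \<in> Y0. iter k z \<in> tag -` B \<inter> Y} \<union> (if u0 \<in> B then - Y0 else {})"
      proof (cases "z \<in> Y0")
        case True
        then have "iter k z \<in> Y" using int_iterate_in[OF Y0(4)] Y0_subset_Y by blast
        then show ?thesis using True by (simp add: code_def itinerary_eq(1))
      qed (simp add: code_def)
    qed
    ultimately show "(\<lambda>z. code z k) -` B \<inter> space borel \<in> sets borel" using Y0_borel by auto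
  qed
  then show ?thesis
    using itinerary_eq(2) u0 by (intro measurable_PiM_single') (auto simp: code_def space_PiM)
qed

lemma code_measurable_\<nu>: "code \<in> \<nu> \<rightarrow>\<^sub>M P"
proof (rule measurableI)
  show "code z \<in> space P" for z using measurable_space[OF code_measurable] by simp
  show "code -` E \<inter> space \<nu> \<in> sets \<nu>" if "E \<in> sets P" for E
    using measurable_sets_borel[OF code_measurable that] Y_borel by (auto simp: sets_\<nu> space_\<nu>)
qed

definition \<mu> :: "(int \<Rightarrow> nat) measure" where "\<mu> = distr \<nu> P code"

lemma space_\<mu>: "space \<mu> = space P" and sets_\<mu>: "sets \<mu> = sets P"
  by (simp_all add: \<mu>_def)

lemma emeasure_\<mu>:
  assumes E: "E \<in> sets P" shows "emeasure \<mu> E = emeasure \<nu> (\<psi> -` E \<inter> Y0)"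
proof -
  have "emeasure \<mu> E = emeasure \<nu> (code -` E \<inter> space \<nu>)"
    unfolding \<mu>_def by (rule emeasure_distr[OF code_measurable_\<nu> E])
  also have "\<dots> = emeasure \<nu> (code -` E \<inter> space \<nu> \<inter> Y0)"
    by (rule emeasure_Int_Y0[symmetric]) (rule measurable_sets[OF code_measurable_\<nu> E])
  also have "code -` E \<inter> space \<nu> \<inter> Y0 = \<psi> -` E \<inter> Y0"
    using Y0_subset_Y by (auto simp: code_def space_\<nu>)
  finally show ?thesis .
qed

lemma markov: "markov_measure I (lift_vector D H) (transition_matrix M N Z T \<alpha> D) \<mu>"
  unfolding markov_measure_def
proof (intro conjI allI impI)
  fix k :: int and w :: "nat list" assume w: "w \<noteq> [] \<and> set w \<subseteq> I"
  let ?E = "{b \<in> space P. \<forall>i\<in>{..<length w}. b (k + int i) = w ! i}"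
  have E: "?E \<in> sets P"
  proof (rule sets.sets_Collect_finite_All)
    fix i
    have "(\<lambda>b. b (k + int i)) -` {w ! i} \<inter> space P \<in> sets P"
      by (rule measurable_sets[OF coordinate_measurable]) simp
    also have "(\<lambda>b. b (k + int i)) -` {w ! i} \<inter> space P = {b \<in> space P. b (k + int i) = w ! i}" by auto
    finally show "{b \<in> space P. b (k + int i) = w ! i} \<in> sets P" .
  qed simp
  have "emeasure \<mu> {b \<in> space \<mu>. \<forall>i<length w. b (k + int i) = w ! i} = emeasure \<mu> ?E"
    by (simp add: space_\<mu> Ball_def)
  also have "\<dots> = emeasure \<nu> (\<psi> -` ?E \<inter> Y0)" by (rule emeasure_\<mu>[OF E])
  also have "\<psi> -` ?E \<inter> Y0 = {z \<in> Y0. iter k z \<in> cyl w}"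
  proof -
    have "\<psi> z \<in> ?E \<longleftrightarrow> iter k z \<in> cyl w" if z: "z \<in> Y0" for z
    proof -
      have "iter k z \<in> good_rugs" using int_iterate_in[OF Y0(4) z] Y0(2) by blast
      then show ?thesis
        using cyl_iff_future[of "iter k z" w] w itinerary_eq(2)[OF z]
        by (simp add: future_iter[OF z] space_P Ball_def)
    qed
    then show ?thesis by blast
  qed
  also have "emeasure \<nu> \<dots> = emeasure \<nu> (cyl w)"
    using iter_preimage cyl_measure(1) w by blast
  also have "\<dots> = ennreal (\<rho> (hd w) * mass (hd w) * weight w)"
    using cyl_measure(2) w by blast
  also have "\<rho> (hd w) * mass (hd w) * weight w =
      lift_vector D H (hd w) * (\<Prod>i<length w - 1. transition_matrix M N Z T \<alpha> D (w ! i) (w ! Suc i))"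
  proof -
    have "hd w \<in> I" using w by auto
    moreover have "(\<Prod>i<length w - 1. transition_matrix M N Z T \<alpha> D (w ! i) (w ! Suc i)) = weight w"
      unfolding weight_eq_prod
    proof (rule prod.cong[OF refl])
      fix i assume "i \<in> {..<length w - 1}"
      then have "w ! i \<in> set w" "w ! Suc i \<in> set w" by auto
      then have "w ! i \<in> \<alpha>" "w ! Suc i \<in> \<alpha>" using w I_subset by blast+
      then show "transition_matrix M N Z T \<alpha> D (w ! i) (w ! Suc i) = transition (w ! i) (w ! Suc i)"
        by (rule transition_matrix_eq)
    qed
    ultimately show ?thesis by (simp add: lift_vector_eq)
  qed
  finally show "emeasure \<mu> {b \<in> space \<mu>. \<forall>i<length w. b (k + int i) = w ! i} =
      ennreal (lift_vector D H (hd w) * (\<Prod>i<length w - 1. transition_matrix M N Z T \<alpha> D (w ! i) (w ! Suc i)))" .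
qed (rule sets_\<mu>)

text \<open>
  The set of itineraries of points of \<open>Y0\<close>, described by means of the inverse, because in this form
  it is measurable.
\<close>
definition \<Omega>0 :: "(int \<Rightarrow> nat) set" where
  "\<Omega>0 = {\<omega> \<in> space P. decode \<omega> \<in> Y0 \<and> (\<forall>k. code (decode \<omega>) k = \<omega> k)}"

lemma \<Omega>0_sets: "\<Omega>0 \<in> sets P"
proof -
  have cd: "(\<lambda>\<omega>. code (decode \<omega>) k) \<in> P \<rightarrow>\<^sub>M count_space UNIV" for k
    by (rule measurable_compose[OF measurable_compose[OF decode_measurable code_measurable] coordinate_measurable])
  have "{\<omega> \<in> space P. code (decode \<omega>) k = \<omega> k} \<in> sets P" for k
  proof -
    have "{\<omega> \<in> space P. code (decode \<omega>) k = \<omega> k} =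
        (\<Union>u. ((\<lambda>\<omega>. code (decode \<omega>) k) -` {u} \<inter> space P) \<inter> ((\<lambda>\<omega>. \<omega> k) -` {u} \<inter> space P))"
      by auto
    also have "\<dots> \<in> sets P"
      by (intro sets.countable_UN'' sets.Int measurable_sets[OF cd] measurable_sets[OF coordinate_measurable]) simp_all
    finally show ?thesis .
  qed
  then have "{\<omega> \<in> space P. \<forall>k. code (decode \<omega>) k = \<omega> k} \<in> sets P"
    by (rule sets.sets_Collect_countable_All)
  moreover have "decode -` Y0 \<inter> space P \<in> sets P" by (rule measurable_sets[OF decode_measurable Y0_borel])
  moreover have "\<Omega>0 = (decode -` Y0 \<inter> space P) \<inter> {\<omega> \<in> space P. \<forall>k. code (decode \<omega>) k = \<omega> k}"
    by (auto simp: \<Omega>0_def)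
  ultimately show ?thesis by simp
qed

lemma \<Omega>0_eq: "\<Omega>0 = \<psi> ` Y0"
proof (intro subset_antisym subsetI)
  fix \<omega> assume "\<omega> \<in> \<Omega>0"
  then have "decode \<omega> \<in> Y0" "\<psi> (decode \<omega>) = \<omega>" by (auto simp: \<Omega>0_def code_def)
  then show "\<omega> \<in> \<psi> ` Y0" by (metis imageI)
next
  fix \<omega> assume "\<omega> \<in> \<psi> ` Y0"
  then obtain z where z: "z \<in> Y0" "\<omega> = \<psi> z" by auto
  then show "\<omega> \<in> \<Omega>0" using decode_itinerary itinerary_eq(2) by (auto simp: \<Omega>0_def code_def space_P)
qed

lemma itinerary_shift:
  assumes z: "z \<in> Y0" shows "\<psi> (F z) = left_shift (\<psi> z)"
proof
  fix k
  have "F z \<in> Y0" using Y0(4) z by (auto simp: bij_betw_def)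
  then show "\<psi> (F z) k = left_shift (\<psi> z) k"
    using int_iterate_map[OF Y0(4) z, of k] by (simp add: itinerary_eq(1) z left_shift_def)
qed

lemma isomorphism: "isomorphism_on Y0 \<Omega>0 \<nu> F \<mu> left_shift \<psi>"
  unfolding isomorphism_on_def
proof (intro conjI ballI)
  show "Y0 \<in> sets \<nu>" "emeasure \<nu> (space \<nu> - Y0) = 0" by (rule Y0)+
  show FY: "F \<in> Y0 \<rightarrow> Y0" using Y0(4) by (auto simp: bij_betw_def)
  show \<Omega>: "\<Omega>0 \<in> sets \<mu>" using \<Omega>0_sets by (simp add: sets_\<mu>)
  have "\<psi> -` (space P - \<Omega>0) \<inter> Y0 = {}" unfolding \<Omega>0_eq by auto
  then show "emeasure \<mu> (space \<mu> - \<Omega>0) = 0"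
    unfolding space_\<mu> using emeasure_\<mu>[of "space P - \<Omega>0"] \<Omega>0_sets by simp
  show "left_shift \<in> \<Omega>0 \<rightarrow> \<Omega>0"
    unfolding \<Omega>0_eq using itinerary_shift FY by (auto simp: Pi_iff) (metis image_eqI)
  have inj: "inj_on \<psi> Y0" by (rule inj_on_inverseI) (rule decode_itinerary)
  then show bij: "bij_betw \<psi> Y0 \<Omega>0" by (simp add: bij_betw_def \<Omega>0_eq)
  have "code \<in> restrict_space \<nu> Y0 \<rightarrow>\<^sub>M \<mu>"
    using measurable_restrict_space1[OF code_measurable_\<nu>] by (simp add: \<mu>_def)
  then have "\<psi> \<in> restrict_space \<nu> Y0 \<rightarrow>\<^sub>M \<mu>"
    by (rule measurable_cong[THEN iffD1, rotated]) (auto simp: space_restrict_space code_def)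
  then show "\<psi> \<in> restrict_space \<nu> Y0 \<rightarrow>\<^sub>M restrict_space \<mu> \<Omega>0"
    by (intro measurable_restrict_space2) (auto simp: \<Omega>0_eq space_restrict_space)
  have inv: "inv_into Y0 \<psi> \<omega> = decode \<omega>" if "\<omega> \<in> \<Omega>0" for \<omega>
    using that inj decode_itinerary unfolding \<Omega>0_eq by auto
  have dY: "decode \<omega> \<in> Y0" if "\<omega> \<in> \<Omega>0" for \<omega> using that by (simp add: \<Omega>0_def)
  have d: "decode \<in> restrict_space \<mu> \<Omega>0 \<rightarrow>\<^sub>M restrict_space \<nu> Y0"
  proof (rule measurable_restrict_space2)
    show "decode \<in> space (restrict_space \<mu> \<Omega>0) \<rightarrow> Y0" using dY by (auto simp: space_restrict_space)
    have b: "decode \<in> restrict_space \<mu> \<Omega>0 \<rightarrow>\<^sub>M borel"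
      by (rule measurable_restrict_space1) (simp add: \<mu>_def decode_measurable)
    show "decode \<in> restrict_space \<mu> \<Omega>0 \<rightarrow>\<^sub>M \<nu>"
    proof (rule measurableI)
      show "decode \<omega> \<in> space \<nu>" if "\<omega> \<in> space (restrict_space \<mu> \<Omega>0)" for \<omega>
        using that dY Y0_subset_Y by (auto simp: space_restrict_space space_\<nu>)
      show "decode -` E \<inter> space (restrict_space \<mu> \<Omega>0) \<in> sets (restrict_space \<mu> \<Omega>0)" if "E \<in> sets \<nu>" for E
        using measurable_sets[OF b] that by (simp add: sets_\<nu>)
    qed
  qed
  then show "inv_into Y0 \<psi> \<in> restrict_space \<mu> \<Omega>0 \<rightarrow>\<^sub>M restrict_space \<nu> Y0"
    by (rule measurable_cong[THEN iffD1, rotated]) (auto simp: space_restrict_space inv)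
  show "emeasure \<mu> E = emeasure \<nu> (\<psi> -` E \<inter> Y0)" if "E \<in> sets \<mu>" for E
    using that emeasure_\<mu> by (simp add: sets_\<mu>)
  show "\<psi> (F z) = left_shift (\<psi> z)" if "z \<in> Y0" for z using that by (rule itinerary_shift)
qed

end

end

theorem proposition5:
  fixes M :: "'a::euclidean_space measure" and X :: "'a set" and N :: nat
    and Z :: "nat \<Rightarrow> 'a set" and T :: "'a \<Rightarrow> 'a" and s :: "nat \<Rightarrow> real"
    and \<alpha> :: "nat set" and D :: "nat \<Rightarrow> 'a set" and H :: "('a \<times> nat) measure"
  assumes system: "piecewise_system M X N Z T s"
    and no_atoms: "\<forall>x\<in>X. emeasure M {x} = 0"
    and tower: "hofbauer_tower M X N Z T s \<alpha> D"
    and lift: "lifts_to M N Z T \<alpha> D H"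
  shows "\<exists>Y\<^sub>0 \<Omega>\<^sub>0 m.
    bij_betw (rug_map M N Z T s \<alpha> D H) Y\<^sub>0 Y\<^sub>0 \<and>
    markov_measure (kept \<alpha> D H) (lift_vector D H) (transition_matrix M N Z T \<alpha> D) m \<and>
    isomorphism_on Y\<^sub>0 \<Omega>\<^sub>0
      (rug_measure M \<alpha> D H) (rug_map M N Z T s \<alpha> D H)
      m left_shift
      (itinerary M N Z T s \<alpha> D H Y\<^sub>0)"
proof -
  interpret tw: hofbauer_tower M X N Z T s \<alpha> D by (rule tower)
  obtain G where G: "tw.good_set G" using tw.good_set_exists by blast
  interpret atomless_lift M X N Z T s \<alpha> D G H
    by unfold_locales (use G lift no_atoms in auto)
  obtain Y0 where Y0: "Y0 \<in> sets \<nu>" "Y0 \<subseteq> good_rugs" "emeasure \<nu> (space \<nu> - Y0) = 0" "bij_betw F Y0 Y0"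
    "\<And>z \<epsilon>. z \<in> Y0 \<Longrightarrow> \<epsilon> > 0 \<Longrightarrow> \<exists>n. \<forall>z'\<in>good_rugs. (F ^^ n) z' = z \<longrightarrow> prob_word n z' < \<epsilon>"
    using contracting_core by metis
  show ?thesis using Y0(4) markov[OF Y0] isomorphism[OF Y0] by blast
qed

end
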